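(* Let $\mathcal C'\xrightarrow{f}\mathcal C\xrightarrow{F}\mathcal C''$ be an exact sequence of fusion categories over a field $\Bbbk$, and assume that $\mathcal C$ is pointed. Then $\mathcal C'$ and $\mathcal C''$ are pointed too, and we have an exact sequence of groups $$1\to G'\to G\to G''\to1,$$ where $G$, $G'$, $G''$ denote the Picard groups of $\mathcal C$, $\mathcal C'$, $\mathcal C''$ respectively. Moreover, up to equivalence, such an exact sequence of fusion categories is of the form $$\mathcal C(G',1)\to\mathcal C(G,\mathrm{infl}(\alpha))\to\mathcal C(G'',\alpha),$$ where $1\to G'\to G\to G''\to1$ is an exact sequence of finite groups, $\alpha$ is a cohomology class in $H^3(G'',\Bbbk^\times)$, and $\mathrm{infl}:H^3(G'',\Bbbk^\times)\to H^3(G,\Bbbk^\times)$ denotes the inflation map.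
   Context: A tensor category over $\Bbbk$ is a $\Bbbk$-linear abelian rigid monoidal category with finite-dimensional Hom spaces, all objects of finite length, monoidal product $\Bbbk$-linear in each variable, and $\operatorname{End}(\mathbf 1)=\Bbbk$. A fusion category is a split semisimple tensor category with finitely many isomorphism classes of simple objects (split: simple objects $X$ satisfy $\operatorname{End}(X)=\Bbbk$). A tensor functor is a $\Bbbk$-linear exact strong monoidal functor. An object is trivial if isomorphic to $\mathbf 1^n$ for some $n$. For a tensor functor $F:\mathcal C\to\mathcal D$: $\mathfrak{Ker}_F\subset\mathcal C$ is the full subcategory of objects $X$ with $F(X)$ trivial; $F$ is dominant if every object of $\mathcal D$ is a subobject of $F(X)$ for some $X$; $F$ is normal if every $X$ in $\mathcal C$ has a subobject $X_0$ such that $F(X_0)$ is the largest trivial subobject of $F(X)$. A sequence of tensor functors $\mathcal C'\xrightarrow{f}\mathcal C\xrightarrow{F}\mathcal C''$ is exact if $F$ is dominant and normal, $f$ is a full embedding and the essential image of $f$ is $\mathfrak{Ker}_F$. A pointed category is a fusion category all of whose simple objects are invertible; its Picard group is the finite group of isomorphism classes of simple objects under tensor product. For a finite group $G$ and $\alpha\in H^3(G,\Bbbk^\times)$ (trivial action), $\mathcal C(G,\alpha)$ is the fusion category of finite-dimensional $G$-graded vector spaces over $\Bbbk$ with associativity constraint given by a 3-cocycle representing $\alpha$. "Up to equivalence" means up to tensor equivalences of the three categories making the diagram of tensor functors commute up to tensor isomorphism. *)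

theory Defs
  imports Jordan_Normal_Form.VS_Connect
begin

section \<open>Categories and linear categories\<close>

text \<open>
  Categories have a carrier set of objects and a carrier set of arrows. Nothing is
  assumed about the data outside these carriers.
\<close>

record ('o, 'm) category_data =
  Obj :: "'o set"
  Arr :: "'m set"
  Dom :: "'m \<Rightarrow> 'o"
  Cod :: "'m \<Rightarrow> 'o"
  ident :: "'o \<Rightarrow> 'm"
  cmp :: "'m \<Rightarrow> 'm \<Rightarrow> 'm"  (\<open>(_ \<diamondop>\<index> _)\<close> [56, 55] 55)

definition Hom :: "('o, 'm, 'z) category_data_scheme \<Rightarrow> 'o \<Rightarrow> 'o \<Rightarrow> 'm set" where
  "Hom C X Y = {f \<in> Arr C. Dom C f = X \<and> Cod C f = Y}"

locale category =
  fixes C :: "('o, 'm, 'z) category_data_scheme" (structure)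
  assumes Dom_Obj: "f \<in> Arr C \<Longrightarrow> Dom C f \<in> Obj C"
    and Cod_Obj: "f \<in> Arr C \<Longrightarrow> Cod C f \<in> Obj C"
    and ident_Hom: "X \<in> Obj C \<Longrightarrow> ident C X \<in> Hom C X X"
    and cmp_Hom: "f \<in> Hom C X Y \<Longrightarrow> g \<in> Hom C Y Z \<Longrightarrow> g \<diamondop> f \<in> Hom C X Z"
    and cmp_ident_right: "f \<in> Hom C X Y \<Longrightarrow> f \<diamondop> ident C X = f"
    and cmp_ident_left: "f \<in> Hom C X Y \<Longrightarrow> ident C Y \<diamondop> f = f"
    and cmp_assoc: "f \<in> Hom C W X \<Longrightarrow> g \<in> Hom C X Y \<Longrightarrow> h \<in> Hom C Y Z \<Longrightarrow>
      (h \<diamondop> g) \<diamondop> f = h \<diamondop> g \<diamondop> f"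

definition is_mono :: "('o, 'm, 'z) category_data_scheme \<Rightarrow> 'm \<Rightarrow> bool" where
  "is_mono C f \<longleftrightarrow> f \<in> Arr C \<and>
    (\<forall>X. \<forall>g \<in> Hom C X (Dom C f). \<forall>h \<in> Hom C X (Dom C f).
      f \<diamondop>\<^bsub>C\<^esub> g = f \<diamondop>\<^bsub>C\<^esub> h \<longrightarrow> g = h)"

definition is_epi :: "('o, 'm, 'z) category_data_scheme \<Rightarrow> 'm \<Rightarrow> bool" where
  "is_epi C f \<longleftrightarrow> f \<in> Arr C \<and>
    (\<forall>Y. \<forall>g \<in> Hom C (Cod C f) Y. \<forall>h \<in> Hom C (Cod C f) Y.
      g \<diamondop>\<^bsub>C\<^esub> f = h \<diamondop>\<^bsub>C\<^esub> f \<longrightarrow> g = h)"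

definition inverse_arrows :: "('o, 'm, 'z) category_data_scheme \<Rightarrow> 'm \<Rightarrow> 'm \<Rightarrow> bool" where
  "inverse_arrows C f g \<longleftrightarrow> f \<in> Arr C \<and> g \<in> Hom C (Cod C f) (Dom C f) \<and>
    g \<diamondop>\<^bsub>C\<^esub> f = ident C (Dom C f) \<and> f \<diamondop>\<^bsub>C\<^esub> g = ident C (Cod C f)"

definition is_iso :: "('o, 'm, 'z) category_data_scheme \<Rightarrow> 'm \<Rightarrow> bool" where
  "is_iso C f \<longleftrightarrow> (\<exists>g. inverse_arrows C f g)"

definition arr_inv :: "('o, 'm, 'z) category_data_scheme \<Rightarrow> 'm \<Rightarrow> 'm" where
  "arr_inv C f = (THE g. inverse_arrows C f g)"

definition isomorphic :: "('o, 'm, 'z) category_data_scheme \<Rightarrow> 'o \<Rightarrow> 'o \<Rightarrow> bool" where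
  "isomorphic C X Y \<longleftrightarrow> X \<in> Obj C \<and> Y \<in> Obj C \<and> (\<exists>f \<in> Hom C X Y. is_iso C f)"

definition iso_class :: "('o, 'm, 'z) category_data_scheme \<Rightarrow> 'o \<Rightarrow> 'o set" where
  "iso_class C X = {Y. isomorphic C X Y}"

definition is_zero_object :: "('o, 'm, 'z) category_data_scheme \<Rightarrow> 'o \<Rightarrow> bool" where
  "is_zero_object C Z \<longleftrightarrow> Z \<in> Obj C \<and>
    (\<forall>X \<in> Obj C. (\<exists>!f. f \<in> Hom C X Z) \<and> (\<exists>!f. f \<in> Hom C Z X))"

record ('o, 'm, 'k) linear_category_data = "('o, 'm) category_data" +
  ladd :: "'m \<Rightarrow> 'm \<Rightarrow> 'm"
  lzero :: "'o \<Rightarrow> 'o \<Rightarrow> 'm"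
  lsmult :: "'k \<Rightarrow> 'm \<Rightarrow> 'm"

text \<open>
  A Hom set as a vector space. The fields \<open>mult\<close> and \<open>one\<close> belong to the record type of
  modules but play no role in the axioms of a module.
\<close>

definition hom_space ::
  "('o, 'm, 'k, 'z) linear_category_data_scheme \<Rightarrow> 'o \<Rightarrow> 'o \<Rightarrow> ('k, 'm) module" where
  "hom_space C X Y = \<lparr>carrier = Hom C X Y, mult = undefined, one = undefined,
     zero = lzero C X Y, add = ladd C, smult = lsmult C\<rparr>"

locale linear_category = category C
  for C :: "('o, 'm, 'k :: field, 'z) linear_category_data_scheme" (structure) +
  assumes hom_vectorspace:
      "X \<in> Obj C \<Longrightarrow> Y \<in> Obj C \<Longrightarrow> vectorspace class_ring (hom_space C X Y)"
    and cmp_ladd_left: "f \<in> Hom C X Y \<Longrightarrow> g \<in> Hom C Y Z \<Longrightarrow> g' \<in> Hom C Y Z \<Longrightarrow>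
      (ladd C g g') \<diamondop> f = ladd C (g \<diamondop> f) (g' \<diamondop> f)"
    and cmp_ladd_right: "f \<in> Hom C X Y \<Longrightarrow> f' \<in> Hom C X Y \<Longrightarrow> g \<in> Hom C Y Z \<Longrightarrow>
      g \<diamondop> (ladd C f f') = ladd C (g \<diamondop> f) (g \<diamondop> f')"
    and cmp_lsmult_left: "f \<in> Hom C X Y \<Longrightarrow> g \<in> Hom C Y Z \<Longrightarrow>
      (lsmult C c g) \<diamondop> f = lsmult C c (g \<diamondop> f)"
    and cmp_lsmult_right: "f \<in> Hom C X Y \<Longrightarrow> g \<in> Hom C Y Z \<Longrightarrow>
      g \<diamondop> (lsmult C c f) = lsmult C c (g \<diamondop> f)"


section \<open>Abelian categories, finite length, semisimplicity\<close>

definition is_kernel ::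
  "('o, 'm, 'k, 'z) linear_category_data_scheme \<Rightarrow> 'm \<Rightarrow> 'm \<Rightarrow> bool" where
  "is_kernel C f k \<longleftrightarrow> f \<in> Arr C \<and> k \<in> Arr C \<and> Cod C k = Dom C f \<and>
    f \<diamondop>\<^bsub>C\<^esub> k = lzero C (Dom C k) (Cod C f) \<and>
    (\<forall>W. \<forall>h \<in> Hom C W (Dom C f). f \<diamondop>\<^bsub>C\<^esub> h = lzero C W (Cod C f) \<longrightarrow>
      (\<exists>!u. u \<in> Hom C W (Dom C k) \<and> k \<diamondop>\<^bsub>C\<^esub> u = h))"

definition is_cokernel ::
  "('o, 'm, 'k, 'z) linear_category_data_scheme \<Rightarrow> 'm \<Rightarrow> 'm \<Rightarrow> bool" where
  "is_cokernel C f q \<longleftrightarrow> f \<in> Arr C \<and> q \<in> Arr C \<and> Dom C q = Cod C f \<and>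
    q \<diamondop>\<^bsub>C\<^esub> f = lzero C (Dom C f) (Cod C q) \<and>
    (\<forall>W. \<forall>h \<in> Hom C (Cod C f) W. h \<diamondop>\<^bsub>C\<^esub> f = lzero C (Dom C f) W \<longrightarrow>
      (\<exists>!u. u \<in> Hom C (Cod C q) W \<and> u \<diamondop>\<^bsub>C\<^esub> q = h))"

text \<open>
  \<open>X\<close> is a direct sum (biproduct) of a finite list of objects; an empty list gives a zero
  object.
\<close>

definition is_direct_sum ::
  "('o, 'm, 'k, 'z) linear_category_data_scheme \<Rightarrow> 'o list \<Rightarrow> 'o \<Rightarrow> bool" where
  "is_direct_sum C Xs X \<longleftrightarrow> X \<in> Obj C \<and> set Xs \<subseteq> Obj C \<and>
    (\<exists>inj proj.
      (\<forall>i < length Xs. inj i \<in> Hom C (Xs ! i) X \<and> proj i \<in> Hom C X (Xs ! i)) \<and>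
      (\<forall>i < length Xs. \<forall>j < length Xs.
        proj j \<diamondop>\<^bsub>C\<^esub> inj i =
          (if i = j then ident C (Xs ! i) else lzero C (Xs ! i) (Xs ! j))) \<and>
      finsum (hom_space C X X) (\<lambda>i. inj i \<diamondop>\<^bsub>C\<^esub> proj i) {..<length Xs} = ident C X)"

locale abelian_category = linear_category C
  for C :: "('o, 'm, 'k :: field, 'z) linear_category_data_scheme" (structure) +
  assumes has_zero_object: "\<exists>Z. is_zero_object C Z"
    and has_biproducts: "X \<in> Obj C \<Longrightarrow> Y \<in> Obj C \<Longrightarrow> \<exists>S. is_direct_sum C [X, Y] S"
    and has_kernels: "f \<in> Arr C \<Longrightarrow> \<exists>k. is_kernel C f k"
    and has_cokernels: "f \<in> Arr C \<Longrightarrow> \<exists>q. is_cokernel C f q"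
    and mono_normal: "is_mono C f \<Longrightarrow> \<exists>g. is_kernel C g f"
    and epi_conormal: "is_epi C f \<Longrightarrow> \<exists>g. is_cokernel C g f"

definition simple_object :: "('o, 'm, 'z) category_data_scheme \<Rightarrow> 'o \<Rightarrow> bool" where
  "simple_object C S \<longleftrightarrow> S \<in> Obj C \<and> \<not> is_zero_object C S \<and>
    (\<forall>m. is_mono C m \<and> Cod C m = S \<longrightarrow> is_zero_object C (Dom C m) \<or> is_iso C m)"

text \<open>Existence of a composition series, built up from the bottom.\<close>

inductive finite_length ::
  "('o, 'm, 'k, 'z) linear_category_data_scheme \<Rightarrow> 'o \<Rightarrow> bool"
  for C :: "('o, 'm, 'k, 'z) linear_category_data_scheme" where
  zero: "is_zero_object C X \<Longrightarrow> finite_length C X"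
| step: "finite_length C (Dom C i) \<Longrightarrow> is_mono C i \<Longrightarrow> is_cokernel C i q \<Longrightarrow>
    simple_object C (Cod C q) \<Longrightarrow> finite_length C (Cod C i)"

definition semisimple_object ::
  "('o, 'm, 'k, 'z) linear_category_data_scheme \<Rightarrow> 'o \<Rightarrow> bool" where
  "semisimple_object C X \<longleftrightarrow>
    (\<exists>Ss. (\<forall>S \<in> set Ss. simple_object C S) \<and> is_direct_sum C Ss X)"

text \<open>\<open>End(X) = \<k>\<close>: every endomorphism is a unique scalar multiple of the identity.\<close>

definition scalar_endos ::
  "('o, 'm, 'k, 'z) linear_category_data_scheme \<Rightarrow> 'o \<Rightarrow> bool" where
  "scalar_endos C X \<longleftrightarrow> bij_betw (\<lambda>c. lsmult C c (ident C X)) UNIV (Hom C X X)"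


section \<open>Tensor categories, fusion categories, pointed categories\<close>

record ('o, 'm, 'k) tensor_category_data = "('o, 'm, 'k) linear_category_data" +
  tunit :: 'o
  tobj :: "'o \<Rightarrow> 'o \<Rightarrow> 'o"
  tarr :: "'m \<Rightarrow> 'm \<Rightarrow> 'm"
  assoc :: "'o \<Rightarrow> 'o \<Rightarrow> 'o \<Rightarrow> 'm"
  lunit :: "'o \<Rightarrow> 'm"
  runit :: "'o \<Rightarrow> 'm"

locale monoidal_category = category C
  for C :: "('o, 'm, 'k, 'z) tensor_category_data_scheme" (structure) +
  assumes tunit_Obj: "tunit C \<in> Obj C"
    and tobj_Obj: "X \<in> Obj C \<Longrightarrow> Y \<in> Obj C \<Longrightarrow> tobj C X Y \<in> Obj C"
    and tarr_Hom: "f \<in> Hom C X X' \<Longrightarrow> g \<in> Hom C Y Y' \<Longrightarrow>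
      tarr C f g \<in> Hom C (tobj C X Y) (tobj C X' Y')"
    and tarr_ident: "X \<in> Obj C \<Longrightarrow> Y \<in> Obj C \<Longrightarrow>
      tarr C (ident C X) (ident C Y) = ident C (tobj C X Y)"
    and tarr_cmp: "f \<in> Hom C X X' \<Longrightarrow> f' \<in> Hom C X' X'' \<Longrightarrow>
      g \<in> Hom C Y Y' \<Longrightarrow> g' \<in> Hom C Y' Y'' \<Longrightarrow>
      tarr C (f' \<diamondop> f) (g' \<diamondop> g) = tarr C f' g' \<diamondop> tarr C f g"
    and assoc_Hom: "X \<in> Obj C \<Longrightarrow> Y \<in> Obj C \<Longrightarrow> Z \<in> Obj C \<Longrightarrow>
      assoc C X Y Z \<in> Hom C (tobj C (tobj C X Y) Z) (tobj C X (tobj C Y Z))"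
    and assoc_iso: "X \<in> Obj C \<Longrightarrow> Y \<in> Obj C \<Longrightarrow> Z \<in> Obj C \<Longrightarrow> is_iso C (assoc C X Y Z)"
    and assoc_natural: "f \<in> Hom C X X' \<Longrightarrow> g \<in> Hom C Y Y' \<Longrightarrow> h \<in> Hom C Z Z' \<Longrightarrow>
      assoc C X' Y' Z' \<diamondop> tarr C (tarr C f g) h = tarr C f (tarr C g h) \<diamondop> assoc C X Y Z"
    and lunit_Hom: "X \<in> Obj C \<Longrightarrow> lunit C X \<in> Hom C (tobj C (tunit C) X) X"
    and lunit_iso: "X \<in> Obj C \<Longrightarrow> is_iso C (lunit C X)"
    and lunit_natural: "f \<in> Hom C X Y \<Longrightarrow>
      lunit C Y \<diamondop> tarr C (ident C (tunit C)) f = f \<diamondop> lunit C X"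
    and runit_Hom: "X \<in> Obj C \<Longrightarrow> runit C X \<in> Hom C (tobj C X (tunit C)) X"
    and runit_iso: "X \<in> Obj C \<Longrightarrow> is_iso C (runit C X)"
    and runit_natural: "f \<in> Hom C X Y \<Longrightarrow>
      runit C Y \<diamondop> tarr C f (ident C (tunit C)) = f \<diamondop> runit C X"
    and pentagon: "W \<in> Obj C \<Longrightarrow> X \<in> Obj C \<Longrightarrow> Y \<in> Obj C \<Longrightarrow> Z \<in> Obj C \<Longrightarrow>
      assoc C W X (tobj C Y Z) \<diamondop> assoc C (tobj C W X) Y Z =
      tarr C (ident C W) (assoc C X Y Z) \<diamondop> assoc C W (tobj C X Y) Z
        \<diamondop> tarr C (assoc C W X Y) (ident C Z)"
    and triangle: "X \<in> Obj C \<Longrightarrow> Y \<in> Obj C \<Longrightarrow>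
      tarr C (ident C X) (lunit C Y) \<diamondop> assoc C X (tunit C) Y =
      tarr C (runit C X) (ident C Y)"

text \<open>
  \<open>Y\<close> is a left dual of \<open>X\<close> (equivalently, \<open>X\<close> is a right dual of \<open>Y\<close>), with
  evaluation \<open>ev : Y \<otimes> X \<rightarrow> 1\<close> and coevaluation \<open>coev : 1 \<rightarrow> X \<otimes> Y\<close>.
\<close>

definition is_left_dual ::
  "('o, 'm, 'k, 'z) tensor_category_data_scheme \<Rightarrow> 'o \<Rightarrow> 'o \<Rightarrow> bool" where
  "is_left_dual C X Y \<longleftrightarrow> X \<in> Obj C \<and> Y \<in> Obj C \<and>
    (\<exists>ev \<in> Hom C (tobj C Y X) (tunit C). \<exists>coev \<in> Hom C (tunit C) (tobj C X Y).
      runit C X \<diamondop>\<^bsub>C\<^esub> tarr C (ident C X) ev \<diamondop>\<^bsub>C\<^esub> assoc C X Y X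
        \<diamondop>\<^bsub>C\<^esub> tarr C coev (ident C X) = lunit C X \<and>
      lunit C Y \<diamondop>\<^bsub>C\<^esub> tarr C ev (ident C Y) \<diamondop>\<^bsub>C\<^esub> arr_inv C (assoc C Y X Y)
        \<diamondop>\<^bsub>C\<^esub> tarr C (ident C Y) coev = runit C Y)"

locale tensor_category = abelian_category C + monoidal_category C
  for C :: "('o, 'm, 'k :: field, 'z) tensor_category_data_scheme" (structure) +
  assumes tarr_ladd_left: "f \<in> Hom C X X' \<Longrightarrow> f' \<in> Hom C X X' \<Longrightarrow> g \<in> Hom C Y Y' \<Longrightarrow>
      tarr C (ladd C f f') g = ladd C (tarr C f g) (tarr C f' g)"
    and tarr_ladd_right: "f \<in> Hom C X X' \<Longrightarrow> g \<in> Hom C Y Y' \<Longrightarrow> g' \<in> Hom C Y Y' \<Longrightarrow>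
      tarr C f (ladd C g g') = ladd C (tarr C f g) (tarr C f g')"
    and tarr_lsmult_left: "f \<in> Hom C X X' \<Longrightarrow> g \<in> Hom C Y Y' \<Longrightarrow>
      tarr C (lsmult C c f) g = lsmult C c (tarr C f g)"
    and tarr_lsmult_right: "f \<in> Hom C X X' \<Longrightarrow> g \<in> Hom C Y Y' \<Longrightarrow>
      tarr C f (lsmult C c g) = lsmult C c (tarr C f g)"
    and has_left_dual: "X \<in> Obj C \<Longrightarrow> \<exists>Y. is_left_dual C X Y"
    and has_right_dual: "X \<in> Obj C \<Longrightarrow> \<exists>Y. is_left_dual C Y X"
    and hom_fin_dim: "X \<in> Obj C \<Longrightarrow> Y \<in> Obj C \<Longrightarrow>
      vectorspace.fin_dim class_ring (hom_space C X Y)"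
    and objects_finite_length: "X \<in> Obj C \<Longrightarrow> finite_length C X"
    and tunit_scalar_endos: "scalar_endos C (tunit C)"

locale fusion_category = tensor_category C
  for C :: "('o, 'm, 'k :: field, 'z) tensor_category_data_scheme" (structure) +
  assumes semisimple: "X \<in> Obj C \<Longrightarrow> semisimple_object C X"
    and split: "simple_object C X \<Longrightarrow> scalar_endos C X"
    and finitely_many_simples: "finite (iso_class C ` {X. simple_object C X})"

definition invertible_object ::
  "('o, 'm, 'k, 'z) tensor_category_data_scheme \<Rightarrow> 'o \<Rightarrow> bool" where
  "invertible_object C X \<longleftrightarrow> X \<in> Obj C \<and>
    (\<exists>Y \<in> Obj C. isomorphic C (tobj C X Y) (tunit C) \<and> isomorphic C (tobj C Y X) (tunit C))"

locale pointed_category = fusion_category C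
  for C :: "('o, 'm, 'k :: field, 'z) tensor_category_data_scheme" (structure) +
  assumes simple_invertible: "simple_object C X \<Longrightarrow> invertible_object C X"

text \<open>
  The product of two isomorphism classes is the isomorphism class of the tensor product of
  any representatives; all members of the union below coincide.
\<close>

definition Picard ::
  "('o, 'm, 'k, 'z) tensor_category_data_scheme \<Rightarrow> 'o set monoid" where
  "Picard C = \<lparr>carrier = iso_class C ` {X. simple_object C X},
     mult = (\<lambda>A B. \<Union>X \<in> A. \<Union>Y \<in> B. iso_class C (tobj C X Y)),
     one = iso_class C (tunit C)\<rparr>"


section \<open>Tensor functors\<close>

record ('o1, 'm1, 'o2, 'm2) functor_data =
  fobj :: "'o1 \<Rightarrow> 'o2"
  farr :: "'m1 \<Rightarrow> 'm2"

definition is_functor :: "('o1, 'm1, 'y) category_data_scheme \<Rightarrow>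
    ('o2, 'm2, 'z) category_data_scheme \<Rightarrow>
    ('o1, 'm1, 'o2, 'm2, 'w) functor_data_scheme \<Rightarrow> bool" where
  "is_functor C D F \<longleftrightarrow>
    (\<forall>X \<in> Obj C. fobj F X \<in> Obj D) \<and>
    (\<forall>X Y. \<forall>f \<in> Hom C X Y. farr F f \<in> Hom D (fobj F X) (fobj F Y)) \<and>
    (\<forall>X \<in> Obj C. farr F (ident C X) = ident D (fobj F X)) \<and>
    (\<forall>X Y Z. \<forall>f \<in> Hom C X Y. \<forall>g \<in> Hom C Y Z.
      farr F (g \<diamondop>\<^bsub>C\<^esub> f) = farr F g \<diamondop>\<^bsub>D\<^esub> farr F f)"

definition natural_iso :: "('o1, 'm1, 'y) category_data_scheme \<Rightarrow>
    ('o2, 'm2, 'z) category_data_scheme \<Rightarrow>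
    ('o1, 'm1, 'o2, 'm2, 'v) functor_data_scheme \<Rightarrow>
    ('o1, 'm1, 'o2, 'm2, 'w) functor_data_scheme \<Rightarrow> ('o1 \<Rightarrow> 'm2) \<Rightarrow> bool" where
  "natural_iso C D F G \<eta> \<longleftrightarrow>
    (\<forall>X \<in> Obj C. \<eta> X \<in> Hom D (fobj F X) (fobj G X) \<and> is_iso D (\<eta> X)) \<and>
    (\<forall>X Y. \<forall>f \<in> Hom C X Y. \<eta> Y \<diamondop>\<^bsub>D\<^esub> farr F f = farr G f \<diamondop>\<^bsub>D\<^esub> \<eta> X)"

definition id_functor :: "('o, 'm, 'o, 'm) functor_data" where
  "id_functor = \<lparr>fobj = (\<lambda>X. X), farr = (\<lambda>f. f)\<rparr>"

definition comp_functor :: "('o2, 'm2, 'o3, 'm3, 'v) functor_data_scheme \<Rightarrow>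
    ('o1, 'm1, 'o2, 'm2, 'w) functor_data_scheme \<Rightarrow> ('o1, 'm1, 'o3, 'm3) functor_data" where
  "comp_functor G F = \<lparr>fobj = (\<lambda>X. fobj G (fobj F X)), farr = (\<lambda>f. farr G (farr F f))\<rparr>"

definition is_equivalence :: "('o1, 'm1, 'y) category_data_scheme \<Rightarrow>
    ('o2, 'm2, 'z) category_data_scheme \<Rightarrow>
    ('o1, 'm1, 'o2, 'm2, 'w) functor_data_scheme \<Rightarrow> bool" where
  "is_equivalence C D F \<longleftrightarrow> is_functor C D F \<and>
    (\<exists>G :: ('o2, 'm2, 'o1, 'm1) functor_data. is_functor D C G \<and>
      (\<exists>\<eta>. natural_iso C C (comp_functor G F) id_functor \<eta>) \<and>
      (\<exists>\<epsilon>. natural_iso D D (comp_functor F G) id_functor \<epsilon>))"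

definition linear_functor :: "('o1, 'm1, 'k, 'y) linear_category_data_scheme \<Rightarrow>
    ('o2, 'm2, 'k, 'z) linear_category_data_scheme \<Rightarrow>
    ('o1, 'm1, 'o2, 'm2, 'w) functor_data_scheme \<Rightarrow> bool" where
  "linear_functor C D F \<longleftrightarrow> is_functor C D F \<and>
    (\<forall>X Y. \<forall>f \<in> Hom C X Y. \<forall>g \<in> Hom C X Y.
      farr F (ladd C f g) = ladd D (farr F f) (farr F g)) \<and>
    (\<forall>f \<in> Arr C. \<forall>c. farr F (lsmult C c f) = lsmult D c (farr F f))"

definition short_exact ::
  "('o, 'm, 'k, 'z) linear_category_data_scheme \<Rightarrow> 'm \<Rightarrow> 'm \<Rightarrow> bool" where
  "short_exact C f g \<longleftrightarrow> is_kernel C g f \<and> is_cokernel C f g"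

definition exact_functor :: "('o1, 'm1, 'k, 'y) linear_category_data_scheme \<Rightarrow>
    ('o2, 'm2, 'k, 'z) linear_category_data_scheme \<Rightarrow>
    ('o1, 'm1, 'o2, 'm2, 'w) functor_data_scheme \<Rightarrow> bool" where
  "exact_functor C D F \<longleftrightarrow> linear_functor C D F \<and>
    (\<forall>f g. short_exact C f g \<longrightarrow> short_exact D (farr F f) (farr F g))"

text \<open>
  \<open>fmult F X Y : F X \<otimes> F Y \<rightarrow> F (X \<otimes> Y)\<close> and \<open>funit F : 1 \<rightarrow> F 1\<close> are the structure
  isomorphisms of a strong monoidal functor.
\<close>

record ('o1, 'm1, 'o2, 'm2) tensor_functor_data = "('o1, 'm1, 'o2, 'm2) functor_data" +
  fmult :: "'o1 \<Rightarrow> 'o1 \<Rightarrow> 'm2"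
  funit :: 'm2

definition strong_monoidal :: "('o1, 'm1, 'k, 'y) tensor_category_data_scheme \<Rightarrow>
    ('o2, 'm2, 'k, 'z) tensor_category_data_scheme \<Rightarrow>
    ('o1, 'm1, 'o2, 'm2, 'w) tensor_functor_data_scheme \<Rightarrow> bool" where
  "strong_monoidal C D F \<longleftrightarrow> is_functor C D F \<and>
    (\<forall>X \<in> Obj C. \<forall>Y \<in> Obj C.
      fmult F X Y \<in> Hom D (tobj D (fobj F X) (fobj F Y)) (fobj F (tobj C X Y)) \<and>
      is_iso D (fmult F X Y)) \<and>
    (\<forall>X X' Y Y'. \<forall>f \<in> Hom C X X'. \<forall>g \<in> Hom C Y Y'.
      fmult F X' Y' \<diamondop>\<^bsub>D\<^esub> tarr D (farr F f) (farr F g) =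
      farr F (tarr C f g) \<diamondop>\<^bsub>D\<^esub> fmult F X Y) \<and>
    funit F \<in> Hom D (tunit D) (fobj F (tunit C)) \<and> is_iso D (funit F) \<and>
    (\<forall>X \<in> Obj C. \<forall>Y \<in> Obj C. \<forall>Z \<in> Obj C.
      farr F (assoc C X Y Z) \<diamondop>\<^bsub>D\<^esub> fmult F (tobj C X Y) Z
        \<diamondop>\<^bsub>D\<^esub> tarr D (fmult F X Y) (ident D (fobj F Z)) =
      fmult F X (tobj C Y Z) \<diamondop>\<^bsub>D\<^esub> tarr D (ident D (fobj F X)) (fmult F Y Z)
        \<diamondop>\<^bsub>D\<^esub> assoc D (fobj F X) (fobj F Y) (fobj F Z)) \<and>
    (\<forall>X \<in> Obj C.
      farr F (lunit C X) \<diamondop>\<^bsub>D\<^esub> fmult F (tunit C) X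
        \<diamondop>\<^bsub>D\<^esub> tarr D (funit F) (ident D (fobj F X)) = lunit D (fobj F X)) \<and>
    (\<forall>X \<in> Obj C.
      farr F (runit C X) \<diamondop>\<^bsub>D\<^esub> fmult F X (tunit C)
        \<diamondop>\<^bsub>D\<^esub> tarr D (ident D (fobj F X)) (funit F) = runit D (fobj F X))"

definition tensor_functor :: "('o1, 'm1, 'k, 'y) tensor_category_data_scheme \<Rightarrow>
    ('o2, 'm2, 'k, 'z) tensor_category_data_scheme \<Rightarrow>
    ('o1, 'm1, 'o2, 'm2, 'w) tensor_functor_data_scheme \<Rightarrow> bool" where
  "tensor_functor C D F \<longleftrightarrow> exact_functor C D F \<and> strong_monoidal C D F"

definition tensor_equivalence :: "('o1, 'm1, 'k, 'y) tensor_category_data_scheme \<Rightarrow>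
    ('o2, 'm2, 'k, 'z) tensor_category_data_scheme \<Rightarrow>
    ('o1, 'm1, 'o2, 'm2, 'w) tensor_functor_data_scheme \<Rightarrow> bool" where
  "tensor_equivalence C D F \<longleftrightarrow> tensor_functor C D F \<and> is_equivalence C D F"

text \<open>The composite \<open>G F\<close>; composing its structure maps takes place in the target \<open>E\<close> of \<open>G\<close>.\<close>

definition comp_tensor_functor :: "('o3, 'm3, 'k, 'z) tensor_category_data_scheme \<Rightarrow>
    ('o2, 'm2, 'o3, 'm3, 'v) tensor_functor_data_scheme \<Rightarrow>
    ('o1, 'm1, 'o2, 'm2, 'w) tensor_functor_data_scheme \<Rightarrow>
    ('o1, 'm1, 'o3, 'm3) tensor_functor_data" where
  "comp_tensor_functor E G F =
    \<lparr>fobj = (\<lambda>X. fobj G (fobj F X)), farr = (\<lambda>f. farr G (farr F f)),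
     fmult = (\<lambda>X Y. farr G (fmult F X Y) \<diamondop>\<^bsub>E\<^esub> fmult G (fobj F X) (fobj F Y)),
     funit = farr G (funit F) \<diamondop>\<^bsub>E\<^esub> funit G\<rparr>"

definition tensor_functor_isomorphic :: "('o1, 'm1, 'k, 'y) tensor_category_data_scheme \<Rightarrow>
    ('o2, 'm2, 'k, 'z) tensor_category_data_scheme \<Rightarrow>
    ('o1, 'm1, 'o2, 'm2, 'v) tensor_functor_data_scheme \<Rightarrow>
    ('o1, 'm1, 'o2, 'm2, 'w) tensor_functor_data_scheme \<Rightarrow> bool" where
  "tensor_functor_isomorphic C D F G \<longleftrightarrow>
    (\<exists>\<eta>. natural_iso C D F G \<eta> \<and>
      (\<forall>X \<in> Obj C. \<forall>Y \<in> Obj C.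
        \<eta> (tobj C X Y) \<diamondop>\<^bsub>D\<^esub> fmult F X Y = fmult G X Y \<diamondop>\<^bsub>D\<^esub> tarr D (\<eta> X) (\<eta> Y)) \<and>
      \<eta> (tunit C) \<diamondop>\<^bsub>D\<^esub> funit F = funit G)"


section \<open>Exact sequences\<close>

definition trivial_object ::
  "('o, 'm, 'k, 'z) tensor_category_data_scheme \<Rightarrow> 'o \<Rightarrow> bool" where
  "trivial_object C X \<longleftrightarrow> (\<exists>n. is_direct_sum C (replicate n (tunit C)) X)"

text \<open>The objects of the full subcategory \<open>Ker\<^sub>F\<close>.\<close>

definition kernel_objects :: "('o1, 'm1, 'k, 'y) tensor_category_data_scheme \<Rightarrow>
    ('o2, 'm2, 'k, 'z) tensor_category_data_scheme \<Rightarrow>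
    ('o1, 'm1, 'o2, 'm2, 'w) functor_data_scheme \<Rightarrow> 'o1 set" where
  "kernel_objects C D F = {X \<in> Obj C. trivial_object D (fobj F X)}"

definition essential_image :: "('o1, 'm1, 'y) category_data_scheme \<Rightarrow>
    ('o2, 'm2, 'z) category_data_scheme \<Rightarrow>
    ('o1, 'm1, 'o2, 'm2, 'w) functor_data_scheme \<Rightarrow> 'o2 set" where
  "essential_image C D F = {Y. \<exists>X \<in> Obj C. isomorphic D (fobj F X) Y}"

definition full_embedding :: "('o1, 'm1, 'y) category_data_scheme \<Rightarrow>
    ('o2, 'm2, 'z) category_data_scheme \<Rightarrow>
    ('o1, 'm1, 'o2, 'm2, 'w) functor_data_scheme \<Rightarrow> bool" where
  "full_embedding C D F \<longleftrightarrow>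
    (\<forall>X \<in> Obj C. \<forall>Y \<in> Obj C.
      bij_betw (farr F) (Hom C X Y) (Hom D (fobj F X) (fobj F Y)))"

definition dominant_functor :: "('o1, 'm1, 'y) category_data_scheme \<Rightarrow>
    ('o2, 'm2, 'z) category_data_scheme \<Rightarrow>
    ('o1, 'm1, 'o2, 'm2, 'w) functor_data_scheme \<Rightarrow> bool" where
  "dominant_functor C D F \<longleftrightarrow>
    (\<forall>Y \<in> Obj D. \<exists>X \<in> Obj C. \<exists>m \<in> Hom D Y (fobj F X). is_mono D m)"

text \<open>The monomorphism \<open>i\<close> represents the largest trivial subobject of its codomain.\<close>

definition largest_trivial_subobject ::
  "('o, 'm, 'k, 'z) tensor_category_data_scheme \<Rightarrow> 'm \<Rightarrow> bool" where
  "largest_trivial_subobject C i \<longleftrightarrow> is_mono C i \<and> trivial_object C (Dom C i) \<and>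
    (\<forall>t. is_mono C t \<and> Cod C t = Cod C i \<and> trivial_object C (Dom C t) \<longrightarrow>
      (\<exists>u \<in> Hom C (Dom C t) (Dom C i). i \<diamondop>\<^bsub>C\<^esub> u = t))"

definition normal_functor :: "('o1, 'm1, 'k, 'y) tensor_category_data_scheme \<Rightarrow>
    ('o2, 'm2, 'k, 'z) tensor_category_data_scheme \<Rightarrow>
    ('o1, 'm1, 'o2, 'm2, 'w) functor_data_scheme \<Rightarrow> bool" where
  "normal_functor C D F \<longleftrightarrow>
    (\<forall>X \<in> Obj C. \<exists>i. is_mono C i \<and> Cod C i = X \<and> largest_trivial_subobject D (farr F i))"

definition exact_sequence :: "('o1, 'm1, 'k :: field, 'x) tensor_category_data_scheme \<Rightarrow>
    ('o2, 'm2, 'k, 'y) tensor_category_data_scheme \<Rightarrow>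
    ('o3, 'm3, 'k, 'z) tensor_category_data_scheme \<Rightarrow>
    ('o1, 'm1, 'o2, 'm2, 'v) tensor_functor_data_scheme \<Rightarrow>
    ('o2, 'm2, 'o3, 'm3, 'w) tensor_functor_data_scheme \<Rightarrow> bool" where
  "exact_sequence C' C C'' f F \<longleftrightarrow>
    tensor_category C' \<and> tensor_category C \<and> tensor_category C'' \<and>
    tensor_functor C' C f \<and> tensor_functor C C'' F \<and>
    dominant_functor C C'' F \<and> normal_functor C C'' F \<and>
    full_embedding C' C f \<and> essential_image C' C f = kernel_objects C C'' F"

definition sequences_equivalent ::
  "('a1, 'b1, 'k, 'z1) tensor_category_data_scheme \<Rightarrow>
    ('a2, 'b2, 'k, 'z2) tensor_category_data_scheme \<Rightarrow>
    ('a3, 'b3, 'k, 'z3) tensor_category_data_scheme \<Rightarrow>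
    ('a1, 'b1, 'a2, 'b2) tensor_functor_data \<Rightarrow>
    ('a2, 'b2, 'a3, 'b3) tensor_functor_data \<Rightarrow>
    ('o1, 'm1, 'k, 'y1) tensor_category_data_scheme \<Rightarrow>
    ('o2, 'm2, 'k, 'y2) tensor_category_data_scheme \<Rightarrow>
    ('o3, 'm3, 'k, 'y3) tensor_category_data_scheme \<Rightarrow>
    ('o1, 'm1, 'o2, 'm2) tensor_functor_data \<Rightarrow>
    ('o2, 'm2, 'o3, 'm3) tensor_functor_data \<Rightarrow> bool" where
  "sequences_equivalent A' A A'' g G C' C C'' f F \<longleftrightarrow>
    (\<exists>(E' :: ('a1, 'b1, 'o1, 'm1) tensor_functor_data)
       (E :: ('a2, 'b2, 'o2, 'm2) tensor_functor_data)
       (E'' :: ('a3, 'b3, 'o3, 'm3) tensor_functor_data).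
      tensor_equivalence A' C' E' \<and> tensor_equivalence A C E \<and> tensor_equivalence A'' C'' E'' \<and>
      tensor_functor_isomorphic A' C (comp_tensor_functor C E g) (comp_tensor_functor C f E') \<and>
      tensor_functor_isomorphic A C'' (comp_tensor_functor C'' E'' G)
        (comp_tensor_functor C'' F E))"

definition group_exact_sequence :: "('a, 'x) monoid_scheme \<Rightarrow> ('b, 'y) monoid_scheme \<Rightarrow>
    ('c, 'z) monoid_scheme \<Rightarrow> ('a \<Rightarrow> 'b) \<Rightarrow> ('b \<Rightarrow> 'c) \<Rightarrow> bool" where
  "group_exact_sequence G' G G'' i p \<longleftrightarrow>
    group G' \<and> group G \<and> group G'' \<and> i \<in> hom G' G \<and> p \<in> hom G G'' \<and>
    inj_on i (carrier G') \<and> i ` carrier G' = kernel G G'' p \<and>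
    p ` carrier G = carrier G''"

text \<open>The map on isomorphism classes induced by a functor into \<open>D\<close>.\<close>

definition iso_class_map :: "('o2, 'm2, 'z) category_data_scheme \<Rightarrow>
    ('o1, 'm1, 'o2, 'm2, 'w) functor_data_scheme \<Rightarrow> 'o1 set \<Rightarrow> 'o2 set" where
  "iso_class_map D F A = (\<Union>X \<in> A. iso_class D (fobj F X))"


section \<open>Third group cohomology with values in \<open>\<k>\<^sup>\<times>\<close> (trivial action)\<close>

abbreviation triples :: "('g, 'z) monoid_scheme \<Rightarrow> ('g \<times> 'g \<times> 'g) set" where
  "triples G \<equiv> carrier G \<times> carrier G \<times> carrier G"

text \<open>Cochains are functions into the nonzero scalars, \<open>undefined\<close> outside of the group.\<close>

definition cocycles3 ::
  "('g, 'z) monoid_scheme \<Rightarrow> ('g \<times> 'g \<times> 'g \<Rightarrow> 'k :: field) monoid" where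
  "cocycles3 G =
    \<lparr>carrier = {a \<in> triples G \<rightarrow>\<^sub>E {c. c \<noteq> 0}.
       \<forall>w \<in> carrier G. \<forall>x \<in> carrier G. \<forall>y \<in> carrier G. \<forall>z \<in> carrier G.
         a (x, y, z) * a (w, x \<otimes>\<^bsub>G\<^esub> y, z) * a (w, x, y) =
         a (w \<otimes>\<^bsub>G\<^esub> x, y, z) * a (w, x, y \<otimes>\<^bsub>G\<^esub> z)},
     mult = (\<lambda>a b. \<lambda>t \<in> triples G. a t * b t),
     one = (\<lambda>t \<in> triples G. 1)\<rparr>"

definition coboundary3 ::
  "('g, 'z) monoid_scheme \<Rightarrow> ('g \<times> 'g \<Rightarrow> 'k :: field) \<Rightarrow> ('g \<times> 'g \<times> 'g \<Rightarrow> 'k)" where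
  "coboundary3 G b = (\<lambda>(x, y, z) \<in> triples G.
     (b (y, z) * b (x, y \<otimes>\<^bsub>G\<^esub> z)) / (b (x \<otimes>\<^bsub>G\<^esub> y, z) * b (x, y)))"

definition coboundaries3 ::
  "('g, 'z) monoid_scheme \<Rightarrow> ('g \<times> 'g \<times> 'g \<Rightarrow> 'k :: field) set" where
  "coboundaries3 G = coboundary3 G ` (carrier G \<times> carrier G \<rightarrow>\<^sub>E {c. c \<noteq> 0})"

definition H3 ::
  "('g, 'z) monoid_scheme \<Rightarrow> ('g \<times> 'g \<times> 'g \<Rightarrow> 'k :: field) set monoid" where
  "H3 G = cocycles3 G Mod coboundaries3 G"

definition normalized3 ::
  "('g, 'z) monoid_scheme \<Rightarrow> ('g \<times> 'g \<times> 'g \<Rightarrow> 'k :: field) \<Rightarrow> bool" where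
  "normalized3 G a \<longleftrightarrow> (\<forall>x \<in> carrier G. \<forall>y \<in> carrier G.
     a (\<one>\<^bsub>G\<^esub>, x, y) = 1 \<and> a (x, \<one>\<^bsub>G\<^esub>, y) = 1 \<and> a (x, y, \<one>\<^bsub>G\<^esub>) = 1)"

definition pullback3 :: "('g, 'z) monoid_scheme \<Rightarrow> ('g \<Rightarrow> 'h) \<Rightarrow>
    ('h \<times> 'h \<times> 'h \<Rightarrow> 'k :: field) \<Rightarrow> ('g \<times> 'g \<times> 'g \<Rightarrow> 'k)" where
  "pullback3 G p a = (\<lambda>(x, y, z) \<in> triples G. a (p x, p y, p z))"

text \<open>
  Inflation along \<open>p : G \<rightarrow> G''\<close>, sending a class (a coset of coboundaries on \<open>G''\<close>) to the
  coset of coboundaries on \<open>G\<close> of the pullback of any member.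
\<close>

definition infl :: "('g, 'z) monoid_scheme \<Rightarrow> ('g \<Rightarrow> 'h) \<Rightarrow>
    ('h \<times> 'h \<times> 'h \<Rightarrow> 'k :: field) set \<Rightarrow> ('g \<times> 'g \<times> 'g \<Rightarrow> 'k) set" where
  "infl G p \<alpha> = (\<Union>a \<in> \<alpha>. coboundaries3 G #>\<^bsub>cocycles3 G\<^esub> pullback3 G p a)"


section \<open>Graded vector spaces with associator given by a 3-cocycle\<close>

text \<open>
  \<open>G\<close>-graded vector spaces with a chosen ordered homogeneous basis: the list
  \<open>[x\<^sub>0, \<dots>, x\<^sub>n\<^sub>-\<^sub>1]\<close> stands for the space \<open>\<k>\<^sup>n\<close> whose \<open>i\<close>-th standard basis vector has
  degree \<open>x\<^sub>i\<close>. An arrow \<open>(xs, ys, M)\<close> is the degree-preserving linear map with matrix \<open>M\<close>.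
  Every finite-dimensional graded space is isomorphic to one of this form. The tensor
  product \<open>e\<^sub>i \<otimes> e\<^sub>j\<close> of basis vectors is placed at position \<open>i * length ys + j\<close>, so that
  \<open>\<otimes>\<close> on maps is the Kronecker product, and \<open>(e\<^sub>i \<otimes> e\<^sub>j) \<otimes> e\<^sub>k\<close> and \<open>e\<^sub>i \<otimes> (e\<^sub>j \<otimes> e\<^sub>k)\<close>
  have the same position; the associator multiplies this vector by \<open>a (x\<^sub>i, y\<^sub>j, z\<^sub>k)\<close>. The
  unit constraints are the canonical ones, which is why \<open>a\<close> should be normalized.
\<close>

type_synonym ('g, 'k) graded_arrow = "'g list \<times> 'g list \<times> 'k mat"

definition kronecker :: "'k :: semiring_0 mat \<Rightarrow> 'k mat \<Rightarrow> 'k mat" where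
  "kronecker A B = mat (dim_row A * dim_row B) (dim_col A * dim_col B)
     (\<lambda>(i, j). A $$ (i div dim_row B, j div dim_col B) * B $$ (i mod dim_row B, j mod dim_col B))"

definition graded_tensor :: "('g, 'z) monoid_scheme \<Rightarrow> 'g list \<Rightarrow> 'g list \<Rightarrow> 'g list" where
  "graded_tensor G xs ys = [x \<otimes>\<^bsub>G\<^esub> y. x \<leftarrow> xs, y \<leftarrow> ys]"

definition graded_assoc :: "('g, 'z) monoid_scheme \<Rightarrow> ('g \<times> 'g \<times> 'g \<Rightarrow> 'k :: field) \<Rightarrow>
    'g list \<Rightarrow> 'g list \<Rightarrow> 'g list \<Rightarrow> ('g, 'k) graded_arrow" where
  "graded_assoc G a xs ys zs =
    (let n = length xs * length ys * length zs in
      (graded_tensor G (graded_tensor G xs ys) zs,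
       graded_tensor G xs (graded_tensor G ys zs),
       mat n n (\<lambda>(i, j). if i = j
         then a (xs ! (i div (length ys * length zs)),
                 ys ! (i div length zs mod length ys),
                 zs ! (i mod length zs))
         else 0)))"

definition Vect :: "('g, 'z) monoid_scheme \<Rightarrow> ('g \<times> 'g \<times> 'g \<Rightarrow> 'k :: field) \<Rightarrow>
    ('g list, ('g, 'k) graded_arrow, 'k) tensor_category_data" where
  "Vect G a =
    \<lparr>Obj = lists (carrier G),
     Arr = {(xs, ys, M). xs \<in> lists (carrier G) \<and> ys \<in> lists (carrier G) \<and>
       M \<in> carrier_mat (length ys) (length xs) \<and>
       (\<forall>i < length ys. \<forall>j < length xs. M $$ (i, j) \<noteq> 0 \<longrightarrow> ys ! i = xs ! j)},
     Dom = (\<lambda>(xs, ys, M). xs),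
     Cod = (\<lambda>(xs, ys, M). ys),
     ident = (\<lambda>xs. (xs, xs, 1\<^sub>m (length xs))),
     cmp = (\<lambda>(ys, zs, N) (xs, ys', M). (xs, zs, N * M)),
     ladd = (\<lambda>(xs, ys, M) (xs', ys', N). (xs, ys, M + N)),
     lzero = (\<lambda>xs ys. (xs, ys, 0\<^sub>m (length ys) (length xs))),
     lsmult = (\<lambda>c (xs, ys, M). (xs, ys, c \<cdot>\<^sub>m M)),
     tunit = [\<one>\<^bsub>G\<^esub>],
     tobj = graded_tensor G,
     tarr = (\<lambda>(xs, xs', M) (ys, ys', N).
       (graded_tensor G xs ys, graded_tensor G xs' ys', kronecker M N)),
     assoc = graded_assoc G a,
     lunit = (\<lambda>xs. (graded_tensor G [\<one>\<^bsub>G\<^esub>] xs, xs, 1\<^sub>m (length xs))),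
     runit = (\<lambda>xs. (graded_tensor G xs [\<one>\<^bsub>G\<^esub>], xs, 1\<^sub>m (length xs)))\<rparr>"

text \<open>
  Change of grading along a group homomorphism \<open>h\<close> into \<open>H\<close>: the underlying spaces and maps
  are unchanged, and the structure isomorphisms are identities.
\<close>

definition regrade :: "('h, 'z) monoid_scheme \<Rightarrow> ('g \<Rightarrow> 'h) \<Rightarrow>
    ('g list, ('g, 'k :: field) graded_arrow, 'h list, ('h, 'k) graded_arrow)
      tensor_functor_data" where
  "regrade H h =
    \<lparr>fobj = map h,
     farr = (\<lambda>(xs, ys, M). (map h xs, map h ys, M)),
     fmult = (\<lambda>xs ys.
       (let zs = graded_tensor H (map h xs) (map h ys) in (zs, zs, 1\<^sub>m (length zs)))),
     funit = ([\<one>\<^bsub>H\<^esub>], [\<one>\<^bsub>H\<^esub>], 1\<^sub>m 1)\<rparr>"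

end

theory Submission
  imports Defs
begin

text \<open>
  A pointed fusion category is governed by its invertible objects, and so is an exact sequence
  with pointed middle term. Tensor functors preserve invertible objects, and an invertible
  object has only scalar endomorphisms, so in a fusion category it is simple. Hence \<open>F\<close> sends
  simple objects of \<open>C\<close> to simple objects of \<open>C''\<close>, and by dominance every simple object of
  \<open>C''\<close> arises in this way. A simple object of \<open>C'\<close> becomes simple, hence invertible, in \<open>C\<close>;
  its inverse is again sent to the unit by \<open>F\<close>, so it lies in the image of the full embedding
  \<open>f\<close>, and full faithfulness moves the inverse back to \<open>C'\<close>. Exactness of the sequence of
  Picard groups is then a matter of reading the definitions on simple objects.

  For the classification, pick a simple object \<open>Y\<^sub>g\<close> of \<open>C''\<close> for every \<open>g \<in> G''\<close> and
  isomorphisms \<open>\<mu>\<^sub>g\<^sub>h : Y\<^sub>g \<otimes> Y\<^sub>h \<rightarrow> Y\<^sub>g\<^sub>h\<close>. The two ways of multiplying three of these objects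
  differ by scalars, which form a 3-cocycle by the pentagon axiom; rescaling \<open>\<mu>\<close> makes it
  normalized and compatible with the unit constraints (\<open>unital_family_exists\<close>). Next choose
  isomorphisms \<open>\<theta>\<^sub>g : Y\<^bsub>p(g)\<^esub> \<rightarrow> F(X\<^sub>g)\<close> for representatives \<open>X\<^sub>g\<close> of the simple objects of \<open>C\<close>.
  Because \<open>F\<close> is bijective on the one-dimensional spaces \<open>Hom(X\<^sub>g \<otimes> X\<^sub>h, X\<^sub>g\<^sub>h)\<close>, there are
  unique \<open>\<mu>\<close> on \<open>C\<close> that \<open>\<theta>\<close> carries to those on \<open>C''\<close>, and their cocycle is the pullback of
  the cocycle of \<open>C''\<close> on the nose, not only up to coboundaries (\<open>transport_family\<close>). The same
  step along \<open>f\<close> gives a family on \<open>C'\<close>, with the pullback along the trivial homomorphism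
  \<open>G' \<rightarrow> G''\<close> as its cocycle, which is \<open>1\<close> by normalization.

  A family with cocycle \<open>a\<close> extends to a tensor functor from graded vector spaces with
  associator \<open>a\<close>: the list \<open>[x\<^sub>0, \<dots>, x\<^sub>n\<^sub>-\<^sub>1]\<close> goes to a direct sum of \<open>X\<^bsub>x\<^sub>0\<^esub>, \<dots>, X\<^bsub>x\<^sub>n\<^sub>-\<^sub>1\<^esub>\<close>, and
  arrows and structure isomorphisms are described on summands. It is an equivalence when the
  \<open>X\<^sub>g\<close> represent each class of simple objects once (\<open>tensor_equivalence_realization\<close>).
  Compatible families make the resulting squares of functors commute up to the tensor
  isomorphism that is \<open>\<theta>\<close> on each summand (\<open>realizations_isomorphic\<close>).
\<close>


section \<open>Categories\<close>

text \<open>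
  Typing of arrows is left to the simplifier: all rules speak of \<open>Arr\<close>, \<open>Dom\<close> and \<open>Cod\<close>, whose
  values it can compute, instead of \<open>Hom\<close> sets, for which it would have to guess the middle
  object of a composite.
\<close>

lemma Hom_iff: "f \<in> Hom C X Y \<longleftrightarrow> f \<in> Arr C \<and> Dom C f = X \<and> Cod C f = Y"
  by (simp add: Hom_def)

context category
begin

lemma Hom_Obj: "f \<in> Hom C X Y \<Longrightarrow> X \<in> Obj C" "f \<in> Hom C X Y \<Longrightarrow> Y \<in> Obj C"
  using Dom_Obj Cod_Obj by (auto simp: Hom_iff)

lemma Dom_Obj' [simp]: "f \<in> Arr C \<Longrightarrow> Dom C f \<in> Obj C"
  and Cod_Obj' [simp]: "f \<in> Arr C \<Longrightarrow> Cod C f \<in> Obj C"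
  using Dom_Obj Cod_Obj by auto

lemma ident_simps [simp]:
  assumes "X \<in> Obj C"
  shows "ident C X \<in> Arr C" "Dom C (ident C X) = X" "Cod C (ident C X) = X"
  using ident_Hom[OF assms] by (auto simp: Hom_iff)

lemma cmp_simps [simp]:
  assumes "f \<in> Arr C" "g \<in> Arr C" "Dom C g = Cod C f"
  shows "g \<diamondop> f \<in> Arr C" "Dom C (g \<diamondop> f) = Dom C f" "Cod C (g \<diamondop> f) = Cod C g"
  using cmp_Hom[of f "Dom C f" "Cod C f" g "Cod C g"] assms by (auto simp: Hom_iff)

lemma cmp_ident_right' [simp]: "f \<in> Arr C \<Longrightarrow> Dom C f = X \<Longrightarrow> f \<diamondop> ident C X = f"
  using cmp_ident_right[of f X "Cod C f"] by (auto simp: Hom_iff)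

lemma cmp_ident_left' [simp]: "f \<in> Arr C \<Longrightarrow> Cod C f = X \<Longrightarrow> ident C X \<diamondop> f = f"
  using cmp_ident_left[of f "Dom C f" X] by (auto simp: Hom_iff)

lemma cmp_assoc' [simp]:
  "f \<in> Arr C \<Longrightarrow> g \<in> Arr C \<Longrightarrow> h \<in> Arr C \<Longrightarrow> Dom C g = Cod C f \<Longrightarrow> Dom C h = Cod C g \<Longrightarrow>
    (h \<diamondop> g) \<diamondop> f = h \<diamondop> g \<diamondop> f"
  using cmp_assoc[of f "Dom C f" "Cod C f" g "Cod C g" h "Cod C h"] by (auto simp: Hom_iff)

text \<open>
  Composites are kept nested to the right; an equation between composites is used inside a
  longer one through this form.
\<close>

lemma cmp_reassoc:
  assumes "g \<diamondop> f = e" "f \<in> Arr C" "g \<in> Arr C" "h \<in> Arr C" "Dom C g = Cod C f" "Dom C f = Cod C h"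
  shows "g \<diamondop> f \<diamondop> h = e \<diamondop> h"
  using cmp_assoc'[of h f g] assms by simp

lemma inverse_arrows_unique: "inverse_arrows C f g \<Longrightarrow> inverse_arrows C f h \<Longrightarrow> g = h"
proof -
  assume g: "inverse_arrows C f g" and h: "inverse_arrows C f h"
  have "g = g \<diamondop> f \<diamondop> h" using g h by (auto simp: inverse_arrows_def Hom_iff)
  also have "\<dots> = (g \<diamondop> f) \<diamondop> h"
    using g h by (intro cmp_assoc'[symmetric]) (auto simp: inverse_arrows_def Hom_iff)
  also have "\<dots> = h" using g h by (auto simp: inverse_arrows_def Hom_iff)
  finally show ?thesis .
qed

lemma arr_inv_eqI: "inverse_arrows C f g \<Longrightarrow> arr_inv C f = g"
  unfolding arr_inv_def by (rule the_equality) (auto intro: inverse_arrows_unique)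

lemma inverse_arrows_arr_inv: "is_iso C f \<Longrightarrow> inverse_arrows C f (arr_inv C f)"
  unfolding is_iso_def using arr_inv_eqI by auto

lemma iso_Arr: "is_iso C f \<Longrightarrow> f \<in> Arr C"
  by (auto simp: is_iso_def inverse_arrows_def)

lemma arr_inv_simps [simp]:
  assumes "is_iso C f"
  shows "arr_inv C f \<in> Arr C" "Dom C (arr_inv C f) = Cod C f" "Cod C (arr_inv C f) = Dom C f"
    "arr_inv C f \<diamondop> f = ident C (Dom C f)" "f \<diamondop> arr_inv C f = ident C (Cod C f)"
  using inverse_arrows_arr_inv[OF assms] by (auto simp: inverse_arrows_def Hom_iff)

lemma arr_inv_reassoc [simp]:
  assumes "is_iso C f" "h \<in> Arr C"
  shows "Cod C h = Dom C f \<Longrightarrow> arr_inv C f \<diamondop> f \<diamondop> h = h"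
    "Cod C h = Cod C f \<Longrightarrow> f \<diamondop> arr_inv C f \<diamondop> h = h"
  using assms cmp_reassoc[OF arr_inv_simps(4)[OF assms(1)], of h]
    cmp_reassoc[OF arr_inv_simps(5)[OF assms(1)], of h] iso_Arr[OF assms(1)] by auto

lemma is_isoI:
  assumes "f \<in> Arr C" "g \<in> Arr C" "Dom C g = Cod C f" "Cod C g = Dom C f"
    "g \<diamondop> f = ident C (Dom C f)" "f \<diamondop> g = ident C (Cod C f)"
  shows "is_iso C f" "arr_inv C f = g"
proof -
  have "inverse_arrows C f g" using assms by (auto simp: inverse_arrows_def Hom_iff)
  then show "is_iso C f" "arr_inv C f = g" using arr_inv_eqI by (auto simp: is_iso_def)
qed

lemma is_iso_ident [simp]: "X \<in> Obj C \<Longrightarrow> is_iso C (ident C X)"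
  by (rule is_isoI(1)[where g = "ident C X"]) auto

lemma is_iso_arr_inv [simp]: "is_iso C f \<Longrightarrow> is_iso C (arr_inv C f)"
  by (rule is_isoI(1)[where g = f]) (auto simp: iso_Arr)

lemma is_iso_cmp [simp]:
  assumes "is_iso C f" "is_iso C g" "Dom C g = Cod C f"
  shows "is_iso C (g \<diamondop> f)"
  by (rule is_isoI(1)[where g = "arr_inv C f \<diamondop> arr_inv C g"])
    (use assms in \<open>auto simp: iso_Arr\<close>)

lemma iso_cancel_right:
  assumes "is_iso C u" "f \<in> Arr C" "g \<in> Arr C" "Dom C f = Cod C u" "Dom C g = Cod C u"
    and eq: "f \<diamondop> u = g \<diamondop> u"
  shows "f = g"
proof -
  have "(f \<diamondop> u) \<diamondop> arr_inv C u = (g \<diamondop> u) \<diamondop> arr_inv C u" using eq by simp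
  then show ?thesis using assms(1-5) by (simp add: iso_Arr)
qed

lemma iso_cancel_left:
  assumes "is_iso C u" "f \<in> Arr C" "g \<in> Arr C" "Cod C f = Dom C u" "Cod C g = Dom C u"
    and eq: "u \<diamondop> f = u \<diamondop> g"
  shows "f = g"
proof -
  have "arr_inv C u \<diamondop> u \<diamondop> f = arr_inv C u \<diamondop> u \<diamondop> g" using eq by simp
  then show ?thesis using assms(1-5) by (simp add: iso_Arr)
qed

lemma isomorphicI: "is_iso C f \<Longrightarrow> f \<in> Hom C X Y \<Longrightarrow> isomorphic C X Y"
  unfolding isomorphic_def using Hom_Obj by blast

lemma isomorphicE:
  assumes "isomorphic C X Y"
  obtains f where "is_iso C f" "f \<in> Arr C" "Dom C f = X" "Cod C f = Y" "X \<in> Obj C" "Y \<in> Obj C"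
  using assms by (auto simp: isomorphic_def Hom_iff)

lemma isomorphic_refl: "X \<in> Obj C \<Longrightarrow> isomorphic C X X"
  by (rule isomorphicI[of "ident C X"]) (auto simp: Hom_iff)

lemma isomorphic_sym: "isomorphic C X Y \<Longrightarrow> isomorphic C Y X"
  by (erule isomorphicE, rule isomorphicI[OF is_iso_arr_inv]) (auto simp: Hom_iff)

lemma isomorphic_trans [trans]:
  assumes "isomorphic C X Y" "isomorphic C Y Z"
  shows "isomorphic C X Z"
proof -
  obtain f g where "is_iso C f" "f \<in> Arr C" "Dom C f = X" "Cod C f = Y"
    "is_iso C g" "g \<in> Arr C" "Dom C g = Y" "Cod C g = Z"
    by (metis assms isomorphicE)
  then show ?thesis by (intro isomorphicI[of "g \<diamondop> f"]) (auto simp: Hom_iff)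
qed

lemma isomorphic_Obj: "isomorphic C X Y \<Longrightarrow> X \<in> Obj C" "isomorphic C X Y \<Longrightarrow> Y \<in> Obj C"
  by (auto simp: isomorphic_def)

lemma iso_class_eq_iff: "X \<in> Obj C \<Longrightarrow> iso_class C X = iso_class C Y \<longleftrightarrow> isomorphic C X Y"
  unfolding iso_class_def
  using isomorphic_refl isomorphic_sym isomorphic_trans isomorphic_Obj by blast

end


section \<open>Linear categories and direct sums\<close>

definition hsum ::
  "('o, 'm, 'k, 'z) linear_category_data_scheme \<Rightarrow> 'o \<Rightarrow> 'o \<Rightarrow> ('i \<Rightarrow> 'm) \<Rightarrow> 'i set \<Rightarrow> 'm" where
  "hsum C X Y g I = finsum (hom_space C X Y) g I"

text \<open>
  In \<open>is_direct_sum\<close> the inclusions and projections are hidden by an existential quantifier;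
  here they are parameters, since arrows will be described by their components.
\<close>

definition biproduct ::
  "('o, 'm, 'k, 'z) linear_category_data_scheme \<Rightarrow> 'o list \<Rightarrow> 'o \<Rightarrow>
    (nat \<Rightarrow> 'm) \<Rightarrow> (nat \<Rightarrow> 'm) \<Rightarrow> bool" where
  "biproduct C Xs X \<iota> \<pi> \<longleftrightarrow> X \<in> Obj C \<and> set Xs \<subseteq> Obj C \<and>
    (\<forall>i < length Xs. \<iota> i \<in> Hom C (Xs ! i) X \<and> \<pi> i \<in> Hom C X (Xs ! i)) \<and>
    (\<forall>i < length Xs. \<forall>j < length Xs.
      \<pi> j \<diamondop>\<^bsub>C\<^esub> \<iota> i =
        (if i = j then ident C (Xs ! i) else lzero C (Xs ! i) (Xs ! j))) \<and>
    hsum C X X (\<lambda>i. \<iota> i \<diamondop>\<^bsub>C\<^esub> \<pi> i) {..<length Xs} = ident C X"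

text \<open>
  A decomposition of the identity without the orthogonality of a direct sum. It still makes
  the arrows \<open>e\<^sub>i\<close> jointly epic and, unlike joint epimorphy, is visibly stable under tensoring
  with an object.
\<close>

definition splitting :: "('o, 'm, 'k, 'z) linear_category_data_scheme \<Rightarrow> 'o \<Rightarrow> nat \<Rightarrow>
    (nat \<Rightarrow> 'm) \<Rightarrow> (nat \<Rightarrow> 'm) \<Rightarrow> bool" where
  "splitting C A n e r \<longleftrightarrow> A \<in> Obj C \<and>
    (\<forall>i < n. e i \<in> Arr C \<and> r i \<in> Arr C \<and> Cod C (e i) = A \<and> Dom C (r i) = A \<and> Cod C (r i) = Dom C (e i)) \<and>
    hsum C A A (\<lambda>i. e i \<diamondop>\<^bsub>C\<^esub> r i) {..<n} = ident C A"

lemma is_direct_sum_iff: "is_direct_sum C Xs X \<longleftrightarrow> (\<exists>j q. biproduct C Xs X j q)"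
  unfolding is_direct_sum_def biproduct_def hsum_def by blast

context linear_category
begin

lemma hom_module: "X \<in> Obj C \<Longrightarrow> Y \<in> Obj C \<Longrightarrow> Module.module class_ring (hom_space C X Y)"
  using hom_vectorspace by (simp add: vectorspace_def)

lemma hom_abelian_group: "X \<in> Obj C \<Longrightarrow> Y \<in> Obj C \<Longrightarrow> abelian_group (hom_space C X Y)"
  using hom_module by (simp add: Module.module_def)

lemma hom_abelian_monoid: "X \<in> Obj C \<Longrightarrow> Y \<in> Obj C \<Longrightarrow> abelian_monoid (hom_space C X Y)"
  using hom_abelian_group by (simp add: abelian_group_def)

lemma hom_space_simps [simp]:
  "carrier (hom_space C X Y) = Hom C X Y" "add (hom_space C X Y) = ladd C"
  "zero (hom_space C X Y) = lzero C X Y" "smult (hom_space C X Y) = lsmult C"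
  by (simp_all add: hom_space_def)

lemma lzero_Hom: "X \<in> Obj C \<Longrightarrow> Y \<in> Obj C \<Longrightarrow> lzero C X Y \<in> Hom C X Y"
  using abelian_monoid.zero_closed[OF hom_abelian_monoid] by fastforce

lemma lzero_simps [simp]:
  assumes "X \<in> Obj C" "Y \<in> Obj C"
  shows "lzero C X Y \<in> Arr C" "Dom C (lzero C X Y) = X" "Cod C (lzero C X Y) = Y"
  using lzero_Hom[OF assms] by (auto simp: Hom_iff)

lemma lsmult_Hom: "f \<in> Hom C X Y \<Longrightarrow> lsmult C c f \<in> Hom C X Y"
  using Module.module.smult_closed[OF hom_module, of X Y c f] Hom_Obj[of f X Y]
  by simp

lemma lsmult_simps [simp]:
  assumes "f \<in> Arr C"
  shows "lsmult C c f \<in> Arr C" "Dom C (lsmult C c f) = Dom C f" "Cod C (lsmult C c f) = Cod C f"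
  using lsmult_Hom[of f "Dom C f" "Cod C f" c] assms by (auto simp: Hom_iff)

lemma ladd_Hom: "f \<in> Hom C X Y \<Longrightarrow> g \<in> Hom C X Y \<Longrightarrow> ladd C f g \<in> Hom C X Y"
  using abelian_monoid.a_closed[OF hom_abelian_monoid, of X Y f g] Hom_Obj[of f X Y] by simp

lemma lsmult_one [simp]: "f \<in> Arr C \<Longrightarrow> lsmult C 1 f = f"
  using Module.module.smult_one[OF hom_module, of "Dom C f" "Cod C f" f]
  by (simp add: Hom_iff)

lemma lsmult_lsmult [simp]: "f \<in> Arr C \<Longrightarrow> lsmult C a (lsmult C b f) = lsmult C (a * b) f"
  using Module.module.smult_assoc1[OF hom_module, of "Dom C f" "Cod C f" a b f]
  by (simp add: Hom_iff)

lemma lsmult_add: "f \<in> Arr C \<Longrightarrow> lsmult C (a + b) f = ladd C (lsmult C a f) (lsmult C b f)"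
  using Module.module.smult_l_distr[OF hom_module, of "Dom C f" "Cod C f" a b f]
  by (simp add: Hom_iff)

lemma lsmult_zero [simp]: "f \<in> Arr C \<Longrightarrow> lsmult C 0 f = lzero C (Dom C f) (Cod C f)"
  using Module.module.smult_l_null[OF hom_module, of "Dom C f" "Cod C f" f]
  by (simp add: Hom_iff)

lemma lsmult_lzero [simp]: "X \<in> Obj C \<Longrightarrow> Y \<in> Obj C \<Longrightarrow> lsmult C c (lzero C X Y) = lzero C X Y"
  using Module.module.smult_r_null[OF hom_module, of X Y c] by simp

lemma cmp_lsmult_left' [simp]:
  "f \<in> Arr C \<Longrightarrow> g \<in> Arr C \<Longrightarrow> Dom C g = Cod C f \<Longrightarrow> (lsmult C c g) \<diamondop> f = lsmult C c (g \<diamondop> f)"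
  using cmp_lsmult_left[of f "Dom C f" "Cod C f" g "Cod C g"] by (simp add: Hom_iff)

lemma cmp_lsmult_right' [simp]:
  "f \<in> Arr C \<Longrightarrow> g \<in> Arr C \<Longrightarrow> Dom C g = Cod C f \<Longrightarrow> g \<diamondop> (lsmult C c f) = lsmult C c (g \<diamondop> f)"
  using cmp_lsmult_right[of f "Dom C f" "Cod C f" g "Cod C g"] by (simp add: Hom_iff)

lemma cmp_lzero_right [simp]:
  assumes "g \<in> Arr C" "Dom C g = Y" "X \<in> Obj C"
  shows "g \<diamondop> lzero C X Y = lzero C X (Cod C g)"
proof -
  have "Y \<in> Obj C" using assms by auto
  then have "g \<diamondop> lsmult C 0 (lzero C X Y) = lsmult C 0 (g \<diamondop> lzero C X Y)"
    using assms by (intro cmp_lsmult_right') auto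
  then show ?thesis using assms \<open>Y \<in> Obj C\<close> by simp
qed

lemma cmp_lzero_left [simp]:
  assumes "f \<in> Arr C" "Cod C f = Y" "Z \<in> Obj C"
  shows "lzero C Y Z \<diamondop> f = lzero C (Dom C f) Z"
proof -
  have "Y \<in> Obj C" using assms by auto
  then have "lsmult C 0 (lzero C Y Z) \<diamondop> f = lsmult C 0 (lzero C Y Z \<diamondop> f)"
    using assms by (intro cmp_lsmult_left') auto
  then show ?thesis using assms \<open>Y \<in> Obj C\<close> by simp
qed

lemma lsmult_cancel:
  assumes "lsmult C a f = lsmult C b f" "f \<in> Arr C" "f \<noteq> lzero C (Dom C f) (Cod C f)"
  shows "a = b"
proof (rule ccontr)
  assume "a \<noteq> b"
  interpret M: Module.module class_ring "hom_space C (Dom C f) (Cod C f)"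
    using hom_module assms by simp
  have f: "f \<in> Hom C (Dom C f) (Cod C f)" using assms by (simp add: Hom_iff)
  have "ladd C (lsmult C (a - b) f) (lsmult C b f) = lsmult C a f"
    using lsmult_add[of f "a - b" b] assms by simp
  also have "\<dots> = ladd C (lzero C (Dom C f) (Cod C f)) (lsmult C b f)"
    using M.l_zero[of "lsmult C b f"] assms(1) f lsmult_Hom by simp
  finally have "lsmult C (a - b) f = lzero C (Dom C f) (Cod C f)"
    using M.add.right_cancel[of "lsmult C b f" "lsmult C (a - b) f" "lzero C (Dom C f) (Cod C f)"]
      f lsmult_Hom lzero_Hom assms by simp
  then have "lsmult C (inverse (a - b)) (lsmult C (a - b) f) = lzero C (Dom C f) (Cod C f)"
    using assms by simp
  then show False using \<open>a \<noteq> b\<close> assms by simp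
qed

lemma hsum_empty [simp]: 
  assumes "X \<in> Obj C" "Y \<in> Obj C"
  shows "hsum C X Y g {} = lzero C X Y"
  unfolding hsum_def using abelian_monoid.finsum_empty[OF hom_abelian_monoid[OF assms]] by simp

lemma hsum_insert:
  assumes "finite I" "i \<notin> I" "\<And>j. j \<in> insert i I \<Longrightarrow> g j \<in> Hom C X Y" 
  shows "hsum C X Y g (insert i I) = ladd C (g i) (hsum C X Y g I)"
proof -
  interpret M: abelian_monoid "hom_space C X Y"
    using hom_abelian_monoid Hom_Obj assms(3)[of i] by blast
  show ?thesis unfolding hsum_def using M.finsum_insert[of I i g] assms by auto
qed

lemma hsum_Hom:
  assumes "X \<in> Obj C" "Y \<in> Obj C" "\<And>i. i \<in> I \<Longrightarrow> g i \<in> Hom C X Y" 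
  shows "hsum C X Y g I \<in> Hom C X Y"
proof -
  interpret M: abelian_monoid "hom_space C X Y"
    using hom_abelian_monoid assms by blast
  show ?thesis unfolding hsum_def using M.finsum_closed[of g I] assms by auto
qed

lemma hsum_cong:
  assumes "X \<in> Obj C" "Y \<in> Obj C" "\<And>i. i \<in> I \<Longrightarrow> g i = h i" "\<And>i. i \<in> I \<Longrightarrow> h i \<in> Hom C X Y"
  shows "hsum C X Y g I = hsum C X Y h I"
proof -
  interpret M: abelian_monoid "hom_space C X Y"
    using hom_abelian_monoid assms by blast
  show ?thesis unfolding hsum_def
    by (rule M.finsum_cong'[OF refl]) (use assms in auto)
qed

text \<open>
  Composition with an arrow, tensoring with an object and linear functors are the instances
  \<open>T\<close> of interest.
\<close>

lemma hsum_additive: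
  assumes "finite I" "\<And>i. i \<in> I \<Longrightarrow> g i \<in> Hom C X Y" "X \<in> Obj C" "Y \<in> Obj C"
    and D: "linear_category D"
    and T: "\<And>f. f \<in> Hom C X Y \<Longrightarrow> T f \<in> Hom D X' Y'" "T (lzero C X Y) = lzero D X' Y'"
      "\<And>f f'. f \<in> Hom C X Y \<Longrightarrow> f' \<in> Hom C X Y \<Longrightarrow> T (ladd C f f') = ladd D (T f) (T f')"
  shows "T (hsum C X Y g I) = hsum D X' Y' (\<lambda>i. T (g i)) I"
  using assms(1,2)
proof (induction I)
  case empty
  interpret D: linear_category D by fact
  have "T (lzero C X Y) \<in> Hom D X' Y'" using T(1) assms(3,4) lzero_Hom by blast
  then show ?case using T assms(3,4) D.Hom_Obj by (metis hsum_empty D.hsum_empty)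
next
  case (insert i I)
  interpret D: linear_category D by fact
  have "T (hsum C X Y g (insert i I)) = T (ladd C (g i) (hsum C X Y g I))"
    using insert by (subst hsum_insert) auto
  also have "\<dots> = ladd D (T (g i)) (T (hsum C X Y g I))"
    using insert assms(3,4) by (intro T(3) hsum_Hom) auto
  also have "\<dots> = hsum D X' Y' (\<lambda>i. T (g i)) (insert i I)"
    using insert T(1) by (subst D.hsum_insert) auto
  finally show ?case .
qed

lemma cmp_hsum:
  assumes "finite I" "\<And>i. i \<in> I \<Longrightarrow> g i \<in> Hom C X Y" "X \<in> Obj C" "Y \<in> Obj C"
    "u \<in> Arr C" "Dom C u = Y"
  shows "u \<diamondop> hsum C X Y g I = hsum C X (Cod C u) (\<lambda>i. u \<diamondop> g i) I"
  by (rule hsum_additive)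
    (use assms cmp_Hom[of _ X Y u "Cod C u"] cmp_ladd_right[of _ X Y _ u "Cod C u"]
      linear_category_axioms in \<open>auto simp: Hom_iff\<close>)

lemma hsum_cmp:
  assumes "finite I" "\<And>i. i \<in> I \<Longrightarrow> g i \<in> Hom C X Y" "X \<in> Obj C" "Y \<in> Obj C"
    "u \<in> Arr C" "Cod C u = X"
  shows "hsum C X Y g I \<diamondop> u = hsum C (Dom C u) Y (\<lambda>i. g i \<diamondop> u) I"
  by (rule hsum_additive)
    (use assms cmp_Hom[of u "Dom C u" X] cmp_ladd_left[of u "Dom C u" X]
      linear_category_axioms in \<open>auto simp: Hom_iff\<close>)

lemma hsum_single:
  assumes "finite I" "k \<in> I" "g k \<in> Hom C X Y" "\<And>i. i \<in> I \<Longrightarrow> i \<noteq> k \<Longrightarrow> g i = lzero C X Y"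
  shows "hsum C X Y g I = g k"
proof -
  have XY: "X \<in> Obj C" "Y \<in> Obj C" using Hom_Obj assms by blast+
  interpret M: abelian_monoid "hom_space C X Y"
    using hom_abelian_monoid XY by blast
  have "hsum C X Y g I = hsum C X Y (\<lambda>i. if k = i then g k else lzero C X Y) I"
    by (rule hsum_cong) (use assms XY lzero_Hom in auto)
  also have "\<dots> = g k"
    unfolding hsum_def using M.finsum_singleton[of k I "\<lambda>_. g k", unfolded hom_space_simps] assms by simp
  finally show ?thesis .
qed

lemma hsum_lsmult:
  assumes "finite I" "f \<in> Arr C"
  shows "hsum C (Dom C f) (Cod C f) (\<lambda>i. lsmult C (c i) f) I = lsmult C (sum c I) f"
  using assms(1)
proof (induction I)
  case empty
  then show ?case using assms by simp
next
  case (insert i I)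
  then show ?case using assms by (simp add: hsum_insert lsmult_add Hom_iff)
qed

lemma splitting_joint_epi:
  assumes s: "splitting C A n e r"
    and fg: "f \<in> Arr C" "g \<in> Arr C" "Dom C f = A" "Dom C g = A" "Cod C f = Cod C g"
    and eq: "\<And>i. i < n \<Longrightarrow> f \<diamondop> e i = g \<diamondop> e i"
  shows "f = g"
proof -
  have S [simp]: "A \<in> Obj C" "i < n \<Longrightarrow> e i \<in> Arr C" "i < n \<Longrightarrow> r i \<in> Arr C" "i < n \<Longrightarrow> Cod C (e i) = A"
    "i < n \<Longrightarrow> Dom C (r i) = A" "i < n \<Longrightarrow> Cod C (r i) = Dom C (e i)" for i
    using s by (auto simp: splitting_def)
  have sum: "hsum C A A (\<lambda>i. e i \<diamondop> r i) {..<n} = ident C A"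
    using s by (auto simp: splitting_def)
  have "f = f \<diamondop> hsum C A A (\<lambda>i. e i \<diamondop> r i) {..<n}" using fg by (simp add: sum)
  also have "\<dots> = hsum C A (Cod C f) (\<lambda>i. f \<diamondop> e i \<diamondop> r i) {..<n}"
    by (rule cmp_hsum) (use fg in \<open>auto simp: Hom_iff\<close>)
  also have "\<dots> = hsum C A (Cod C g) (\<lambda>i. g \<diamondop> e i \<diamondop> r i) {..<n}"
  proof -
    have "f \<diamondop> e i \<diamondop> r i = g \<diamondop> e i \<diamondop> r i" if "i < n" for i
      using eq[OF that] that fg cmp_assoc'[of "r i" "e i" f] cmp_assoc'[of "r i" "e i" g] by simp
    then show ?thesis
      unfolding fg(5) by (intro hsum_cong) (use fg in \<open>auto simp: Hom_iff\<close>)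
  qed
  also have "\<dots> = g \<diamondop> hsum C A A (\<lambda>i. e i \<diamondop> r i) {..<n}"
    by (rule cmp_hsum[symmetric]) (use fg in \<open>auto simp: Hom_iff\<close>)
  also have "\<dots> = g" using fg by (simp add: sum)
  finally show ?thesis .
qed

end

context
  fixes C :: "('o, 'm, 'k :: field, 'z) linear_category_data_scheme" (structure)
    and Xs X \<iota> \<pi>
  assumes C: "linear_category C" and B: "biproduct C Xs X \<iota> \<pi>"
begin

interpretation linear_category C by (rule C)

lemma biproduct_simps:
  "X \<in> Obj C" "i < length Xs \<Longrightarrow> Xs ! i \<in> Obj C"
  "i < length Xs \<Longrightarrow> \<iota> i \<in> Arr C" "i < length Xs \<Longrightarrow> Dom C (\<iota> i) = Xs ! i"
  "i < length Xs \<Longrightarrow> Cod C (\<iota> i) = X"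
  "i < length Xs \<Longrightarrow> \<pi> i \<in> Arr C" "i < length Xs \<Longrightarrow> Dom C (\<pi> i) = X"
  "i < length Xs \<Longrightarrow> Cod C (\<pi> i) = Xs ! i"
  "i < length Xs \<Longrightarrow> \<pi> i \<diamondop> \<iota> i = ident C (Xs ! i)"
  "i < length Xs \<Longrightarrow> j < length Xs \<Longrightarrow> i \<noteq> j \<Longrightarrow> \<pi> j \<diamondop> \<iota> i = lzero C (Xs ! i) (Xs ! j)"
  using B by (auto simp: biproduct_def Hom_iff)

lemma biproduct_sum: "hsum C X X (\<lambda>i. \<iota> i \<diamondop> \<pi> i) {..<length Xs} = ident C X"
  using B by (simp add: biproduct_def)

lemma biproduct_delta_reassoc:
  assumes "i < length Xs" "j < length Xs" "h \<in> Arr C" "Cod C h = Xs ! i"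
  shows "\<pi> i \<diamondop> \<iota> i \<diamondop> h = h"
    "i \<noteq> j \<Longrightarrow> \<pi> j \<diamondop> \<iota> i \<diamondop> h = lzero C (Dom C h) (Xs ! j)"
  using assms biproduct_simps
  by (simp_all add: cmp_reassoc[OF biproduct_simps(9)] cmp_reassoc[OF biproduct_simps(10)])

lemma biproduct_expand_left:
  assumes "f \<in> Arr C" "Cod C f = X"
  shows "f = hsum C (Dom C f) X (\<lambda>i. \<iota> i \<diamondop> \<pi> i \<diamondop> f) {..<length Xs}"
proof -
  have "f = hsum C X X (\<lambda>i. \<iota> i \<diamondop> \<pi> i) {..<length Xs} \<diamondop> f"
    using assms by (simp add: biproduct_sum)
  also have "\<dots> = hsum C (Dom C f) X (\<lambda>i. (\<iota> i \<diamondop> \<pi> i) \<diamondop> f) {..<length Xs}"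
    by (subst hsum_cmp) (use assms biproduct_simps in \<open>auto simp: Hom_iff\<close>)
  also have "\<dots> = hsum C (Dom C f) X (\<lambda>i. \<iota> i \<diamondop> \<pi> i \<diamondop> f) {..<length Xs}"
    by (rule hsum_cong) (use assms biproduct_simps in \<open>auto simp: Hom_iff\<close>)
  finally show ?thesis .
qed

lemma biproduct_splitting: "splitting C X (length Xs) \<iota> \<pi>"
  using B unfolding biproduct_def splitting_def by (auto simp: Hom_iff)

lemmas biproduct_joint_epi = splitting_joint_epi[OF biproduct_splitting]

lemma biproduct_joint_mono:
  assumes "f \<in> Arr C" "g \<in> Arr C" "Cod C f = X" "Cod C g = X" "Dom C f = Dom C g"
    and "\<And>i. i < length Xs \<Longrightarrow> \<pi> i \<diamondop> f = \<pi> i \<diamondop> g"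
  shows "f = g"
proof -
  have "f = hsum C (Dom C f) X (\<lambda>i. \<iota> i \<diamondop> \<pi> i \<diamondop> f) {..<length Xs}"
    using assms by (intro biproduct_expand_left)
  also have "\<dots> = hsum C (Dom C f) X (\<lambda>i. \<iota> i \<diamondop> \<pi> i \<diamondop> g) {..<length Xs}"
    by (rule hsum_cong) (use assms biproduct_simps in \<open>auto simp: Hom_iff\<close>)
  also have "\<dots> = g" using assms biproduct_expand_left[of g] by simp
  finally show ?thesis .
qed

lemma biproduct_cotuple:
  assumes "Z \<in> Obj C" "\<And>i. i < length Xs \<Longrightarrow> g i \<in> Hom C (Xs ! i) Z"
  obtains f where "f \<in> Hom C X Z" "\<And>i. i < length Xs \<Longrightarrow> f \<diamondop> \<iota> i = g i"
proof
  let ?f = "hsum C X Z (\<lambda>i. g i \<diamondop> \<pi> i) {..<length Xs}"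
  note [simp] = biproduct_simps
  have g [simp]: "i < length Xs \<Longrightarrow> g i \<in> Arr C \<and> Dom C (g i) = Xs ! i \<and> Cod C (g i) = Z" for i
    using assms by (simp add: Hom_iff)
  have gp: "g i \<diamondop> \<pi> i \<in> Hom C X Z" if "i \<in> {..<length Xs}" for i
    using assms that by (auto simp: Hom_iff)
  show "?f \<in> Hom C X Z" using gp assms by (intro hsum_Hom) auto
  fix i assume i: "i < length Xs"
  have "?f \<diamondop> \<iota> i = hsum C (Xs ! i) Z (\<lambda>j. (g j \<diamondop> \<pi> j) \<diamondop> \<iota> i) {..<length Xs}"
    using i gp assms by (subst hsum_cmp) auto
  also have "\<dots> = (g i \<diamondop> \<pi> i) \<diamondop> \<iota> i"
    by (rule hsum_single) (use i assms in \<open>auto simp: Hom_iff\<close>)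
  finally show "?f \<diamondop> \<iota> i = g i" using i by simp
qed

lemma biproduct_tuple:
  assumes "Z \<in> Obj C" "\<And>i. i < length Xs \<Longrightarrow> g i \<in> Hom C Z (Xs ! i)"
  obtains f where "f \<in> Hom C Z X" "\<And>i. i < length Xs \<Longrightarrow> \<pi> i \<diamondop> f = g i"
proof
  let ?f = "hsum C Z X (\<lambda>i. \<iota> i \<diamondop> g i) {..<length Xs}"
  note [simp] = biproduct_simps
  have g [simp]: "i < length Xs \<Longrightarrow> g i \<in> Arr C \<and> Cod C (g i) = Xs ! i \<and> Dom C (g i) = Z" for i
    using assms by (simp add: Hom_iff)
  have gp: "\<iota> i \<diamondop> g i \<in> Hom C Z X" if "i \<in> {..<length Xs}" for i
    using assms that by (auto simp: Hom_iff)
  show "?f \<in> Hom C Z X" using gp assms by (intro hsum_Hom) auto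
  fix i assume i: "i < length Xs"
  have "\<pi> i \<diamondop> ?f = hsum C Z (Xs ! i) (\<lambda>j. \<pi> i \<diamondop> \<iota> j \<diamondop> g j) {..<length Xs}"
    using i gp assms by (subst cmp_hsum) auto
  also have "\<dots> = \<pi> i \<diamondop> \<iota> i \<diamondop> g i"
    by (rule hsum_single) (use i assms in \<open>auto simp: Hom_iff biproduct_delta_reassoc\<close>)
  finally show "\<pi> i \<diamondop> ?f = g i" using i by (simp add: biproduct_delta_reassoc)
qed

end

context linear_category
begin

text \<open>
  The decomposition of the identity, the one condition on a biproduct that mentions sums, may
  be checked after composing with the inclusions as soon as these are jointly epic.
\<close>

lemma biproductI:
  assumes X: "X \<in> Obj C" "set Xs \<subseteq> Obj C"
    and i: "\<And>i. i < length Xs \<Longrightarrow> \<iota> i \<in> Hom C (Xs ! i) X"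
    and p: "\<And>i. i < length Xs \<Longrightarrow> \<pi> i \<in> Hom C X (Xs ! i)"
    and one: "\<And>i. i < length Xs \<Longrightarrow> \<pi> i \<diamondop> \<iota> i = ident C (Xs ! i)"
    and zero: "\<And>i j. i < length Xs \<Longrightarrow> j < length Xs \<Longrightarrow> i \<noteq> j \<Longrightarrow>
      \<pi> j \<diamondop> \<iota> i = lzero C (Xs ! i) (Xs ! j)"
    and epi: "\<And>f. f \<in> Hom C X X \<Longrightarrow> (\<And>i. i < length Xs \<Longrightarrow> f \<diamondop> \<iota> i = \<iota> i) \<Longrightarrow> f = ident C X"
  shows "biproduct C Xs X \<iota> \<pi>"
proof -
  have [simp]: "\<iota> i \<in> Arr C" "Dom C (\<iota> i) = Xs ! i" "Cod C (\<iota> i) = X"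
    "\<pi> i \<in> Arr C" "Cod C (\<pi> i) = Xs ! i" "Dom C (\<pi> i) = X" "Xs ! i \<in> Obj C"
    if "i < length Xs" for i
    using i[OF that] p[OF that] X(2) that by (auto simp: Hom_iff)
  have H: "\<iota> i \<diamondop> \<pi> i \<in> Hom C X X" if "i \<in> {..<length Xs}" for i using that by (auto simp: Hom_iff)
  have "hsum C X X (\<lambda>i. \<iota> i \<diamondop> \<pi> i) {..<length Xs} = ident C X"
  proof (rule epi)
    show "hsum C X X (\<lambda>i. \<iota> i \<diamondop> \<pi> i) {..<length Xs} \<in> Hom C X X"
      using H X by (intro hsum_Hom) auto
    fix k assume k: "k < length Xs"
    have "hsum C X X (\<lambda>i. \<iota> i \<diamondop> \<pi> i) {..<length Xs} \<diamondop> \<iota> k =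
        hsum C (Xs ! k) X (\<lambda>i. (\<iota> i \<diamondop> \<pi> i) \<diamondop> \<iota> k) {..<length Xs}"
      using H X k by (subst hsum_cmp) auto
    also have "\<dots> = (\<iota> k \<diamondop> \<pi> k) \<diamondop> \<iota> k"
      by (rule hsum_single) (use k X zero in \<open>auto simp: Hom_iff\<close>)
    finally show "hsum C X X (\<lambda>i. \<iota> i \<diamondop> \<pi> i) {..<length Xs} \<diamondop> \<iota> k = \<iota> k"
      using k one by simp
  qed
  then show ?thesis
    using assms by (auto simp: biproduct_def)
qed

lemma biproduct_single:
  assumes "is_iso C u" "X = Cod C u"
  shows "biproduct C [Dom C u] X (\<lambda>_. u) (\<lambda>_. arr_inv C u)"
proof (rule biproductI)
  fix f assume "f \<in> Hom C X X" "\<And>i. i < length [Dom C u] \<Longrightarrow> f \<diamondop> u = u"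
  then show "f = ident C X"
    using iso_cancel_right[OF assms(1), of f "ident C X"] assms iso_Arr by (auto simp: Hom_iff)
qed (use assms iso_Arr in \<open>auto simp: Hom_iff\<close>)

lemma biproducts_isomorphic:
  assumes "biproduct C Xs X \<iota> \<pi>" "biproduct C Xs Y \<iota>' \<pi>'"
  shows "isomorphic C X Y"
proof -
  note L = linear_category_axioms
  note X = biproduct_simps[OF L assms(1)] and Y = biproduct_simps[OF L assms(2)]
  obtain f where f: "f \<in> Hom C X Y" "\<And>i. i < length Xs \<Longrightarrow> f \<diamondop> \<iota> i = \<iota>' i"
    by (rule biproduct_cotuple[OF L assms(1), of Y \<iota>']) (use Y in \<open>auto simp: Hom_iff\<close>)
  obtain g where g: "g \<in> Hom C Y X" "\<And>i. i < length Xs \<Longrightarrow> g \<diamondop> \<iota>' i = \<iota> i"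
    by (rule biproduct_cotuple[OF L assms(2), of X \<iota>]) (use X in \<open>auto simp: Hom_iff\<close>)
  have [simp]: "f \<in> Arr C" "Dom C f = X" "Cod C f = Y" "g \<in> Arr C" "Dom C g = Y" "Cod C g = X"
    using f g by (auto simp: Hom_iff)
  have "g \<diamondop> f = ident C X"
    by (rule biproduct_joint_epi[OF L assms(1)]) (use f g X Y in auto)
  moreover have "f \<diamondop> g = ident C Y"
    by (rule biproduct_joint_epi[OF L assms(2)]) (use f g X Y in auto)
  ultimately show ?thesis
    by (intro isomorphicI[of f] is_isoI(1)[of f g]) (auto simp: f(1))
qed

lemma biproduct_change_summands:
  assumes B: "biproduct C Xs X \<iota> \<pi>" and len: "length Ys = length Xs"
    and u: "\<And>i. i < length Xs \<Longrightarrow> is_iso C (u i) \<and> u i \<in> Hom C (Ys ! i) (Xs ! i)"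
  shows "biproduct C Ys X (\<lambda>i. \<iota> i \<diamondop> u i) (\<lambda>i. arr_inv C (u i) \<diamondop> \<pi> i)"
proof -
  note L = linear_category_axioms
  note [simp] = biproduct_simps[OF L B] biproduct_delta_reassoc[OF L B]
  have [simp]: "is_iso C (u i)" "u i \<in> Arr C" "Dom C (u i) = Ys ! i" "Cod C (u i) = Xs ! i"
    "Ys ! i \<in> Obj C" if "i < length Xs" for i
    using u[OF that] Hom_Obj[of "u i" "Ys ! i" "Xs ! i"] by (auto simp: Hom_iff)
  show ?thesis
  proof (rule biproductI)
    show "set Ys \<subseteq> Obj C" using len by (auto simp: set_conv_nth)
  next
    fix f assume f: "f \<in> Hom C X X" "\<And>i. i < length Ys \<Longrightarrow> f \<diamondop> \<iota> i \<diamondop> u i = \<iota> i \<diamondop> u i"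
    show "f = ident C X"
    proof (rule biproduct_joint_epi[OF L B])
      fix i assume i: "i < length Xs"
      show "f \<diamondop> \<iota> i = ident C X \<diamondop> \<iota> i"
        by (rule iso_cancel_right[of "u i"]) (use i f len in \<open>auto simp: Hom_iff\<close>)
    qed (use f in \<open>auto simp: Hom_iff\<close>)
  qed (use len in \<open>auto simp: Hom_iff\<close>)
qed

end

lemma (in abelian_category) biproduct_exists:
  assumes "set Xs \<subseteq> Obj C"
  shows "\<exists>X \<iota> \<pi>. biproduct C Xs X \<iota> \<pi>"
  using assms
proof (induction Xs)
  case Nil
  obtain Z where Z: "is_zero_object C Z" using has_zero_object by blast
  then have "Z \<in> Obj C" by (simp add: is_zero_object_def)
  have "biproduct C [] Z (\<lambda>_. ident C Z) (\<lambda>_. ident C Z)"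
    by (rule biproductI)
      (use Z \<open>Z \<in> Obj C\<close> ident_Hom in \<open>auto simp: is_zero_object_def\<close>)
  then show ?case by blast
next
  case (Cons A Xs)
  note L = linear_category_axioms
  obtain X \<iota> \<pi> where B: "biproduct C Xs X \<iota> \<pi>" using Cons by auto
  note [simp] = biproduct_simps[OF L B] biproduct_delta_reassoc[OF L B]
  have A [simp]: "A \<in> Obj C" using Cons by simp
  obtain Y j q where D: "biproduct C [A, X] Y j q"
    using has_biproducts[of A X] by (auto simp: is_direct_sum_iff)
  have D': "Y \<in> Obj C" "j 0 \<in> Arr C" "j (Suc 0) \<in> Arr C" "Dom C (j 0) = A" "Dom C (j (Suc 0)) = X"
    "Cod C (j 0) = Y" "Cod C (j (Suc 0)) = Y" "q 0 \<in> Arr C" "q (Suc 0) \<in> Arr C" "Dom C (q 0) = Y" "Dom C (q (Suc 0)) = Y"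
    "Cod C (q 0) = A" "Cod C (q (Suc 0)) = X" "q 0 \<diamondop> j 0 = ident C A" "q (Suc 0) \<diamondop> j (Suc 0) = ident C X"
    "q (Suc 0) \<diamondop> j 0 = lzero C A X" "q 0 \<diamondop> j (Suc 0) = lzero C X A"
    using biproduct_simps(1)[OF L D] biproduct_simps(2-9)[OF L D, of 0] biproduct_simps(2-9)[OF L D, of 1]
      biproduct_simps(10)[OF L D, of 0 1] biproduct_simps(10)[OF L D, of 1 0] by auto
  note [simp] = D' cmp_reassoc[OF D'(14)] cmp_reassoc[OF D'(15)] cmp_reassoc[OF D'(16)]
    cmp_reassoc[OF D'(17)]
  let ?\<iota> = "\<lambda>i. case i of 0 \<Rightarrow> j 0 | Suc n \<Rightarrow> j (Suc 0) \<diamondop> \<iota> n"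
  let ?\<pi> = "\<lambda>i. case i of 0 \<Rightarrow> q 0 | Suc n \<Rightarrow> \<pi> n \<diamondop> q (Suc 0)"
  have "biproduct C (A # Xs) Y ?\<iota> ?\<pi>"
  proof (rule biproductI)
    show "set (A # Xs) \<subseteq> Obj C" using Cons by simp
  next
    fix f assume f: "f \<in> Hom C Y Y" "\<And>i. i < length (A # Xs) \<Longrightarrow> f \<diamondop> ?\<iota> i = ?\<iota> i"
    have fA [simp]: "f \<in> Arr C" "Dom C f = Y" "Cod C f = Y" using f(1) by (auto simp: Hom_iff)
    show "f = ident C Y"
    proof (rule biproduct_joint_epi[OF L D])
      have 0: "f \<diamondop> j 0 = j 0" using f(2)[of 0] by simp
      have "f \<diamondop> j (Suc 0) = j (Suc 0)"
      proof (rule biproduct_joint_epi[OF L B])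
        fix i assume i: "i < length Xs"
        then show "(f \<diamondop> j (Suc 0)) \<diamondop> \<iota> i = j (Suc 0) \<diamondop> \<iota> i" using f(2)[of "Suc i"] by simp
      qed auto
      then show "f \<diamondop> j i = ident C Y \<diamondop> j i" if "i < length [A, X]" for i
        using that 0 by (cases i) (auto simp: less_Suc_eq)
    qed auto
  qed (auto simp: Hom_iff split: nat.splits)
  then show ?case by blast
qed

section \<open>Simple objects\<close>

context linear_category
begin

lemma is_zero_object_iff:
  assumes "X \<in> Obj C"
  shows "is_zero_object C X \<longleftrightarrow> ident C X = lzero C X X"
proof
  assume "is_zero_object C X"
  then show "ident C X = lzero C X X"
    using assms ident_Hom lzero_Hom unfolding is_zero_object_def by blast
next
  assume eq: "ident C X = lzero C X X"
  have "f = lzero C Y X" if "f \<in> Hom C Y X" for f Y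
    using that cmp_ident_left[OF that] cmp_lzero_left[of f X X] assms
    by (simp add: eq Hom_iff)
  moreover have "f = lzero C X Y" if "f \<in> Hom C X Y" for f Y
    using that cmp_ident_right[OF that] cmp_lzero_right[of f X X] assms
    by (simp add: eq Hom_iff)
  ultimately show "is_zero_object C X"
    using assms lzero_Hom unfolding is_zero_object_def by blast
qed

lemma iso_nonzero:
  assumes "is_iso C f" "ident C (Cod C f) \<noteq> lzero C (Cod C f) (Cod C f)"
  shows "f \<noteq> lzero C (Dom C f) (Cod C f)"
proof
  assume "f = lzero C (Dom C f) (Cod C f)"
  then have "f \<diamondop> arr_inv C f = lzero C (Dom C f) (Cod C f) \<diamondop> arr_inv C f" by simp
  then show False using assms iso_Arr by simp
qed

lemma zero_object_isomorphic:
  assumes "isomorphic C X Y" "is_zero_object C X"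
  shows "is_zero_object C Y"
proof -
  obtain u where u: "is_iso C u" "u \<in> Arr C" "Dom C u = X" "Cod C u = Y" "X \<in> Obj C" "Y \<in> Obj C"
    using assms(1) by (rule isomorphicE)
  have "u \<diamondop> ident C X \<diamondop> arr_inv C u = u \<diamondop> lzero C X X \<diamondop> arr_inv C u"
    using assms u by (simp add: is_zero_object_iff)
  then show ?thesis using u by (simp add: is_zero_object_iff)
qed

text \<open>
  Hom spaces have no subtraction symbol of their own; the difference of \<open>f\<close> and \<open>g\<close> is written
  with the scalar \<open>-1\<close>.
\<close>

lemma ladd_minus_cancel:
  assumes "f \<in> Hom C X Y" "g \<in> Hom C X Y" "ladd C f (lsmult C (-1) g) = lzero C X Y"
  shows "f = g"
proof -
  have XY: "X \<in> Obj C" "Y \<in> Obj C" using assms Hom_Obj by auto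
  interpret M: Module.module class_ring "hom_space C X Y"
    using hom_module XY by simp
  have neg: "lsmult C (-1) g \<in> Hom C X Y" using assms lsmult_Hom by blast
  have "ladd C (lsmult C (-1) g) g = lzero C X Y"
    using lsmult_add[of g "-1" 1] assms by (simp add: Hom_iff)
  then have "ladd C f (lzero C X Y) = ladd C (lzero C X Y) g"
    using M.a_assoc[of f "lsmult C (-1) g" g] assms neg by simp
  then show ?thesis using M.r_zero[of f] M.l_zero[of g] assms by simp
qed

lemma scalar_endos_iff:
  assumes "X \<in> Obj C"
  shows "scalar_endos C X \<longleftrightarrow>
    ident C X \<noteq> lzero C X X \<and> (\<forall>f \<in> Hom C X X. \<exists>c. f = lsmult C c (ident C X))"
proof
  assume s: "scalar_endos C X"
  have "ident C X \<noteq> lzero C X X"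
  proof
    assume eq: "ident C X = lzero C X X"
    have "inj (\<lambda>c. lsmult C c (ident C X))"
      using s by (simp add: scalar_endos_def bij_betw_def)
    then show False
      using injD[of "\<lambda>c. lsmult C c (ident C X)" 0 1] eq assms by simp
  qed
  then show "ident C X \<noteq> lzero C X X \<and> (\<forall>f \<in> Hom C X X. \<exists>c. f = lsmult C c (ident C X))"
    using s by (auto simp: scalar_endos_def bij_betw_def)
next
  assume *: "ident C X \<noteq> lzero C X X \<and> (\<forall>f \<in> Hom C X X. \<exists>c. f = lsmult C c (ident C X))"
  have "inj (\<lambda>c. lsmult C c (ident C X))"
    by (rule injI) (use * assms lsmult_cancel[of _ "ident C X"] in auto)
  moreover have "range (\<lambda>c. lsmult C c (ident C X)) = Hom C X X"
    using * lsmult_Hom[OF ident_Hom[OF assms]] by auto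
  ultimately show "scalar_endos C X"
    by (simp add: scalar_endos_def bij_betw_def)
qed

text \<open>
  This is what turns the comparison of two isomorphisms into a scalar, and so the source of
  all cocycles below.
\<close>

lemma scalar_multiple_of_iso:
  assumes "scalar_endos C Y" "is_iso C v" "v \<in> Hom C X Y" "u \<in> Hom C X Y"
  obtains c where "u = lsmult C c v"
proof -
  have Y: "Y \<in> Obj C" using assms Hom_Obj by auto
  have "u \<diamondop> arr_inv C v \<in> Hom C Y Y" using assms by (simp add: Hom_iff)
  then obtain c where "u \<diamondop> arr_inv C v = lsmult C c (ident C Y)"
    using assms(1) Y scalar_endos_iff by blast
  then have "(u \<diamondop> arr_inv C v) \<diamondop> v = lsmult C c (ident C Y) \<diamondop> v" by simp
  then have "u = lsmult C c v" using assms by (simp add: Hom_iff Y)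
  then show ?thesis by (rule that)
qed

lemma iso_multiple_unique:
  assumes "scalar_endos C Y" "is_iso C v" "v \<in> Hom C X Y" "lsmult C a v = lsmult C b v"
  shows "a = b"
proof (rule lsmult_cancel[OF assms(4)])
  show "v \<in> Arr C" using assms by (simp add: Hom_iff)
  show "v \<noteq> lzero C (Dom C v) (Cod C v)"
    using iso_nonzero[of v] assms scalar_endos_iff[of Y] Hom_Obj[of v X Y] by (simp add: Hom_iff)
qed

lemma iso_multiple_nonzero:
  assumes "scalar_endos C Y" "is_iso C u" "u \<in> Hom C X Y" "u = lsmult C c v" "v \<in> Hom C X Y"
  shows "c \<noteq> 0"
proof
  assume "c = 0"
  then have "u = lzero C (Dom C u) (Cod C u)" using assms by (simp add: Hom_iff)
  then show False using iso_nonzero[of u] assms scalar_endos_iff[of Y] Hom_Obj[of u X Y]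
    by (simp add: Hom_iff)
qed

lemma is_iso_lsmult [simp]:
  assumes "is_iso C v" "c \<noteq> 0"
  shows "is_iso C (lsmult C c v)"
  by (rule is_isoI(1)[of _ "lsmult C (inverse c) (arr_inv C v)"]) (use assms iso_Arr in auto)

lemma scalar_endos_isomorphic:
  assumes "isomorphic C X Y" "scalar_endos C X"
  shows "scalar_endos C Y"
proof -
  obtain u where u: "is_iso C u" "u \<in> Arr C" "Dom C u = X" "Cod C u = Y" "X \<in> Obj C" "Y \<in> Obj C"
    using assms(1) by (rule isomorphicE)
  have "\<not> is_zero_object C Y"
    using assms u zero_object_isomorphic[OF isomorphic_sym[OF assms(1)]] scalar_endos_iff[of X]
      is_zero_object_iff[of X] by auto
  moreover have "\<exists>c. f = lsmult C c (ident C Y)" if f: "f \<in> Hom C Y Y" for f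
  proof -
    have fA: "f \<in> Arr C" "Dom C f = Y" "Cod C f = Y" using f by (auto simp: Hom_iff)
    have "arr_inv C u \<diamondop> f \<diamondop> u \<in> Hom C X X" using u fA by (simp add: Hom_iff)
    then obtain c where c: "arr_inv C u \<diamondop> f \<diamondop> u = lsmult C c (ident C X)"
      using assms(2) u scalar_endos_iff[of X] by blast
    have "f = u \<diamondop> (arr_inv C u \<diamondop> f \<diamondop> u) \<diamondop> arr_inv C u" using u fA by simp
    also have "\<dots> = lsmult C c (ident C Y)" unfolding c using u by simp
    finally show ?thesis by blast
  qed
  ultimately show ?thesis using u scalar_endos_iff is_zero_object_iff by simp
qed

lemma mono_cmp_iso:
  assumes "is_mono C m" "is_iso C u" "Dom C u = Cod C m"
  shows "is_mono C (u \<diamondop> m)"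
  unfolding is_mono_def
proof (intro conjI allI ballI impI)
  have [simp]: "m \<in> Arr C" "u \<in> Arr C" using assms iso_Arr by (auto simp: is_mono_def)
  show "u \<diamondop> m \<in> Arr C" using assms by simp
  fix X g h
  assume gh: "g \<in> Hom C X (Dom C (u \<diamondop> m))" "h \<in> Hom C X (Dom C (u \<diamondop> m))"
    "(u \<diamondop> m) \<diamondop> g = (u \<diamondop> m) \<diamondop> h"
  then have "m \<diamondop> g = m \<diamondop> h"
    using assms iso_cancel_left[of u "m \<diamondop> g" "m \<diamondop> h"] by (simp add: Hom_iff)
  then show "g = h" using gh assms unfolding is_mono_def by simp
qed

lemma simple_isomorphic:
  assumes "isomorphic C X Y" "simple_object C X"
  shows "simple_object C Y"
  unfolding simple_object_def
proof (intro conjI allI impI)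
  obtain u where u: "is_iso C u" "u \<in> Arr C" "Dom C u = X" "Cod C u = Y" "X \<in> Obj C" "Y \<in> Obj C"
    using assms(1) by (rule isomorphicE)
  show "Y \<in> Obj C" using u by simp
  show "\<not> is_zero_object C Y"
    using zero_object_isomorphic[OF isomorphic_sym[OF assms(1)]] assms(2)
    by (auto simp: simple_object_def)
  fix m assume m: "is_mono C m \<and> Cod C m = Y"
  then have mA: "m \<in> Arr C" by (simp add: is_mono_def)
  have "is_mono C (arr_inv C u \<diamondop> m)" using m u by (intro mono_cmp_iso) auto
  then have "is_zero_object C (Dom C m) \<or> is_iso C (arr_inv C u \<diamondop> m)"
    using assms(2) u m mA unfolding simple_object_def by fastforce
  moreover have "is_iso C m" if "is_iso C (arr_inv C u \<diamondop> m)"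
    using is_iso_cmp[OF that u(1)] u m mA by simp
  ultimately show "is_zero_object C (Dom C m) \<or> is_iso C m" by blast
qed

end

context abelian_category
begin

text \<open>
  The kernel of a nonzero arrow is a proper subobject of the simple source, hence zero, so the
  arrow is mono, and a nonzero subobject of the simple target is everything.
\<close>

theorem schur:
  assumes "simple_object C X" "simple_object C Y" "f \<in> Hom C X Y" "f \<noteq> lzero C X Y"
  shows "is_iso C f"
proof -
  have X: "X \<in> Obj C" "\<not> is_zero_object C X" and Y: "Y \<in> Obj C"
    using assms by (auto simp: simple_object_def)
  have f [simp]: "f \<in> Arr C" "Dom C f = X" "Cod C f = Y" using assms by (auto simp: Hom_iff)
  obtain k where k: "is_kernel C f k" using has_kernels[of f] f(1) by blast
  then have [simp]: "k \<in> Arr C" "Cod C k = X" and fk: "f \<diamondop> k = lzero C (Dom C k) Y"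
    by (auto simp: is_kernel_def)
  have univ: "\<exists>!u. u \<in> Hom C W (Dom C k) \<and> k \<diamondop> u = h"
    if "h \<in> Hom C W X" "f \<diamondop> h = lzero C W Y" for W h
    using k that by (auto simp: is_kernel_def)
  have "is_mono C k" unfolding is_mono_def
  proof (intro conjI allI ballI impI)
    fix W g h assume gh: "g \<in> Hom C W (Dom C k)" "h \<in> Hom C W (Dom C k)" "k \<diamondop> g = k \<diamondop> h"
    then have "k \<diamondop> g \<in> Hom C W X" "f \<diamondop> k \<diamondop> g = lzero C W Y"
      using Y by (auto simp: Hom_iff cmp_reassoc[OF fk])
    then show "g = h" using univ[of "k \<diamondop> g" W] gh by metis
  qed simp
  then have "is_zero_object C (Dom C k) \<or> is_iso C k"
    using assms(1) unfolding simple_object_def by auto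
  then show ?thesis
  proof
    assume "is_iso C k"
    then have "f = lzero C X Y" using fk X Y
      by (intro iso_cancel_right[of k f "lzero C X Y"]) auto
    then show ?thesis using assms by simp
  next
    assume z: "is_zero_object C (Dom C k)"
    have k0: "k = lzero C (Dom C k) X"
    proof -
      have "k \<diamondop> ident C (Dom C k) = k \<diamondop> lzero C (Dom C k) (Dom C k)"
        using z by (simp add: is_zero_object_iff)
      then show ?thesis by simp
    qed
    have "is_mono C f" unfolding is_mono_def
    proof (intro conjI allI ballI impI)
      fix W g h assume gh: "g \<in> Hom C W (Dom C f)" "h \<in> Hom C W (Dom C f)" "f \<diamondop> g = f \<diamondop> h"
      then have W: "W \<in> Obj C" using Hom_Obj by blast
      let ?d = "ladd C g (lsmult C (-1) h)"
      have d: "?d \<in> Hom C W X" using gh lsmult_Hom ladd_Hom by simp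
      have "f \<diamondop> ?d = ladd C (f \<diamondop> g) (f \<diamondop> lsmult C (-1) h)"
        by (rule cmp_ladd_right[of _ W X _ _ Y]) (use gh lsmult_Hom assms in auto)
      also have "\<dots> = lsmult C (1 + -1) (f \<diamondop> h)"
        by (subst lsmult_add) (use gh in \<open>auto simp: Hom_iff\<close>)
      also have "\<dots> = lzero C W Y" using gh by (simp add: Hom_iff)
      finally obtain u where u: "u \<in> Hom C W (Dom C k)" "k \<diamondop> u = ?d"
        using univ[OF d] by blast
      have "k \<diamondop> u = lzero C W X"
        by (subst k0) (use u X in \<open>simp add: Hom_iff\<close>)
      then show "g = h" using u gh ladd_minus_cancel[of g W X h] by simp
    qed simp
    then show ?thesis using assms(2) X(2) unfolding simple_object_def by auto
  qed
qed

lemma schur_isomorphic: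
  assumes "simple_object C X" "simple_object C Y" "f \<in> Hom C X Y" "f \<noteq> lzero C X Y"
  shows "isomorphic C X Y"
  using schur[OF assms] assms by (auto intro: isomorphicI)

end


section \<open>Monoidal categories and invertible objects\<close>

context monoidal_category
begin

lemma tunit_Obj' [simp]: "tunit C \<in> Obj C" by (rule tunit_Obj)

lemma tobj_Obj' [simp]: "X \<in> Obj C \<Longrightarrow> Y \<in> Obj C \<Longrightarrow> tobj C X Y \<in> Obj C" by (rule tobj_Obj)

lemma tarr_simps [simp]:
  assumes "f \<in> Arr C" "g \<in> Arr C"
  shows "tarr C f g \<in> Arr C" "Dom C (tarr C f g) = tobj C (Dom C f) (Dom C g)"
    "Cod C (tarr C f g) = tobj C (Cod C f) (Cod C g)"
  using tarr_Hom[of f "Dom C f" "Cod C f" g "Dom C g" "Cod C g"] assms by (auto simp: Hom_iff)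

lemma tarr_ident' [simp]:
  "X \<in> Obj C \<Longrightarrow> Y \<in> Obj C \<Longrightarrow> tarr C (ident C X) (ident C Y) = ident C (tobj C X Y)"
  by (rule tarr_ident)

lemma tarr_cmp' [simp]:
  assumes "f \<in> Arr C" "g \<in> Arr C" "f' \<in> Arr C" "g' \<in> Arr C" "Dom C f' = Cod C f" "Dom C g' = Cod C g"
  shows "tarr C f' g' \<diamondop> tarr C f g = tarr C (f' \<diamondop> f) (g' \<diamondop> g)"
  using tarr_cmp[of f "Dom C f" "Cod C f" f' "Cod C f'" g "Dom C g" "Cod C g" g' "Cod C g'"] assms
  by (simp add: Hom_iff)

lemma tarr_cmp_reassoc [simp]:
  assumes "f \<in> Arr C" "g \<in> Arr C" "f' \<in> Arr C" "g' \<in> Arr C" "Dom C f' = Cod C f" "Dom C g' = Cod C g"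
    "h \<in> Arr C" "Cod C h = tobj C (Dom C f) (Dom C g)"
  shows "tarr C f' g' \<diamondop> tarr C f g \<diamondop> h = tarr C (f' \<diamondop> f) (g' \<diamondop> g) \<diamondop> h"
  using cmp_reassoc[OF tarr_cmp'[OF assms(1-6)], of h] assms by simp

lemma is_iso_tarr [simp]: 
  assumes "is_iso C f" "is_iso C g"
  shows "is_iso C (tarr C f g)" "arr_inv C (tarr C f g) = tarr C (arr_inv C f) (arr_inv C g)"
  using is_isoI[of "tarr C f g" "tarr C (arr_inv C f) (arr_inv C g)"] assms
  by (simp_all add: iso_Arr)

lemma assoc_simps [simp]:
  assumes "X \<in> Obj C" "Y \<in> Obj C" "Z \<in> Obj C"
  shows "assoc C X Y Z \<in> Arr C" "Dom C (assoc C X Y Z) = tobj C (tobj C X Y) Z"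
    "Cod C (assoc C X Y Z) = tobj C X (tobj C Y Z)" "is_iso C (assoc C X Y Z)"
  using assoc_Hom[OF assms] assoc_iso[OF assms] by (auto simp: Hom_iff)

lemma unit_simps [simp]:
  assumes "X \<in> Obj C"
  shows "lunit C X \<in> Arr C" "Dom C (lunit C X) = tobj C (tunit C) X" "Cod C (lunit C X) = X"
    "is_iso C (lunit C X)" "runit C X \<in> Arr C" "Dom C (runit C X) = tobj C X (tunit C)"
    "Cod C (runit C X) = X" "is_iso C (runit C X)"
  using lunit_Hom[OF assms] lunit_iso[OF assms] runit_Hom[OF assms] runit_iso[OF assms]
  by (auto simp: Hom_iff)

lemma assoc_natural':
  assumes "f \<in> Arr C" "g \<in> Arr C" "h \<in> Arr C"
  shows "assoc C (Cod C f) (Cod C g) (Cod C h) \<diamondop> tarr C (tarr C f g) h =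
    tarr C f (tarr C g h) \<diamondop> assoc C (Dom C f) (Dom C g) (Dom C h)"
  using assms by (intro assoc_natural) (auto simp: Hom_iff)

lemma lunit_natural': "f \<in> Arr C \<Longrightarrow>
    lunit C (Cod C f) \<diamondop> tarr C (ident C (tunit C)) f = f \<diamondop> lunit C (Dom C f)"
  by (rule lunit_natural) (auto simp: Hom_iff)

lemma runit_natural': "f \<in> Arr C \<Longrightarrow>
    runit C (Cod C f) \<diamondop> tarr C f (ident C (tunit C)) = f \<diamondop> runit C (Dom C f)"
  by (rule runit_natural) (auto simp: Hom_iff)

lemma isomorphic_tobj:
  assumes "isomorphic C X X'" "isomorphic C Y Y'"
  shows "isomorphic C (tobj C X Y) (tobj C X' Y')"
proof -
  obtain u v where "is_iso C u" "u \<in> Arr C" "Dom C u = X" "Cod C u = X'"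
    "is_iso C v" "v \<in> Arr C" "Dom C v = Y" "Cod C v = Y'"
    by (metis assms isomorphicE)
  then show ?thesis by (intro isomorphicI[of "tarr C u v"]) (auto simp: Hom_iff)
qed

lemma isomorphic_assoc:
  "X \<in> Obj C \<Longrightarrow> Y \<in> Obj C \<Longrightarrow> Z \<in> Obj C \<Longrightarrow>
    isomorphic C (tobj C (tobj C X Y) Z) (tobj C X (tobj C Y Z))"
  by (rule isomorphicI[of "assoc C X Y Z"]) (auto simp: Hom_iff)

lemma isomorphic_units:
  "X \<in> Obj C \<Longrightarrow> isomorphic C (tobj C (tunit C) X) X"
  "X \<in> Obj C \<Longrightarrow> isomorphic C (tobj C X (tunit C)) X"
  using isomorphicI[of "lunit C X"] isomorphicI[of "runit C X"] by (auto simp: Hom_iff)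

lemma isomorphic_cancel_inverse:
  assumes "X \<in> Obj C" "Y \<in> Obj C" "X' \<in> Obj C" "isomorphic C (tobj C X X') (tunit C)"
  shows "isomorphic C (tobj C X (tobj C X' Y)) Y"
proof -
  have "isomorphic C (tobj C X (tobj C X' Y)) (tobj C (tobj C X X') Y)"
    using assms by (intro isomorphic_sym[OF isomorphic_assoc])
  also have "isomorphic C (tobj C (tobj C X X') Y) (tobj C (tunit C) Y)"
    using assms by (intro isomorphic_tobj isomorphic_refl)
  also have "isomorphic C (tobj C (tunit C) Y) Y"
    using assms by (intro isomorphic_units)
  finally show ?thesis .
qed

lemma isomorphic_inverse_tobj:
  assumes "X \<in> Obj C" "Y \<in> Obj C" "X' \<in> Obj C" "Y' \<in> Obj C"
    "isomorphic C (tobj C X X') (tunit C)" "isomorphic C (tobj C Y Y') (tunit C)"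
  shows "isomorphic C (tobj C (tobj C X Y) (tobj C Y' X')) (tunit C)"
proof -
  have "isomorphic C (tobj C (tobj C X Y) (tobj C Y' X')) (tobj C X (tobj C Y (tobj C Y' X')))"
    using assms by (intro isomorphic_assoc) auto
  also have "isomorphic C \<dots> (tobj C X X')"
    using assms by (intro isomorphic_tobj isomorphic_refl isomorphic_cancel_inverse)
  also have "isomorphic C \<dots> (tunit C)" by fact
  finally show ?thesis .
qed

lemma invertible_objectE:
  assumes "invertible_object C X"
  obtains Y where "Y \<in> Obj C" "isomorphic C (tobj C X Y) (tunit C)" "isomorphic C (tobj C Y X) (tunit C)"
  using assms by (auto simp: invertible_object_def)

lemma invertible_tobj:
  assumes "invertible_object C X" "invertible_object C Y"
  shows "invertible_object C (tobj C X Y)"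
proof -
  obtain X' Y' where "X' \<in> Obj C" "isomorphic C (tobj C X X') (tunit C)" "isomorphic C (tobj C X' X) (tunit C)"
    "Y' \<in> Obj C" "isomorphic C (tobj C Y Y') (tunit C)" "isomorphic C (tobj C Y' Y) (tunit C)"
    by (metis assms invertible_objectE)
  moreover have "X \<in> Obj C" "Y \<in> Obj C" using assms by (auto simp: invertible_object_def)
  ultimately show ?thesis
    unfolding invertible_object_def
    by (intro conjI bexI[of _ "tobj C Y' X'"] isomorphic_inverse_tobj) auto
qed

lemma invertible_isomorphic:
  assumes "isomorphic C X Y" "invertible_object C X"
  shows "invertible_object C Y"
proof -
  obtain X' where X': "X' \<in> Obj C" "isomorphic C (tobj C X X') (tunit C)" "isomorphic C (tobj C X' X) (tunit C)"
    using assms(2) by (rule invertible_objectE)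
  have "isomorphic C (tobj C Y X') (tobj C X X')" "isomorphic C (tobj C X' Y) (tobj C X' X)"
    using isomorphic_tobj isomorphic_sym[OF assms(1)] isomorphic_refl[OF X'(1)] by blast+
  then show ?thesis
    using X' isomorphic_trans isomorphic_Obj[OF assms(1)] unfolding invertible_object_def by blast
qed

text \<open>
  Tensoring once more, with the one-sided inverse \<open>Z\<close> of \<open>Y\<close>, gives back the original arrows up
  to the associativity and unit constraints.
\<close>

lemma tarr_ident_faithful:
  assumes f: "f \<in> Hom C X X'" and g: "g \<in> Hom C X X'" and Y: "Y \<in> Obj C" "Z \<in> Obj C"
    and iso: "isomorphic C (tobj C Y Z) (tunit C)"
    and eq: "tarr C f (ident C Y) = tarr C g (ident C Y)"
  shows "f = g"
proof -
  have X: "X \<in> Obj C" "X' \<in> Obj C" using f Hom_Obj by auto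
  have [simp]: "f \<in> Arr C" "Dom C f = X" "Cod C f = X'" "g \<in> Arr C" "Dom C g = X" "Cod C g = X'"
    using f g by (auto simp: Hom_iff)
  have "tarr C f (ident C (tobj C Y Z)) \<diamondop> assoc C X Y Z = tarr C g (ident C (tobj C Y Z)) \<diamondop> assoc C X Y Z"
    using assoc_natural'[of f "ident C Y" "ident C Z"] assoc_natural'[of g "ident C Y" "ident C Z"]
      eq X Y by simp
  then have YZ: "tarr C f (ident C (tobj C Y Z)) = tarr C g (ident C (tobj C Y Z))"
    by (rule iso_cancel_right[rotated -1]) (use X Y in auto)
  obtain v where v: "is_iso C v" "v \<in> Arr C" "Dom C v = tobj C Y Z" "Cod C v = tunit C"
    using iso by (rule isomorphicE)
  have "tarr C f (ident C (tunit C)) \<diamondop> tarr C (ident C X) v =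
      tarr C (ident C X') v \<diamondop> tarr C f (ident C (tobj C Y Z))"
    using v X Y by simp
  also have "\<dots> = tarr C g (ident C (tunit C)) \<diamondop> tarr C (ident C X) v"
    unfolding YZ using v X Y by simp
  finally have "tarr C f (ident C (tunit C)) = tarr C g (ident C (tunit C))"
    by (rule iso_cancel_right[rotated -1]) (use v X Y in auto)
  then have "f \<diamondop> runit C X = g \<diamondop> runit C X"
    using runit_natural'[of f] runit_natural'[of g] by simp
  then show ?thesis
    by (rule iso_cancel_right[rotated -1]) (use X in auto)
qed

end

context tensor_category
begin

lemma tarr_lsmult [simp]:
  "f \<in> Arr C \<Longrightarrow> g \<in> Arr C \<Longrightarrow> tarr C (lsmult C c f) g = lsmult C c (tarr C f g)"
  "f \<in> Arr C \<Longrightarrow> g \<in> Arr C \<Longrightarrow> tarr C f (lsmult C c g) = lsmult C c (tarr C f g)"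
  using tarr_lsmult_left[of f "Dom C f" "Cod C f" g] tarr_lsmult_right[of f "Dom C f" "Cod C f" g]
  by (auto simp: Hom_iff)

lemma tarr_lzero [simp]:
  "X \<in> Obj C \<Longrightarrow> Y \<in> Obj C \<Longrightarrow> g \<in> Arr C \<Longrightarrow>
    tarr C (lzero C X Y) g = lzero C (tobj C X (Dom C g)) (tobj C Y (Cod C g))"
  "X \<in> Obj C \<Longrightarrow> Y \<in> Obj C \<Longrightarrow> g \<in> Arr C \<Longrightarrow>
    tarr C g (lzero C X Y) = lzero C (tobj C (Dom C g) X) (tobj C (Cod C g) Y)"
  using tarr_lsmult(1)[of "lzero C X Y" g 0] tarr_lsmult(2)[of g "lzero C X Y" 0] by simp_all

text \<open>
  Tensoring with an inverse of \<open>X\<close> embeds \<open>End(X)\<close> into the endomorphisms of an object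
  isomorphic to the unit, which are scalars.
\<close>

lemma invertible_scalar_endos:
  assumes "invertible_object C X"
  shows "scalar_endos C X"
proof -
  obtain Y where Y: "Y \<in> Obj C" "isomorphic C (tobj C X Y) (tunit C)" "isomorphic C (tobj C Y X) (tunit C)"
    using assms by (rule invertible_objectE)
  have X: "X \<in> Obj C" using assms by (simp add: invertible_object_def)
  have XY: "scalar_endos C (tobj C X Y)"
    using scalar_endos_isomorphic[OF isomorphic_sym[OF Y(2)] tunit_scalar_endos] .
  have "ident C X \<noteq> lzero C X X"
  proof
    assume "ident C X = lzero C X X"
    then have "tarr C (ident C X) (ident C Y) = lzero C (tobj C X Y) (tobj C X Y)"
      using X Y by (simp del: tarr_ident')
    then show False using XY X Y by (simp add: scalar_endos_iff)
  qed
  moreover have "\<exists>c. f = lsmult C c (ident C X)" if f: "f \<in> Hom C X X" for f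
  proof -
    have "tarr C f (ident C Y) \<in> Hom C (tobj C X Y) (tobj C X Y)"
      using f Y by (simp add: Hom_iff)
    then obtain c where "tarr C f (ident C Y) = lsmult C c (ident C (tobj C X Y))"
      using XY X Y scalar_endos_iff[of "tobj C X Y"] by auto
    then have "tarr C f (ident C Y) = tarr C (lsmult C c (ident C X)) (ident C Y)"
      using X Y by simp
    then have "f = lsmult C c (ident C X)"
      using tarr_ident_faithful[OF f _ Y(1) X Y(3)] X by (simp add: Hom_iff)
    then show ?thesis by blast
  qed
  ultimately show ?thesis using scalar_endos_iff X by blast
qed

lemma trivial_object_unit:
  assumes "isomorphic C X (tunit C)"
  shows "trivial_object C X"
proof -
  obtain u where u: "is_iso C u" "u \<in> Arr C" "Dom C u = tunit C" "Cod C u = X"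
    using isomorphic_sym[OF assms] by (rule isomorphicE)
  then have "biproduct C (replicate 1 (tunit C)) X (\<lambda>_. u) (\<lambda>_. arr_inv C u)"
    using biproduct_single[of u X] by simp
  then show ?thesis unfolding trivial_object_def is_direct_sum_iff by blast
qed

end

context fusion_category
begin

text \<open>
  If \<open>X\<close> is a direct sum of simple objects, the projector onto the first of them is a nonzero
  scalar, hence the identity, so \<open>X\<close> is that summand.
\<close>

lemma scalar_endos_simple:
  assumes "X \<in> Obj C" "scalar_endos C X"
  shows "simple_object C X"
proof -
  note L = linear_category_axioms
  obtain Ss \<iota> \<pi> where Ss: "\<forall>S \<in> set Ss. simple_object C S" and B: "biproduct C Ss X \<iota> \<pi>"
    using semisimple[OF assms(1)] by (auto simp: semisimple_object_def is_direct_sum_iff)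
  note [simp] = biproduct_simps[OF L B] biproduct_delta_reassoc[OF L B]
  have nz: "ident C X \<noteq> lzero C X X" using assms scalar_endos_iff by blast
  have "Ss \<noteq> []"
  proof
    assume "Ss = []"
    then have "ident C X = lzero C X X" using biproduct_sum[OF L B] assms by simp
    then show False using nz by blast
  qed
  then have 0: "0 < length Ss" by simp
  then have S0: "simple_object C (Ss ! 0)" "\<not> is_zero_object C (Ss ! 0)"
    using Ss by (auto simp: simple_object_def)
  have "\<iota> 0 \<diamondop> \<pi> 0 \<in> Hom C X X" using 0 by (simp add: Hom_iff)
  then obtain c where c: "\<iota> 0 \<diamondop> \<pi> 0 = lsmult C c (ident C X)"
    using assms scalar_endos_iff by blast
  have "(\<iota> 0 \<diamondop> \<pi> 0) \<diamondop> \<iota> 0 = lsmult C c (\<iota> 0)"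
    unfolding c using 0 assms by simp
  then have "lsmult C 1 (\<iota> 0) = lsmult C c (\<iota> 0)" using 0 by simp
  moreover have "\<iota> 0 \<noteq> lzero C (Dom C (\<iota> 0)) (Cod C (\<iota> 0))"
  proof
    assume "\<iota> 0 = lzero C (Dom C (\<iota> 0)) (Cod C (\<iota> 0))"
    then have "\<pi> 0 \<diamondop> \<iota> 0 = \<pi> 0 \<diamondop> lzero C (Ss ! 0) X" using 0 by simp
    then show False using 0 S0 by (simp add: is_zero_object_iff)
  qed
  ultimately have "c = 1" using lsmult_cancel[of 1 "\<iota> 0" c] 0 by simp
  then have "is_iso C (\<iota> 0)"
    using 0 c assms by (intro is_isoI(1)[of _ "\<pi> 0"]) auto
  then have "isomorphic C (Ss ! 0) X" using 0 by (intro isomorphicI[of "\<iota> 0"]) (auto simp: Hom_iff)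
  then show ?thesis using simple_isomorphic S0 by blast
qed

lemma simple_iff_scalar_endos: "simple_object C X \<longleftrightarrow> X \<in> Obj C \<and> scalar_endos C X"
  using scalar_endos_simple split by (auto simp: simple_object_def)

lemma invertible_simple: "invertible_object C X \<Longrightarrow> simple_object C X"
  using invertible_scalar_endos scalar_endos_simple by (simp add: invertible_object_def)

lemma tunit_simple: "simple_object C (tunit C)"
  using scalar_endos_simple tunit_scalar_endos by simp

text \<open>
  Some component of a nonzero arrow is nonzero, and Schur's lemma makes it an isomorphism.
\<close>

lemma simple_into_biproduct:
  assumes B: "biproduct C Ss X \<iota> \<pi>" and Ss: "\<forall>S \<in> set Ss. simple_object C S"
    and f: "simple_object C Y" "f \<in> Hom C Y X" "f \<noteq> lzero C Y X"
  shows "\<exists>S \<in> set Ss. isomorphic C Y S"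
proof (rule ccontr)
  assume neg: "\<not> (\<exists>S \<in> set Ss. isomorphic C Y S)"
  note L = linear_category_axioms
  note [simp] = biproduct_simps[OF L B]
  have Y: "Y \<in> Obj C" using f Hom_Obj by blast
  have "f = lzero C Y X"
  proof (rule biproduct_joint_mono[OF L B])
    fix i assume i: "i < length Ss"
    have "\<pi> i \<diamondop> f = lzero C Y (Ss ! i)"
      using schur_isomorphic[of Y "Ss ! i" "\<pi> i \<diamondop> f"] f i neg Ss by (auto simp: Hom_iff)
    then show "\<pi> i \<diamondop> f = \<pi> i \<diamondop> lzero C Y X" using i Y f by (simp add: Hom_iff)
  qed (use f Y in \<open>auto simp: Hom_iff\<close>)
  then show False using f by simp
qed

lemma trivial_simple_object:
  assumes "simple_object C X" "trivial_object C X"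
  shows "isomorphic C X (tunit C)"
proof -
  obtain n \<iota> \<pi> where B: "biproduct C (replicate n (tunit C)) X \<iota> \<pi>"
    using assms(2) by (auto simp: trivial_object_def is_direct_sum_iff)
  have "X \<in> Obj C" "ident C X \<noteq> lzero C X X"
    using assms(1) is_zero_object_iff by (auto simp: simple_object_def)
  then show ?thesis
    using simple_into_biproduct[OF B _ assms(1), of "ident C X"] tunit_simple ident_Hom by auto
qed

end


section \<open>The Picard group\<close>

context monoidal_category
begin

lemma iso_class_tobj:
  assumes "X \<in> Obj C" "Y \<in> Obj C"
  shows "(\<Union>X' \<in> iso_class C X. \<Union>Y' \<in> iso_class C Y. iso_class C (tobj C X' Y')) =
    iso_class C (tobj C X Y)"
proof -
  have "iso_class C (tobj C X' Y') = iso_class C (tobj C X Y)"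
    if "isomorphic C X X'" "isomorphic C Y Y'" for X' Y'
    using that isomorphic_tobj iso_class_eq_iff[of "tobj C X' Y'"] isomorphic_Obj isomorphic_sym
    by (meson tobj_Obj)
  moreover have "X \<in> iso_class C X" "Y \<in> iso_class C Y"
    using assms isomorphic_refl by (auto simp: iso_class_def)
  ultimately show ?thesis unfolding iso_class_def by blast
qed

end

context pointed_category
begin

lemma simple_iff_invertible: "simple_object C X \<longleftrightarrow> invertible_object C X"
  using simple_invertible invertible_simple by blast

lemma simple_tobj: "simple_object C X \<Longrightarrow> simple_object C Y \<Longrightarrow> simple_object C (tobj C X Y)"
  using simple_iff_invertible invertible_tobj by blast

lemma carrier_Picard: "carrier (Picard C) = iso_class C ` {X. simple_object C X}"
  and one_Picard: "\<one>\<^bsub>Picard C\<^esub> = iso_class C (tunit C)"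
  by (simp_all add: Picard_def)

lemma mult_Picard: "simple_object C X \<Longrightarrow> simple_object C Y \<Longrightarrow>
    iso_class C X \<otimes>\<^bsub>Picard C\<^esub> iso_class C Y = iso_class C (tobj C X Y)"
  by (simp add: Picard_def iso_class_tobj simple_object_def)

lemma simple_Obj: "simple_object C X \<Longrightarrow> X \<in> Obj C"
  by (simp add: simple_object_def)

lemma group_Picard: "group (Picard C)"
proof (rule groupI)
  fix A B D assume "A \<in> carrier (Picard C)" "B \<in> carrier (Picard C)" "D \<in> carrier (Picard C)"
  then obtain X Y Z where XYZ: "simple_object C X" "simple_object C Y" "simple_object C Z"
    "A = iso_class C X" "B = iso_class C Y" "D = iso_class C Z"
    by (auto simp: carrier_Picard)
  then show "A \<otimes>\<^bsub>Picard C\<^esub> B \<otimes>\<^bsub>Picard C\<^esub> D = A \<otimes>\<^bsub>Picard C\<^esub> (B \<otimes>\<^bsub>Picard C\<^esub> D)"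
    using isomorphic_assoc[of X Y Z] iso_class_eq_iff
    by (simp add: mult_Picard simple_tobj simple_Obj)
next
  fix A B assume "A \<in> carrier (Picard C)" "B \<in> carrier (Picard C)"
  then show "A \<otimes>\<^bsub>Picard C\<^esub> B \<in> carrier (Picard C)"
    by (auto simp: carrier_Picard mult_Picard simple_tobj)
next
  show "\<one>\<^bsub>Picard C\<^esub> \<in> carrier (Picard C)"
    using tunit_simple by (auto simp: carrier_Picard one_Picard)
next
  fix A assume "A \<in> carrier (Picard C)"
  then obtain X where X: "simple_object C X" "A = iso_class C X"
    by (auto simp: carrier_Picard)
  show "\<one>\<^bsub>Picard C\<^esub> \<otimes>\<^bsub>Picard C\<^esub> A = A"
    using X isomorphic_units(1)[of X] iso_class_eq_iff tunit_simple
    by (simp add: one_Picard mult_Picard simple_Obj)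
  obtain Y where Y: "Y \<in> Obj C" "isomorphic C (tobj C X Y) (tunit C)" "isomorphic C (tobj C Y X) (tunit C)"
    using simple_invertible[OF X(1)] by (rule invertible_objectE)
  then have "simple_object C Y"
    using simple_Obj[OF X(1)] by (intro invertible_simple) (auto simp: invertible_object_def)
  then show "\<exists>B \<in> carrier (Picard C). B \<otimes>\<^bsub>Picard C\<^esub> A = \<one>\<^bsub>Picard C\<^esub>"
    using X Y iso_class_eq_iff[of "tobj C Y X" "tunit C"]
    by (intro bexI[of _ "iso_class C Y"]) (auto simp: carrier_Picard one_Picard mult_Picard simple_Obj)
qed

lemma finite_Picard: "finite (carrier (Picard C))"
  using finitely_many_simples by (simp add: carrier_Picard)

end

section \<open>Functors\<close>

locale functor_between = C: category C + D: category D
  for C :: "('o1, 'm1, 'y) category_data_scheme" and D :: "('o2, 'm2, 'z) category_data_scheme" (structure) +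
  fixes F :: "('o1, 'm1, 'o2, 'm2, 'w) functor_data_scheme"
  assumes F: "is_functor C D F"
begin

lemma F_simps [simp]:
  "X \<in> Obj C \<Longrightarrow> fobj F X \<in> Obj D"
  "f \<in> Arr C \<Longrightarrow> farr F f \<in> Arr D"
  "f \<in> Arr C \<Longrightarrow> Dom D (farr F f) = fobj F (Dom C f)"
  "f \<in> Arr C \<Longrightarrow> Cod D (farr F f) = fobj F (Cod C f)"
  "X \<in> Obj C \<Longrightarrow> farr F (ident C X) = ident D (fobj F X)"
  "f \<in> Arr C \<Longrightarrow> g \<in> Arr C \<Longrightarrow> Dom C g = Cod C f \<Longrightarrow>
    farr F (g \<diamondop>\<^bsub>C\<^esub> f) = farr F g \<diamondop> farr F f"
proof -
  have *: "farr F f \<in> Hom D (fobj F (Dom C f)) (fobj F (Cod C f))" if "f \<in> Arr C" for f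
    using F that by (auto simp: is_functor_def Hom_iff)
  show "X \<in> Obj C \<Longrightarrow> fobj F X \<in> Obj D" "X \<in> Obj C \<Longrightarrow> farr F (ident C X) = ident D (fobj F X)"
    using F by (auto simp: is_functor_def)
  show "f \<in> Arr C \<Longrightarrow> farr F f \<in> Arr D"
    "f \<in> Arr C \<Longrightarrow> Dom D (farr F f) = fobj F (Dom C f)"
    "f \<in> Arr C \<Longrightarrow> Cod D (farr F f) = fobj F (Cod C f)"
    using * by (auto simp: Hom_iff)
  show "f \<in> Arr C \<Longrightarrow> g \<in> Arr C \<Longrightarrow> Dom C g = Cod C f \<Longrightarrow>
    farr F (g \<diamondop>\<^bsub>C\<^esub> f) = farr F g \<diamondop> farr F f"
    using F by (auto simp: is_functor_def Hom_iff)
qed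

lemma F_Hom: "f \<in> Hom C X Y \<Longrightarrow> farr F f \<in> Hom D (fobj F X) (fobj F Y)"
  by (auto simp: Hom_iff)

lemma F_iso [simp]:
  assumes "is_iso C f"
  shows "is_iso D (farr F f)" "arr_inv D (farr F f) = farr F (arr_inv C f)"
proof -
  have "f \<in> Arr C" using assms C.iso_Arr by blast
  moreover have "farr F (arr_inv C f) \<diamondop> farr F f = ident D (fobj F (Dom C f))"
    "farr F f \<diamondop> farr F (arr_inv C f) = ident D (fobj F (Cod C f))"
    using assms \<open>f \<in> Arr C\<close> F_simps(6)[of f "arr_inv C f"] F_simps(6)[of "arr_inv C f" f] by auto
  ultimately show "is_iso D (farr F f)" "arr_inv D (farr F f) = farr F (arr_inv C f)"
    using D.is_isoI[of "farr F f" "farr F (arr_inv C f)"] assms by auto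
qed

lemma F_isomorphic: "isomorphic C X Y \<Longrightarrow> isomorphic D (fobj F X) (fobj F Y)"
  by (erule C.isomorphicE, rule D.isomorphicI[OF F_iso(1)]) (auto simp: Hom_iff)

lemma F_iso_inverse_arrows:
  assumes "is_iso C f"
  shows "farr F f \<diamondop> farr F (arr_inv C f) = ident D (fobj F (Cod C f))"
    "farr F (arr_inv C f) \<diamondop> farr F f = ident D (fobj F (Dom C f))"
  using D.arr_inv_simps(4,5)[OF F_iso(1)[OF assms]] F_iso(2)[OF assms] assms C.iso_Arr by auto

text \<open>
  This is for functors known to be full only on some Hom sets. Bijectivity from \<open>B\<close> to itself
  and from \<open>A\<close> to \<open>B\<close> suffices, because the given isomorphism between \<open>A\<close> and \<open>B\<close> supplies
  an arrow in the other direction.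
\<close>

lemma reflects_iso:
  assumes f: "f \<in> Hom C A B" and iso: "is_iso D (farr F f)" and AB: "isomorphic C A B"
    and full: "bij_betw (farr F) (Hom C B B) (Hom D (fobj F B) (fobj F B))"
      "bij_betw (farr F) (Hom C A B) (Hom D (fobj F A) (fobj F B))"
  shows "is_iso C f"
proof -
  obtain w where w: "is_iso C w" "w \<in> Arr C" "Dom C w = A" "Cod C w = B" "A \<in> Obj C" "B \<in> Obj C"
    using AB by (rule C.isomorphicE)
  have [simp]: "f \<in> Arr C" "Dom C f = A" "Cod C f = B" using f by (auto simp: Hom_iff)
  have FI: "farr F w \<diamondop> farr F (arr_inv C w) = ident D (fobj F B)"
    using F_iso_inverse_arrows(1)[OF w(1)] w by simp
  have "farr F w \<diamondop> arr_inv D (farr F f) \<in> Hom D (fobj F B) (fobj F B)"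
    using iso w by (simp add: Hom_iff)
  then obtain z where z: "z \<in> Hom C B B" "farr F z = farr F w \<diamondop> arr_inv D (farr F f)"
    using full(1) unfolding bij_betw_def by (metis imageE)
  then have [simp]: "z \<in> Arr C" "Dom C z = B" "Cod C z = B" by (auto simp: Hom_iff)
  have "farr F (z \<diamondop>\<^bsub>C\<^esub> f) = farr F w" using z iso w by (simp)
  then have zf: "z \<diamondop>\<^bsub>C\<^esub> f = w"
    using full(2) w by (auto simp: bij_betw_def inj_on_def Hom_iff)
  have "farr F (f \<diamondop>\<^bsub>C\<^esub> arr_inv C w \<diamondop>\<^bsub>C\<^esub> z) = farr F (ident C B)"
  proof -
    have "farr F (arr_inv C w) \<diamondop> farr F w \<diamondop> arr_inv D (farr F f) = arr_inv D (farr F f)"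
      using D.cmp_reassoc[OF F_iso_inverse_arrows(2)[OF w(1)]] w iso by simp
    then show ?thesis using w z iso by simp
  qed
  then have "f \<diamondop>\<^bsub>C\<^esub> arr_inv C w \<diamondop>\<^bsub>C\<^esub> z = ident C B"
    using full(1) w by (auto simp: bij_betw_def inj_on_def Hom_iff)
  then show ?thesis
    using w zf by (intro C.is_isoI(1)[of f "arr_inv C w \<diamondop>\<^bsub>C\<^esub> z"]) auto
qed

end

locale equivalence_functor = functor_between C D F
  for C :: "('o1, 'm1, 'y) category_data_scheme" and D :: "('o2, 'm2, 'z) category_data_scheme" (structure)
    and F :: "('o1, 'm1, 'o2, 'm2, 'w) functor_data_scheme" +
  assumes fully_faithful: "full_embedding C D F"
    and essentially_surjective: "Y \<in> Obj D \<Longrightarrow> \<exists>X \<in> Obj C. isomorphic D (fobj F X) Y"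
begin

lemma full:
  assumes "X \<in> Obj C" "Y \<in> Obj C" "h \<in> Hom D (fobj F X) (fobj F Y)"
  obtains g where "g \<in> Arr C" "Dom C g = X" "Cod C g = Y" "farr F g = h"
proof -
  have "farr F ` Hom C X Y = Hom D (fobj F X) (fobj F Y)"
    using fully_faithful assms(1,2) unfolding full_embedding_def bij_betw_def by simp
  then have "h \<in> farr F ` Hom C X Y" using assms(3) by simp
  then show ?thesis by (rule imageE) (rule that, auto simp: Hom_iff)
qed

lemma faithful:
  assumes "f \<in> Arr C" "g \<in> Arr C" "Dom C f = Dom C g" "Cod C f = Cod C g" "farr F f = farr F g"
  shows "f = g"
proof -
  have "inj_on (farr F) (Hom C (Dom C f) (Cod C f))"
    using fully_faithful assms unfolding full_embedding_def bij_betw_def by simp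
  then show ?thesis using assms by (auto simp: inj_on_def Hom_iff)
qed

lemma is_equivalence: "is_equivalence C D F"
proof -
  have "\<forall>Y. \<exists>X u. Y \<in> Obj D \<longrightarrow> X \<in> Obj C \<and> is_iso D u \<and> u \<in> Arr D \<and> Dom D u = fobj F X \<and> Cod D u = Y"
    using essentially_surjective by (metis D.isomorphicE)
  then obtain S u where S: "\<And>Y. Y \<in> Obj D \<Longrightarrow> S Y \<in> Obj C"
    and u: "\<And>Y. Y \<in> Obj D \<Longrightarrow> is_iso D (u Y)" "\<And>Y. Y \<in> Obj D \<Longrightarrow> u Y \<in> Arr D"
      "\<And>Y. Y \<in> Obj D \<Longrightarrow> Dom D (u Y) = fobj F (S Y)" "\<And>Y. Y \<in> Obj D \<Longrightarrow> Cod D (u Y) = Y"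
    by metis
  note [simp] = S u
  have "\<forall>h. \<exists>g. h \<in> Arr D \<longrightarrow> g \<in> Arr C \<and> Dom C g = S (Dom D h) \<and> Cod C g = S (Cod D h) \<and>
      farr F g = arr_inv D (u (Cod D h)) \<diamondop> h \<diamondop> u (Dom D h)"
  proof
    fix h
    show "\<exists>g. h \<in> Arr D \<longrightarrow> g \<in> Arr C \<and> Dom C g = S (Dom D h) \<and> Cod C g = S (Cod D h) \<and>
      farr F g = arr_inv D (u (Cod D h)) \<diamondop> h \<diamondop> u (Dom D h)"
    proof (cases "h \<in> Arr D")
      case True
      show ?thesis
        by (rule full[of "S (Dom D h)" "S (Cod D h)"
              "arr_inv D (u (Cod D h)) \<diamondop> h \<diamondop> u (Dom D h)"])
          (use True in \<open>auto simp: Hom_iff\<close>)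
    qed simp
  qed
  then obtain T where T [simp]: "\<And>h. h \<in> Arr D \<Longrightarrow> T h \<in> Arr C"
      "\<And>h. h \<in> Arr D \<Longrightarrow> Dom C (T h) = S (Dom D h)" "\<And>h. h \<in> Arr D \<Longrightarrow> Cod C (T h) = S (Cod D h)"
      "\<And>h. h \<in> Arr D \<Longrightarrow> farr F (T h) = arr_inv D (u (Cod D h)) \<diamondop> h \<diamondop> u (Dom D h)"
    by metis
  define G :: "('o2, 'm2, 'o1, 'm1) functor_data" where "G = \<lparr>fobj = S, farr = T\<rparr>"
  have "T (ident D X) = ident C (S X)" if "X \<in> Obj D" for X
    by (rule faithful) (use that in auto)
  moreover have "T (g \<diamondop> f) = T g \<diamondop>\<^bsub>C\<^esub> T f" if "f \<in> Arr D" "g \<in> Arr D" "Dom D g = Cod D f" for f g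
    by (rule faithful) (use that in auto)
  ultimately have G: "is_functor D C G"
    unfolding is_functor_def G_def by (simp add: Hom_iff)
  have "\<forall>X. \<exists>v. X \<in> Obj C \<longrightarrow> v \<in> Arr C \<and> Dom C v = S (fobj F X) \<and> Cod C v = X \<and>
      farr F v = u (fobj F X)"
  proof
    fix X
    show "\<exists>v. X \<in> Obj C \<longrightarrow> v \<in> Arr C \<and> Dom C v = S (fobj F X) \<and> Cod C v = X \<and> farr F v = u (fobj F X)"
    proof (cases "X \<in> Obj C")
      case True
      show ?thesis
        by (rule full[of "S (fobj F X)" X "u (fobj F X)"]) (use True in \<open>auto simp: Hom_iff\<close>)
    qed simp
  qed
  then obtain v where v [simp]: "\<And>X. X \<in> Obj C \<Longrightarrow> v X \<in> Arr C" "\<And>X. X \<in> Obj C \<Longrightarrow> Dom C (v X) = S (fobj F X)"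
      "\<And>X. X \<in> Obj C \<Longrightarrow> Cod C (v X) = X" "\<And>X. X \<in> Obj C \<Longrightarrow> farr F (v X) = u (fobj F X)"
    by metis
  have v_iso: "is_iso C (v X)" if X: "X \<in> Obj C" for X
  proof -
    obtain w where w: "w \<in> Arr C" "Dom C w = X" "Cod C w = S (fobj F X)"
        "farr F w = arr_inv D (u (fobj F X))"
      by (rule full[of X "S (fobj F X)" "arr_inv D (u (fobj F X))"]) (use X in \<open>auto simp: Hom_iff\<close>)
    have "w \<diamondop>\<^bsub>C\<^esub> v X = ident C (S (fobj F X))" "v X \<diamondop>\<^bsub>C\<^esub> w = ident C X"
      by (rule faithful; use X w in simp)+
    then show ?thesis using X w by (intro C.is_isoI(1)[of _ w]) auto
  qed
  have "v (Cod C f) \<diamondop>\<^bsub>C\<^esub> T (farr F f) = f \<diamondop>\<^bsub>C\<^esub> v (Dom C f)" if "f \<in> Arr C" for f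
    by (rule faithful) (use that in auto)
  then have "natural_iso C C (comp_functor G F) id_functor v"
    unfolding natural_iso_def comp_functor_def id_functor_def G_def
    by (auto simp: Hom_iff v_iso)
  moreover have "natural_iso D D (comp_functor F G) id_functor u"
    unfolding natural_iso_def comp_functor_def id_functor_def G_def
    by (auto simp: Hom_iff)
  ultimately show ?thesis unfolding is_equivalence_def using F G by blast
qed

end

text \<open>
  An equivalence that preserves zero arrows preserves kernels: a test arrow into the image is,
  up to an isomorphism of its source, the image of a test arrow.
\<close>

locale zero_preserving_equivalence = equivalence_functor C D F
  for C :: "('o1, 'm1, 'k :: field, 'y) linear_category_data_scheme"
    and D :: "('o2, 'm2, 'k, 'z) linear_category_data_scheme" (structure)
    and F :: "('o1, 'm1, 'o2, 'm2, 'w) functor_data_scheme" +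
  assumes D: "linear_category D"
    and zero_Hom: "X \<in> Obj C \<Longrightarrow> Y \<in> Obj C \<Longrightarrow> lzero C X Y \<in> Hom C X Y"
    and zero_preserving: "X \<in> Obj C \<Longrightarrow> Y \<in> Obj C \<Longrightarrow>
      farr F (lzero C X Y) = lzero D (fobj F X) (fobj F Y)"
begin

interpretation D: linear_category D by (rule D)

lemma zero_simps [simp]:
  "X \<in> Obj C \<Longrightarrow> Y \<in> Obj C \<Longrightarrow> lzero C X Y \<in> Arr C"
  "X \<in> Obj C \<Longrightarrow> Y \<in> Obj C \<Longrightarrow> Dom C (lzero C X Y) = X"
  "X \<in> Obj C \<Longrightarrow> Y \<in> Obj C \<Longrightarrow> Cod C (lzero C X Y) = Y"
  using zero_Hom by (auto simp: Hom_iff)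

lemma preserves_kernel:
  assumes "is_kernel C f k"
  shows "is_kernel D (farr F f) (farr F k)"
proof -
  have fk [simp]: "f \<in> Arr C" "k \<in> Arr C" "Cod C k = Dom C f"
    and fk0: "f \<diamondop>\<^bsub>C\<^esub> k = lzero C (Dom C k) (Cod C f)"
    using assms by (auto simp: is_kernel_def)
  have univ: "\<exists>!u. u \<in> Hom C W (Dom C k) \<and> k \<diamondop>\<^bsub>C\<^esub> u = h"
    if "h \<in> Hom C W (Dom C f)" "f \<diamondop>\<^bsub>C\<^esub> h = lzero C W (Cod C f)" for W h
    using assms that by (auto simp: is_kernel_def)
  have "farr F f \<diamondop> farr F k = lzero D (fobj F (Dom C k)) (fobj F (Cod C f))"
    using F_simps(6)[of k f] by (simp add: fk0 zero_preserving)
  moreover have "\<exists>!u. u \<in> Hom D W (fobj F (Dom C k)) \<and> farr F k \<diamondop> u = h"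
    if h: "h \<in> Hom D W (fobj F (Dom C f))" "farr F f \<diamondop> h = lzero D W (fobj F (Cod C f))" for W h
  proof -
    have hA [simp]: "h \<in> Arr D" "Dom D h = W" "Cod D h = fobj F (Dom C f)" "W \<in> Obj D"
      using h D.Hom_Obj by (auto simp: Hom_iff)
    obtain X where X: "X \<in> Obj C" "isomorphic D (fobj F X) W"
      using essentially_surjective[of W] by auto
    obtain u where u [simp]: "is_iso D u" "u \<in> Arr D" "Dom D u = fobj F X" "Cod D u = W"
      using X(2) by (rule D.isomorphicE)
    obtain h' where h' [simp]: "h' \<in> Arr C" "Dom C h' = X" "Cod C h' = Dom C f"
        and Fh': "farr F h' = h \<diamondop> u"
      by (rule full[of X "Dom C f" "h \<diamondop> u"]) (use X in \<open>auto simp: Hom_iff\<close>)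
    have "f \<diamondop>\<^bsub>C\<^esub> h' = lzero C X (Cod C f)"
      by (rule faithful) (use X in \<open>auto simp: Fh' zero_preserving D.cmp_reassoc[OF h(2)]\<close>)
    then have univ': "\<exists>!v. v \<in> Hom C X (Dom C k) \<and> k \<diamondop>\<^bsub>C\<^esub> v = h'"
      by (intro univ) (auto simp: Hom_iff)
    then obtain v where v: "v \<in> Hom C X (Dom C k)" and kv: "k \<diamondop>\<^bsub>C\<^esub> v = h'" by blast
    have [simp]: "v \<in> Arr C" "Dom C v = X" "Cod C v = Dom C k" using v by (auto simp: Hom_iff)
    have Fkv: "farr F k \<diamondop> farr F v = h \<diamondop> u"
      using F_simps(6)[of v k] by (simp add: kv Fh')
    show ?thesis
    proof (rule ex1I[of _ "farr F v \<diamondop> arr_inv D u"])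
      show "farr F v \<diamondop> arr_inv D u \<in> Hom D W (fobj F (Dom C k)) \<and>
          farr F k \<diamondop> farr F v \<diamondop> arr_inv D u = h"
        using D.cmp_reassoc[OF Fkv] by (simp add: Hom_iff)
    next
      fix w assume w: "w \<in> Hom D W (fobj F (Dom C k)) \<and> farr F k \<diamondop> w = h"
      then have wA [simp]: "w \<in> Arr D" "Dom D w = W" "Cod D w = fobj F (Dom C k)"
        and kw: "farr F k \<diamondop> w = h" by (auto simp: Hom_iff)
      obtain w' where w' [simp]: "w' \<in> Arr C" "Dom C w' = X" "Cod C w' = Dom C k"
          and Fw': "farr F w' = w \<diamondop> u"
        by (rule full[of X "Dom C k" "w \<diamondop> u"]) (use X in \<open>auto simp: Hom_iff\<close>)
      have "k \<diamondop>\<^bsub>C\<^esub> w' = h'"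
        by (rule faithful) (auto simp: Fh' Fw' D.cmp_reassoc[OF kw])
      moreover have "w' \<in> Hom C X (Dom C k)" by (simp add: Hom_iff)
      ultimately have "w' = v" using univ' v kv by blast
      then have "farr F v = w \<diamondop> u" using Fw' by simp
      then show "w = farr F v \<diamondop> arr_inv D u" by simp
    qed
  qed
  ultimately show ?thesis by (auto simp: is_kernel_def)
qed

lemma preserves_cokernel:
  assumes "is_cokernel C f q"
  shows "is_cokernel D (farr F f) (farr F q)"
proof -
  have fq [simp]: "f \<in> Arr C" "q \<in> Arr C" "Dom C q = Cod C f"
    and fq0: "q \<diamondop>\<^bsub>C\<^esub> f = lzero C (Dom C f) (Cod C q)"
    using assms by (auto simp: is_cokernel_def)
  have univ: "\<exists>!u. u \<in> Hom C (Cod C q) W \<and> u \<diamondop>\<^bsub>C\<^esub> q = h"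
    if "h \<in> Hom C (Cod C f) W" "h \<diamondop>\<^bsub>C\<^esub> f = lzero C (Dom C f) W" for W h
    using assms that by (auto simp: is_cokernel_def)
  have "farr F q \<diamondop> farr F f = lzero D (fobj F (Dom C f)) (fobj F (Cod C q))"
    using F_simps(6)[of f q] by (simp add: fq0 zero_preserving)
  moreover have "\<exists>!u. u \<in> Hom D (fobj F (Cod C q)) W \<and> u \<diamondop> farr F q = h"
    if h: "h \<in> Hom D (fobj F (Cod C f)) W" "h \<diamondop> farr F f = lzero D (fobj F (Dom C f)) W" for W h
  proof -
    have hA [simp]: "h \<in> Arr D" "Cod D h = W" "Dom D h = fobj F (Cod C f)" "W \<in> Obj D"
      using h D.Hom_Obj by (auto simp: Hom_iff)
    obtain X where X: "X \<in> Obj C" "isomorphic D (fobj F X) W"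
      using essentially_surjective[of W] by auto
    obtain u where u [simp]: "is_iso D u" "u \<in> Arr D" "Dom D u = W" "Cod D u = fobj F X"
      using D.isomorphic_sym[OF X(2)] by (rule D.isomorphicE)
    obtain h' where h' [simp]: "h' \<in> Arr C" "Cod C h' = X" "Dom C h' = Cod C f"
        and Fh': "farr F h' = u \<diamondop> h"
      by (rule full[of "Cod C f" X "u \<diamondop> h"]) (use X in \<open>auto simp: Hom_iff\<close>)
    have "h' \<diamondop>\<^bsub>C\<^esub> f = lzero C (Dom C f) X"
      by (rule faithful) (use X in \<open>auto simp: Fh' zero_preserving h(2)\<close>)
    then have univ': "\<exists>!v. v \<in> Hom C (Cod C q) X \<and> v \<diamondop>\<^bsub>C\<^esub> q = h'"
      by (intro univ) (auto simp: Hom_iff)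
    then obtain v where v: "v \<in> Hom C (Cod C q) X" and kv: "v \<diamondop>\<^bsub>C\<^esub> q = h'" by blast
    have [simp]: "v \<in> Arr C" "Cod C v = X" "Dom C v = Cod C q" using v by (auto simp: Hom_iff)
    have Fkv: "farr F v \<diamondop> farr F q = u \<diamondop> h"
      using F_simps(6)[of q v] by (simp add: kv Fh')
    show ?thesis
    proof (rule ex1I[of _ "arr_inv D u \<diamondop> farr F v"])
      show "arr_inv D u \<diamondop> farr F v \<in> Hom D (fobj F (Cod C q)) W \<and>
          (arr_inv D u \<diamondop> farr F v) \<diamondop> farr F q = h"
        by (simp add: Hom_iff Fkv)
    next
      fix w assume w: "w \<in> Hom D (fobj F (Cod C q)) W \<and> w \<diamondop> farr F q = h"
      then have wA [simp]: "w \<in> Arr D" "Cod D w = W" "Dom D w = fobj F (Cod C q)"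
        and kw: "w \<diamondop> farr F q = h" by (auto simp: Hom_iff)
      obtain w' where w' [simp]: "w' \<in> Arr C" "Cod C w' = X" "Dom C w' = Cod C q"
          and Fw': "farr F w' = u \<diamondop> w"
        by (rule full[of "Cod C q" X "u \<diamondop> w"]) (use X in \<open>auto simp: Hom_iff\<close>)
      have "w' \<diamondop>\<^bsub>C\<^esub> q = h'"
        by (rule faithful) (auto simp: Fh' Fw' kw)
      moreover have "w' \<in> Hom C (Cod C q) X" by (simp add: Hom_iff)
      ultimately have "w' = v" using univ' v kv by blast
      then have "farr F v = u \<diamondop> w" using Fw' by simp
      then show "w = arr_inv D u \<diamondop> farr F v" by simp
    qed
  qed
  ultimately show ?thesis by (auto simp: is_cokernel_def)
qed

lemma preserves_short_exact:
  "short_exact C f g \<Longrightarrow> short_exact D (farr F f) (farr F g)"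
  by (simp add: short_exact_def preserves_kernel preserves_cokernel)

end

locale linear_functor_between = C: linear_category C + D: linear_category D
  for C :: "('o1, 'm1, 'k :: field, 'y) linear_category_data_scheme"
    and D :: "('o2, 'm2, 'k, 'z) linear_category_data_scheme" (structure) +
  fixes F :: "('o1, 'm1, 'o2, 'm2, 'w) functor_data_scheme"
  assumes linear: "linear_functor C D F"

sublocale linear_functor_between \<subseteq> functor_between C D F
  by unfold_locales (use linear in \<open>simp add: linear_functor_def\<close>)

context linear_functor_between
begin

lemma F_lsmult [simp]: "f \<in> Arr C \<Longrightarrow> farr F (lsmult C c f) = lsmult D c (farr F f)"
  using linear by (simp add: linear_functor_def)

lemma F_ladd: "f \<in> Hom C X Y \<Longrightarrow> g \<in> Hom C X Y \<Longrightarrow>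
    farr F (ladd C f g) = ladd D (farr F f) (farr F g)"
  using linear by (simp add: linear_functor_def)

lemma F_lzero [simp]: "X \<in> Obj C \<Longrightarrow> Y \<in> Obj C \<Longrightarrow> farr F (lzero C X Y) = lzero D (fobj F X) (fobj F Y)"
  using F_lsmult[of "lzero C X Y" 0] by simp

text \<open>
  Direct sums are given by equations between sums and composites, so a linear functor
  preserves them.
\<close>

lemma F_biproduct:
  assumes B: "biproduct C Xs X \<iota> \<pi>"
  shows "biproduct D (map (fobj F) Xs) (fobj F X) (\<lambda>i. farr F (\<iota> i)) (\<lambda>i. farr F (\<pi> i))"
proof -
  note S [simp] = biproduct_simps[OF C.linear_category_axioms B]
  have Xs: "set Xs \<subseteq> Obj C" using B by (simp add: biproduct_def)
  have F1: "farr F (\<pi> j) \<diamondop> farr F (\<iota> i) =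
      (if i = j then ident D (fobj F (Xs ! i)) else lzero D (fobj F (Xs ! i)) (fobj F (Xs ! j)))"
    if "i < length Xs" "j < length Xs" for i j
    using that F_simps(6)[of "\<iota> i" "\<pi> j"] by (cases "i = j") auto
  have "farr F (hsum C X X (\<lambda>i. \<iota> i \<diamondop>\<^bsub>C\<^esub> \<pi> i) {..<length Xs}) =
      hsum D (fobj F X) (fobj F X) (\<lambda>i. farr F (\<iota> i \<diamondop>\<^bsub>C\<^esub> \<pi> i)) {..<length Xs}"
    by (rule C.hsum_additive[where X = X and Y = X])
      (use F_ladd[of _ X X] in \<open>auto simp: Hom_iff D.linear_category_axioms\<close>)
  also have "\<dots> = hsum D (fobj F X) (fobj F X) (\<lambda>i. farr F (\<iota> i) \<diamondop> farr F (\<pi> i)) {..<length Xs}"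
    by (rule D.hsum_cong) (auto simp: Hom_iff)
  finally have "hsum D (fobj F X) (fobj F X) (\<lambda>i. farr F (\<iota> i) \<diamondop> farr F (\<pi> i)) {..<length Xs} =
      ident D (fobj F X)"
    using biproduct_sum[OF C.linear_category_axioms B] by simp
  then show ?thesis
    using Xs unfolding biproduct_def by (auto simp: F1 Hom_iff)
qed

end

locale tensor_functor_between = C: tensor_category C + D: tensor_category D
  for C :: "('o1, 'm1, 'k :: field, 'y) tensor_category_data_scheme"
    and D :: "('o2, 'm2, 'k, 'z) tensor_category_data_scheme" (structure) +
  fixes F :: "('o1, 'm1, 'o2, 'm2, 'w) tensor_functor_data_scheme"
  assumes tensor: "tensor_functor C D F"

sublocale tensor_functor_between \<subseteq> linear_functor_between C D F
  by unfold_locales (use tensor in \<open>simp add: tensor_functor_def exact_functor_def\<close>)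

context tensor_functor_between
begin

lemma strong: "strong_monoidal C D F"
  using tensor by (simp add: tensor_functor_def)

lemma fmult_simps [simp]:
  assumes "X \<in> Obj C" "Y \<in> Obj C"
  shows "fmult F X Y \<in> Arr D" "Dom D (fmult F X Y) = tobj D (fobj F X) (fobj F Y)"
    "Cod D (fmult F X Y) = fobj F (tobj C X Y)" "is_iso D (fmult F X Y)"
  using strong assms by (auto simp: strong_monoidal_def Hom_iff)

lemma funit_simps [simp]:
  shows "funit F \<in> Arr D" "Dom D (funit F) = tunit D"
    "Cod D (funit F) = fobj F (tunit C)" "is_iso D (funit F)"
  using strong by (auto simp: strong_monoidal_def Hom_iff)

lemma fmult_natural:
  assumes "f \<in> Arr C" "g \<in> Arr C"
  shows "fmult F (Cod C f) (Cod C g) \<diamondop> tarr D (farr F f) (farr F g) =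
    farr F (tarr C f g) \<diamondop> fmult F (Dom C f) (Dom C g)"
  using strong assms by (simp add: strong_monoidal_def Hom_iff)

lemma fmult_assoc:
  assumes "X \<in> Obj C" "Y \<in> Obj C" "Z \<in> Obj C"
  shows "farr F (assoc C X Y Z) \<diamondop> fmult F (tobj C X Y) Z
        \<diamondop> tarr D (fmult F X Y) (ident D (fobj F Z)) =
      fmult F X (tobj C Y Z) \<diamondop> tarr D (ident D (fobj F X)) (fmult F Y Z)
        \<diamondop> assoc D (fobj F X) (fobj F Y) (fobj F Z)"
  using strong assms by (simp add: strong_monoidal_def)

lemma fmult_lunit:
  assumes "X \<in> Obj C"
  shows "farr F (lunit C X) \<diamondop> fmult F (tunit C) X
        \<diamondop> tarr D (funit F) (ident D (fobj F X)) = lunit D (fobj F X)"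
  using strong assms by (simp add: strong_monoidal_def)

lemma fmult_runit:
  assumes "X \<in> Obj C"
  shows "farr F (runit C X) \<diamondop> fmult F X (tunit C)
        \<diamondop> tarr D (ident D (fobj F X)) (funit F) = runit D (fobj F X)"
  using strong assms by (simp add: strong_monoidal_def)

lemma F_tobj_isomorphic:
  "X \<in> Obj C \<Longrightarrow> Y \<in> Obj C \<Longrightarrow>
    isomorphic D (tobj D (fobj F X) (fobj F Y)) (fobj F (tobj C X Y))"
  by (rule D.isomorphicI[of "fmult F X Y"]) (auto simp: Hom_iff)

lemma F_tunit_isomorphic: "isomorphic D (tunit D) (fobj F (tunit C))"
  by (rule D.isomorphicI[of "funit F"]) (auto simp: Hom_iff)

lemma F_inverse:
  assumes "X \<in> Obj C" "Y \<in> Obj C" "isomorphic C (tobj C X Y) (tunit C)"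
  shows "isomorphic D (tobj D (fobj F X) (fobj F Y)) (tunit D)"
proof -
  have "isomorphic D (tobj D (fobj F X) (fobj F Y)) (fobj F (tobj C X Y))"
    using assms by (intro F_tobj_isomorphic)
  also have "isomorphic D \<dots> (fobj F (tunit C))"
    using assms by (intro F_isomorphic)
  also have "isomorphic D \<dots> (tunit D)"
    using F_tunit_isomorphic D.isomorphic_sym by blast
  finally show ?thesis .
qed

lemma F_invertible:
  assumes "invertible_object C X"
  shows "invertible_object D (fobj F X)"
proof -
  obtain Y where "Y \<in> Obj C" "isomorphic C (tobj C X Y) (tunit C)" "isomorphic C (tobj C Y X) (tunit C)"
    using assms by (rule C.invertible_objectE)
  moreover have "X \<in> Obj C" using assms by (simp add: invertible_object_def)
  ultimately show ?thesis
    unfolding invertible_object_def by (intro conjI bexI[of _ "fobj F Y"] F_inverse) auto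
qed

text \<open>
  Both Hom spaces are lines spanned by an isomorphism, and \<open>F\<close> takes one generator to the
  other.
\<close>

lemma bij_on_scalar_homs:
  assumes AB: "isomorphic C A B" and B: "scalar_endos C B" "scalar_endos D (fobj F B)"
  shows "bij_betw (farr F) (Hom C A B) (Hom D (fobj F A) (fobj F B))"
proof -
  obtain w where w: "is_iso C w" "w \<in> Arr C" "Dom C w = A" "Cod C w = B" "A \<in> Obj C" "B \<in> Obj C"
    using AB by (rule C.isomorphicE)
  then have wH: "w \<in> Hom C A B" "farr F w \<in> Hom D (fobj F A) (fobj F B)" "is_iso D (farr F w)"
    by (auto simp: Hom_iff)
  show ?thesis unfolding bij_betw_def
  proof
    show "inj_on (farr F) (Hom C A B)"
    proof (rule inj_onI)
      fix f g assume f: "f \<in> Hom C A B" and g: "g \<in> Hom C A B" and eq: "farr F f = farr F g"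
      obtain c where c: "f = lsmult C c w" by (rule C.scalar_multiple_of_iso[OF B(1) w(1) wH(1) f])
      obtain d where d: "g = lsmult C d w" by (rule C.scalar_multiple_of_iso[OF B(1) w(1) wH(1) g])
      have "lsmult D c (farr F w) = lsmult D d (farr F w)" using eq w by (simp add: c d)
      then have "c = d" using D.iso_multiple_unique[OF B(2) wH(3,2)] by blast
      then show "f = g" by (simp add: c d)
    qed
    have "h \<in> farr F ` Hom C A B" if h: "h \<in> Hom D (fobj F A) (fobj F B)" for h
    proof -
      obtain c where c: "h = lsmult D c (farr F w)"
        by (rule D.scalar_multiple_of_iso[OF B(2) wH(3,2) h])
      show ?thesis
        by (rule image_eqI[of _ _ "lsmult C c w"]) (use c w in \<open>auto simp: Hom_iff\<close>)
    qed
    then show "farr F ` Hom C A B = Hom D (fobj F A) (fobj F B)" using F_Hom by blast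
  qed
qed

end

section \<open>Multiplicative families of objects and their cocycles\<close>

text \<open>
  A tensor functor from the discrete monoidal category on \<open>G\<close> with associator \<open>a\<close>, before any
  condition on units is imposed. That \<open>a\<close> is a cocycle is a consequence, proved next.
\<close>

locale multiplicative_family = tensor_category C + G: group G
  for C :: "('o, 'm, 'k :: field, 'z) tensor_category_data_scheme" (structure)
    and G :: "('g, 'y) monoid_scheme" +
  fixes X :: "'g \<Rightarrow> 'o" and \<mu> :: "'g \<Rightarrow> 'g \<Rightarrow> 'm" and a :: "'g \<times> 'g \<times> 'g \<Rightarrow> 'k"
  assumes X_Obj [simp]: "g \<in> carrier G \<Longrightarrow> X g \<in> Obj C"
    and \<mu>_iso [simp]: "g \<in> carrier G \<Longrightarrow> h \<in> carrier G \<Longrightarrow> is_iso C (\<mu> g h)"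
    and \<mu>_Hom: "g \<in> carrier G \<Longrightarrow> h \<in> carrier G \<Longrightarrow>
      \<mu> g h \<in> Hom C (tobj C (X g) (X h)) (X (g \<otimes>\<^bsub>G\<^esub> h))"
    and \<mu>_assoc: "g \<in> carrier G \<Longrightarrow> h \<in> carrier G \<Longrightarrow> k \<in> carrier G \<Longrightarrow>
      \<mu> g (h \<otimes>\<^bsub>G\<^esub> k) \<diamondop> tarr C (ident C (X g)) (\<mu> h k) \<diamondop> assoc C (X g) (X h) (X k) =
      lsmult C (a (g, h, k)) (\<mu> (g \<otimes>\<^bsub>G\<^esub> h) k \<diamondop> tarr C (\<mu> g h) (ident C (X k)))"
begin

lemma \<mu>_simps [simp]:
  assumes "g \<in> carrier G" "h \<in> carrier G"
  shows "\<mu> g h \<in> Arr C" "Dom C (\<mu> g h) = tobj C (X g) (X h)" "Cod C (\<mu> g h) = X (g \<otimes>\<^bsub>G\<^esub> h)"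
  using \<mu>_Hom[OF assms] by (auto simp: Hom_iff)

lemma \<mu>_assoc_reassoc:
  assumes "g \<in> carrier G" "h \<in> carrier G" "k \<in> carrier G"
    "f \<in> Arr C" "Cod C f = tobj C (tobj C (X g) (X h)) (X k)"
  shows "\<mu> g (h \<otimes>\<^bsub>G\<^esub> k) \<diamondop> tarr C (ident C (X g)) (\<mu> h k) \<diamondop> assoc C (X g) (X h) (X k) \<diamondop> f =
      lsmult C (a (g, h, k)) (\<mu> (g \<otimes>\<^bsub>G\<^esub> h) k \<diamondop> tarr C (\<mu> g h) (ident C (X k)) \<diamondop> f)"
proof -
  have "(\<mu> g (h \<otimes>\<^bsub>G\<^esub> k) \<diamondop> tarr C (ident C (X g)) (\<mu> h k) \<diamondop> assoc C (X g) (X h) (X k)) \<diamondop> f =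
      (lsmult C (a (g, h, k)) (\<mu> (g \<otimes>\<^bsub>G\<^esub> h) k \<diamondop> tarr C (\<mu> g h) (ident C (X k)))) \<diamondop> f"
    using assms by (simp add: \<mu>_assoc)
  then show ?thesis using assms by (simp add: G.m_assoc)
qed

text \<open>
  The arrow \<open>\<Phi>\<close> in the proof runs along the two sides of the pentagon. Moving the associators
  past \<open>\<mu>\<close> one at a time, each move costs one value of \<open>a\<close>: two on one side, three on the other,
  and both times the same isomorphism \<open>\<Psi>\<close> is left.
\<close>

lemma cocycle_identity:
  assumes w: "w \<in> carrier G" and x: "x \<in> carrier G" and y: "y \<in> carrier G" and z: "z \<in> carrier G"
    and scalar: "scalar_endos C (X (w \<otimes>\<^bsub>G\<^esub> x \<otimes>\<^bsub>G\<^esub> y \<otimes>\<^bsub>G\<^esub> z))"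
  shows "a (x, y, z) * a (w, x \<otimes>\<^bsub>G\<^esub> y, z) * a (w, x, y) =
         a (w \<otimes>\<^bsub>G\<^esub> x, y, z) * a (w, x, y \<otimes>\<^bsub>G\<^esub> z)"
proof -
  note [simp] = w x y z
  let ?M = "\<mu> w (x \<otimes>\<^bsub>G\<^esub> (y \<otimes>\<^bsub>G\<^esub> z))"
  let ?\<Phi> = "?M \<diamondop> tarr C (ident C (X w)) (\<mu> x (y \<otimes>\<^bsub>G\<^esub> z)) \<diamondop>
      tarr C (ident C (X w)) (tarr C (ident C (X x)) (\<mu> y z)) \<diamondop>
      assoc C (X w) (X x) (tobj C (X y) (X z)) \<diamondop> assoc C (tobj C (X w) (X x)) (X y) (X z)"
  let ?\<Psi> = "\<mu> (w \<otimes>\<^bsub>G\<^esub> x \<otimes>\<^bsub>G\<^esub> y) z \<diamondop> tarr C (\<mu> (w \<otimes>\<^bsub>G\<^esub> x) y) (ident C (X z)) \<diamondop>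
      tarr C (tarr C (\<mu> w x) (ident C (X y))) (ident C (X z))"
  have \<Psi>: "is_iso C ?\<Psi>" "?\<Psi> \<in> Hom C (tobj C (tobj C (tobj C (X w) (X x)) (X y)) (X z))
      (X (w \<otimes>\<^bsub>G\<^esub> x \<otimes>\<^bsub>G\<^esub> y \<otimes>\<^bsub>G\<^esub> z))"
    by (auto simp: Hom_iff)

  have n1: "tarr C (ident C (X w)) (tarr C (ident C (X x)) (\<mu> y z)) \<diamondop>
      assoc C (X w) (X x) (tobj C (X y) (X z)) =
      assoc C (X w) (X x) (X (y \<otimes>\<^bsub>G\<^esub> z)) \<diamondop> tarr C (ident C (tobj C (X w) (X x))) (\<mu> y z)"
    using assoc_natural'[of "ident C (X w)" "ident C (X x)" "\<mu> y z"] by simp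
  have n2: "tarr C (\<mu> w x) (ident C (tobj C (X y) (X z))) \<diamondop> assoc C (tobj C (X w) (X x)) (X y) (X z) =
      assoc C (X (w \<otimes>\<^bsub>G\<^esub> x)) (X y) (X z) \<diamondop> tarr C (tarr C (\<mu> w x) (ident C (X y))) (ident C (X z))"
    using assoc_natural'[of "\<mu> w x" "ident C (X y)" "ident C (X z)"] by simp
  have "?\<Phi> = ?M \<diamondop> tarr C (ident C (X w)) (\<mu> x (y \<otimes>\<^bsub>G\<^esub> z)) \<diamondop>
      assoc C (X w) (X x) (X (y \<otimes>\<^bsub>G\<^esub> z)) \<diamondop> tarr C (ident C (tobj C (X w) (X x))) (\<mu> y z) \<diamondop>
      assoc C (tobj C (X w) (X x)) (X y) (X z)"
    by (subst cmp_reassoc[OF n1]) (simp_all del: tarr_cmp' tarr_cmp_reassoc)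
  also have "\<dots> = lsmult C (a (w, x, y \<otimes>\<^bsub>G\<^esub> z)) (\<mu> (w \<otimes>\<^bsub>G\<^esub> x) (y \<otimes>\<^bsub>G\<^esub> z) \<diamondop>
      tarr C (\<mu> w x) (\<mu> y z) \<diamondop> assoc C (tobj C (X w) (X x)) (X y) (X z))"
    by (subst \<mu>_assoc_reassoc) simp_all
  also have "tarr C (\<mu> w x) (\<mu> y z) = tarr C (ident C (X (w \<otimes>\<^bsub>G\<^esub> x))) (\<mu> y z) \<diamondop>
      tarr C (\<mu> w x) (ident C (tobj C (X y) (X z)))"
    by simp
  also have "(\<mu> (w \<otimes>\<^bsub>G\<^esub> x) (y \<otimes>\<^bsub>G\<^esub> z) \<diamondop> (tarr C (ident C (X (w \<otimes>\<^bsub>G\<^esub> x))) (\<mu> y z) \<diamondop>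
      tarr C (\<mu> w x) (ident C (tobj C (X y) (X z)))) \<diamondop> assoc C (tobj C (X w) (X x)) (X y) (X z)) =
     \<mu> (w \<otimes>\<^bsub>G\<^esub> x) (y \<otimes>\<^bsub>G\<^esub> z) \<diamondop> tarr C (ident C (X (w \<otimes>\<^bsub>G\<^esub> x))) (\<mu> y z) \<diamondop>
      assoc C (X (w \<otimes>\<^bsub>G\<^esub> x)) (X y) (X z) \<diamondop> tarr C (tarr C (\<mu> w x) (ident C (X y))) (ident C (X z))"
    by (simp add: n2 del: tarr_cmp' tarr_cmp_reassoc)
  also have "\<dots> = lsmult C (a (w \<otimes>\<^bsub>G\<^esub> x, y, z)) ?\<Psi>"
    by (subst \<mu>_assoc_reassoc) simp_all
  finally have L: "?\<Phi> = lsmult C (a (w \<otimes>\<^bsub>G\<^esub> x, y, z) * a (w, x, y \<otimes>\<^bsub>G\<^esub> z)) ?\<Psi>"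
    by (simp add: mult.commute)

  have inner: "\<mu> x (y \<otimes>\<^bsub>G\<^esub> z) \<diamondop> tarr C (ident C (X x)) (\<mu> y z) \<diamondop> assoc C (X x) (X y) (X z) =
      lsmult C (a (x, y, z)) (\<mu> (x \<otimes>\<^bsub>G\<^esub> y) z \<diamondop> tarr C (\<mu> x y) (ident C (X z)))"
    by (simp add: \<mu>_assoc)
  have n3: "tarr C (ident C (X w)) (tarr C (\<mu> x y) (ident C (X z))) \<diamondop>
      assoc C (X w) (tobj C (X x) (X y)) (X z) =
      assoc C (X w) (X (x \<otimes>\<^bsub>G\<^esub> y)) (X z) \<diamondop> tarr C (tarr C (ident C (X w)) (\<mu> x y)) (ident C (X z))"
    using assoc_natural'[of "ident C (X w)" "\<mu> x y" "ident C (X z)"] by simp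
  have "?\<Phi> = ?M \<diamondop> tarr C (ident C (X w)) (\<mu> x (y \<otimes>\<^bsub>G\<^esub> z)) \<diamondop>
      tarr C (ident C (X w)) (tarr C (ident C (X x)) (\<mu> y z)) \<diamondop>
      tarr C (ident C (X w)) (assoc C (X x) (X y) (X z)) \<diamondop> assoc C (X w) (tobj C (X x) (X y)) (X z) \<diamondop>
      tarr C (assoc C (X w) (X x) (X y)) (ident C (X z))"
    using pentagon[of "X w" "X x" "X y" "X z"] by (simp del: tarr_cmp' tarr_cmp_reassoc)
  also have "\<dots> = ?M \<diamondop> tarr C (ident C (X w)) (lsmult C (a (x, y, z))
      (\<mu> (x \<otimes>\<^bsub>G\<^esub> y) z \<diamondop> tarr C (\<mu> x y) (ident C (X z)))) \<diamondop>
      assoc C (X w) (tobj C (X x) (X y)) (X z) \<diamondop>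
      tarr C (assoc C (X w) (X x) (X y)) (ident C (X z))"
    by (simp add: inner G.m_assoc)
  also have "\<dots> = lsmult C (a (x, y, z)) (?M \<diamondop> tarr C (ident C (X w)) (\<mu> (x \<otimes>\<^bsub>G\<^esub> y) z) \<diamondop>
      tarr C (ident C (X w)) (tarr C (\<mu> x y) (ident C (X z))) \<diamondop>
      assoc C (X w) (tobj C (X x) (X y)) (X z) \<diamondop>
      tarr C (assoc C (X w) (X x) (X y)) (ident C (X z)))"
    by (simp add: G.m_assoc)
  also have "\<dots> = lsmult C (a (x, y, z)) (\<mu> w (x \<otimes>\<^bsub>G\<^esub> y \<otimes>\<^bsub>G\<^esub> z) \<diamondop>
      tarr C (ident C (X w)) (\<mu> (x \<otimes>\<^bsub>G\<^esub> y) z) \<diamondop> assoc C (X w) (X (x \<otimes>\<^bsub>G\<^esub> y)) (X z) \<diamondop>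
      tarr C (tarr C (ident C (X w)) (\<mu> x y)) (ident C (X z)) \<diamondop>
      tarr C (assoc C (X w) (X x) (X y)) (ident C (X z)))"
    by (subst cmp_reassoc[OF n3]) (simp_all add: G.m_assoc del: tarr_cmp' tarr_cmp_reassoc)
  also have "\<dots> = lsmult C (a (x, y, z) * a (w, x \<otimes>\<^bsub>G\<^esub> y, z)) (\<mu> (w \<otimes>\<^bsub>G\<^esub> (x \<otimes>\<^bsub>G\<^esub> y)) z \<diamondop>
      tarr C (\<mu> w (x \<otimes>\<^bsub>G\<^esub> y)) (ident C (X z)) \<diamondop>
      tarr C (tarr C (ident C (X w)) (\<mu> x y)) (ident C (X z)) \<diamondop>
      tarr C (assoc C (X w) (X x) (X y)) (ident C (X z)))"
    by (subst \<mu>_assoc_reassoc) (simp_all del: tarr_cmp' tarr_cmp_reassoc)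
  also have "\<dots> = lsmult C (a (x, y, z) * a (w, x \<otimes>\<^bsub>G\<^esub> y, z) * a (w, x, y)) ?\<Psi>"
    by (simp add: \<mu>_assoc G.m_assoc)
  finally show ?thesis
    using L iso_multiple_unique[OF scalar \<Psi>] by simp
qed

end

locale unital_family = multiplicative_family C G X \<mu> a
  for C :: "('o, 'm, 'k :: field, 'z) tensor_category_data_scheme" (structure)
    and G :: "('g, 'y) monoid_scheme" and X \<mu> a +
  fixes \<nu> :: 'm
  assumes \<nu>_iso [simp]: "is_iso C \<nu>" and \<nu>_Hom: "\<nu> \<in> Hom C (tunit C) (X \<one>\<^bsub>G\<^esub>)"
    and \<mu>_unit_left: "g \<in> carrier G \<Longrightarrow> \<mu> \<one>\<^bsub>G\<^esub> g \<diamondop> tarr C \<nu> (ident C (X g)) = lunit C (X g)"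
    and \<mu>_unit_right: "g \<in> carrier G \<Longrightarrow> \<mu> g \<one>\<^bsub>G\<^esub> \<diamondop> tarr C (ident C (X g)) \<nu> = runit C (X g)"
begin

lemma \<nu>_simps [simp]: "\<nu> \<in> Arr C" "Dom C \<nu> = tunit C" "Cod C \<nu> = X \<one>\<^bsub>G\<^esub>"
  using \<nu>_Hom by (auto simp: Hom_iff)

end

text \<open>
  Arbitrary isomorphisms \<open>m\<^sub>g\<^sub>h\<close> satisfy the unit conditions up to scalars \<open>l\<^sub>h\<close> on the left and
  \<open>r\<^sub>g\<close> on the right. The triangle axiom gives \<open>l\<^sub>h = c(g, 1, h) r\<^sub>g\<close>, and the cocycle identity
  for \<open>1, 1, 1, 1\<close> gives \<open>c(1, 1, 1) = 1\<close>, so \<open>l\<^sub>1 = r\<^sub>1\<close>. Thus a single rescaling \<open>b\<close> repairs both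
  sides. After the rescaling, \<open>a(g, 1, h) = 1\<close>, and the cocycle identity spreads this to the other two slots.
\<close>

lemma (in tensor_category) unital_family_exists:
  fixes G :: "('g, 'y) monoid_scheme" and X :: "'g \<Rightarrow> 'o"
  assumes G: "group G"
    and X: "\<And>g. g \<in> carrier G \<Longrightarrow> X g \<in> Obj C" "\<And>g. g \<in> carrier G \<Longrightarrow> scalar_endos C (X g)"
    and unit: "isomorphic C (tunit C) (X \<one>\<^bsub>G\<^esub>)"
    and mult: "\<And>g h. g \<in> carrier G \<Longrightarrow> h \<in> carrier G \<Longrightarrow>
      isomorphic C (tobj C (X g) (X h)) (X (g \<otimes>\<^bsub>G\<^esub> h))"
  shows "\<exists>\<mu> a \<nu>. unital_family C G X \<mu> a \<nu> \<and> a \<in> carrier (cocycles3 G) \<and> normalized3 G a"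
proof -
  interpret G: group G by fact
  note [simp] = X(1)
  have "\<forall>p. \<exists>u. p \<in> carrier G \<times> carrier G \<longrightarrow> is_iso C u \<and>
      u \<in> Hom C (tobj C (X (fst p)) (X (snd p))) (X (fst p \<otimes>\<^bsub>G\<^esub> snd p))"
    using mult unfolding isomorphic_def by fastforce
  then obtain m' where m': "\<And>p. p \<in> carrier G \<times> carrier G \<Longrightarrow> is_iso C (m' p) \<and>
      m' p \<in> Hom C (tobj C (X (fst p)) (X (snd p))) (X (fst p \<otimes>\<^bsub>G\<^esub> snd p))"
    by metis
  define m where "m g h = m' (g, h)" for g h
  have m_iso [simp]: "is_iso C (m g h)"
    and m_Hom: "m g h \<in> Hom C (tobj C (X g) (X h)) (X (g \<otimes>\<^bsub>G\<^esub> h))"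
    if "g \<in> carrier G" "h \<in> carrier G" for g h
    using m'[of "(g, h)"] that by (auto simp: m_def)
  have m_simps [simp]: "m g h \<in> Arr C" "Dom C (m g h) = tobj C (X g) (X h)" "Cod C (m g h) = X (g \<otimes>\<^bsub>G\<^esub> h)"
    if "g \<in> carrier G" "h \<in> carrier G" for g h
    using m_Hom[OF that] by (auto simp: Hom_iff)
  obtain \<nu> where \<nu> [simp]: "is_iso C \<nu>" "\<nu> \<in> Arr C" "Dom C \<nu> = tunit C" "Cod C \<nu> = X \<one>\<^bsub>G\<^esub>"
    using unit by (rule isomorphicE)

  have multiple: "\<exists>c. c \<noteq> 0 \<and> u = lsmult C c v"
    if g: "g \<in> carrier G" and u: "is_iso C u" and v: "is_iso C v" and uv: "Dom C u = Dom C v" "Cod C u = X g" "Cod C v = X g" for u v g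
  proof -
    have H: "u \<in> Hom C (Dom C v) (X g)" "v \<in> Hom C (Dom C v) (X g)"
      using u v uv iso_Arr by (auto simp: Hom_iff)
    obtain c where c: "u = lsmult C c v"
      by (rule scalar_multiple_of_iso[OF X(2)[OF g] v H(2,1)])
    moreover have "c \<noteq> 0"
      using iso_multiple_nonzero[OF X(2)[OF g] u H(1) c H(2)] .
    ultimately show ?thesis by blast
  qed

  define L where "L g h k = m g (h \<otimes>\<^bsub>G\<^esub> k) \<diamondop> tarr C (ident C (X g)) (m h k) \<diamondop> assoc C (X g) (X h) (X k)" for g h k
  define R where "R g h k = m (g \<otimes>\<^bsub>G\<^esub> h) k \<diamondop> tarr C (m g h) (ident C (X k))" for g h k
  have ex_c: "\<forall>t. \<exists>c. t \<in> triples G \<longrightarrow> c \<noteq> 0 \<and> (case t of (g, h, k) \<Rightarrow> L g h k = lsmult C c (R g h k))"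
  proof
    fix t
    show "\<exists>c. t \<in> triples G \<longrightarrow> c \<noteq> 0 \<and> (case t of (g, h, k) \<Rightarrow> L g h k = lsmult C c (R g h k))"
    proof (cases t)
      case (fields g h k)
      show ?thesis
      proof (cases "t \<in> triples G")
        case True
        then have "\<exists>c. c \<noteq> 0 \<and> L g h k = lsmult C c (R g h k)"
          by (intro multiple[of "g \<otimes>\<^bsub>G\<^esub> h \<otimes>\<^bsub>G\<^esub> k"]) (auto simp: fields L_def R_def G.m_assoc)
        then show ?thesis by (auto simp: fields)
      qed simp
    qed
  qed
  obtain c where c: "\<forall>t. t \<in> triples G \<longrightarrow> c t \<noteq> 0 \<and>
      (case t of (g, h, k) \<Rightarrow> L g h k = lsmult C (c t) (R g h k))"
    using choice[OF ex_c] by (rule exE) (rule that)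
  have c_nz: "c (g, h, k) \<noteq> 0"
    and m_assoc: "m g (h \<otimes>\<^bsub>G\<^esub> k) \<diamondop> tarr C (ident C (X g)) (m h k) \<diamondop> assoc C (X g) (X h) (X k) =
      lsmult C (c (g, h, k)) (m (g \<otimes>\<^bsub>G\<^esub> h) k \<diamondop> tarr C (m g h) (ident C (X k)))"
    if "g \<in> carrier G" "h \<in> carrier G" "k \<in> carrier G" for g h k
    using c[rule_format, of "(g, h, k)"] that by (auto simp: L_def R_def)
  interpret M: multiplicative_family C G X m c
    by unfold_locales (use m_assoc m_Hom in auto)

  have "\<forall>g. \<exists>e. g \<in> carrier G \<longrightarrow> e \<noteq> 0 \<and>
      m \<one>\<^bsub>G\<^esub> g \<diamondop> tarr C \<nu> (ident C (X g)) = lsmult C e (lunit C (X g))"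
  proof
    fix g
    show "\<exists>e. g \<in> carrier G \<longrightarrow> e \<noteq> 0 \<and>
      m \<one>\<^bsub>G\<^esub> g \<diamondop> tarr C \<nu> (ident C (X g)) = lsmult C e (lunit C (X g))"
      using multiple[of g "m \<one>\<^bsub>G\<^esub> g \<diamondop> tarr C \<nu> (ident C (X g))" "lunit C (X g)"]
      by (cases "g \<in> carrier G") auto
  qed
  then obtain l where l_nz: "\<And>g. g \<in> carrier G \<Longrightarrow> l g \<noteq> 0"
    and l: "\<And>g. g \<in> carrier G \<Longrightarrow> m \<one>\<^bsub>G\<^esub> g \<diamondop> tarr C \<nu> (ident C (X g)) = lsmult C (l g) (lunit C (X g))"
    by metis
  have "\<forall>g. \<exists>e. g \<in> carrier G \<longrightarrow> e \<noteq> 0 \<and>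
      m g \<one>\<^bsub>G\<^esub> \<diamondop> tarr C (ident C (X g)) \<nu> = lsmult C e (runit C (X g))"
  proof
    fix g
    show "\<exists>e. g \<in> carrier G \<longrightarrow> e \<noteq> 0 \<and>
      m g \<one>\<^bsub>G\<^esub> \<diamondop> tarr C (ident C (X g)) \<nu> = lsmult C e (runit C (X g))"
      using multiple[of g "m g \<one>\<^bsub>G\<^esub> \<diamondop> tarr C (ident C (X g)) \<nu>" "runit C (X g)"]
      by (cases "g \<in> carrier G") auto
  qed
  then obtain r where r_nz: "\<And>g. g \<in> carrier G \<Longrightarrow> r g \<noteq> 0"
    and r: "\<And>g. g \<in> carrier G \<Longrightarrow> m g \<one>\<^bsub>G\<^esub> \<diamondop> tarr C (ident C (X g)) \<nu> = lsmult C (r g) (runit C (X g))"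
    by metis

  have middle: "l h = c (g, \<one>\<^bsub>G\<^esub>, h) * r g" if g: "g \<in> carrier G" and h: "h \<in> carrier G" for g h
  proof -
    note [simp] = g h
    let ?t = "tarr C (tarr C (ident C (X g)) \<nu>) (ident C (X h))"
    let ?u = "m g h \<diamondop> tarr C (runit C (X g)) (ident C (X h))"
    have n: "assoc C (X g) (X \<one>\<^bsub>G\<^esub>) (X h) \<diamondop> ?t =
        tarr C (ident C (X g)) (tarr C \<nu> (ident C (X h))) \<diamondop> assoc C (X g) (tunit C) (X h)"
      using assoc_natural'[of "ident C (X g)" \<nu> "ident C (X h)"] by simp
    have "lsmult C (c (g, \<one>\<^bsub>G\<^esub>, h) * r g) ?u = lsmult C (c (g, \<one>\<^bsub>G\<^esub>, h))
        (m (g \<otimes>\<^bsub>G\<^esub> \<one>\<^bsub>G\<^esub>) h \<diamondop> tarr C (m g \<one>\<^bsub>G\<^esub>) (ident C (X h)) \<diamondop> ?t)"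
      by (simp add: r)
    also have "\<dots> = m g (\<one>\<^bsub>G\<^esub> \<otimes>\<^bsub>G\<^esub> h) \<diamondop> tarr C (ident C (X g)) (m \<one>\<^bsub>G\<^esub> h) \<diamondop>
        assoc C (X g) (X \<one>\<^bsub>G\<^esub>) (X h) \<diamondop> ?t"
      by (rule M.\<mu>_assoc_reassoc[symmetric]) auto
    also have "\<dots> = lsmult C (l h) (m g h \<diamondop> tarr C (ident C (X g)) (lunit C (X h)) \<diamondop> assoc C (X g) (tunit C) (X h))"
      by (simp add: n l)
    also have "\<dots> = lsmult C (l h) ?u"
      by (simp add: triangle)
    finally show ?thesis
      using iso_multiple_unique[OF X(2)[of "g \<otimes>\<^bsub>G\<^esub> h"], of ?u _ "l h" "c (g, \<one>\<^bsub>G\<^esub>, h) * r g"]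
      by (simp add: Hom_iff)
  qed
  have c_cocycle: "c (x, y, z) * c (w, x \<otimes>\<^bsub>G\<^esub> y, z) * c (w, x, y) =
         c (w \<otimes>\<^bsub>G\<^esub> x, y, z) * c (w, x, y \<otimes>\<^bsub>G\<^esub> z)"
    if "w \<in> carrier G" "x \<in> carrier G" "y \<in> carrier G" "z \<in> carrier G" for w x y z
    using that by (intro M.cocycle_identity X(2)) auto
  have lr: "l \<one>\<^bsub>G\<^esub> = r \<one>\<^bsub>G\<^esub>"
    using middle[of "\<one>\<^bsub>G\<^esub>" "\<one>\<^bsub>G\<^esub>"] c_cocycle[of "\<one>\<^bsub>G\<^esub>" "\<one>\<^bsub>G\<^esub>" "\<one>\<^bsub>G\<^esub>" "\<one>\<^bsub>G\<^esub>"]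
      c_nz[of "\<one>\<^bsub>G\<^esub>" "\<one>\<^bsub>G\<^esub>" "\<one>\<^bsub>G\<^esub>"] by simp

  \<comment> \<open>The first two cases overlap at \<open>g = h = 1\<close>, where \<open>lr\<close> makes them agree.\<close>
  define b where "b g h = (if g = \<one>\<^bsub>G\<^esub> then inverse (l h) else if h = \<one>\<^bsub>G\<^esub> then inverse (r g) else 1)" for g h
  define \<mu> where "\<mu> g h = lsmult C (b g h) (m g h)" for g h
  define a where "a = (\<lambda>(g, h, k) \<in> triples G.
    c (g, h, k) * (b h k * b g (h \<otimes>\<^bsub>G\<^esub> k)) / (b (g \<otimes>\<^bsub>G\<^esub> h) k * b g h))"
  have b_nz: "b g h \<noteq> 0" if "g \<in> carrier G" "h \<in> carrier G" for g h
    using that l_nz r_nz by (simp add: b_def)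
  have b_right: "b g \<one>\<^bsub>G\<^esub> = inverse (r g)" for g
    by (simp add: b_def lr)
  have b_left: "b \<one>\<^bsub>G\<^esub> g = inverse (l g)" for g
    by (simp add: b_def)
  have a_nz: "a (g, h, k) \<noteq> 0" if "g \<in> carrier G" "h \<in> carrier G" "k \<in> carrier G" for g h k
    using that c_nz b_nz by (simp add: a_def)
  have fam: "unital_family C G X \<mu> a \<nu>"
  proof
    fix g h k assume [simp]: "g \<in> carrier G" "h \<in> carrier G" "k \<in> carrier G"
    have "c (g, h, k) * (b h k * b g (h \<otimes>\<^bsub>G\<^esub> k)) = a (g, h, k) * (b (g \<otimes>\<^bsub>G\<^esub> h) k * b g h)"
      using b_nz by (simp add: a_def)
    then show "\<mu> g (h \<otimes>\<^bsub>G\<^esub> k) \<diamondop> tarr C (ident C (X g)) (\<mu> h k) \<diamondop> assoc C (X g) (X h) (X k) =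
      lsmult C (a (g, h, k)) (\<mu> (g \<otimes>\<^bsub>G\<^esub> h) k \<diamondop> tarr C (\<mu> g h) (ident C (X k)))"
      by (simp add: \<mu>_def m_assoc ac_simps)
  next
    fix g assume [simp]: "g \<in> carrier G"
    show "\<mu> \<one>\<^bsub>G\<^esub> g \<diamondop> tarr C \<nu> (ident C (X g)) = lunit C (X g)"
      using l_nz[of g] by (simp add: \<mu>_def l b_left)
    show "\<mu> g \<one>\<^bsub>G\<^esub> \<diamondop> tarr C (ident C (X g)) \<nu> = runit C (X g)"
      using r_nz[of g] by (simp add: \<mu>_def r b_right)
  qed (use m_Hom b_nz lsmult_Hom in \<open>auto simp: \<mu>_def Hom_iff\<close>)
  interpret U: unital_family C G X \<mu> a \<nu> by (rule fam)
  have a_cocycle: "a (x, y, z) * a (w, x \<otimes>\<^bsub>G\<^esub> y, z) * a (w, x, y) =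
         a (w \<otimes>\<^bsub>G\<^esub> x, y, z) * a (w, x, y \<otimes>\<^bsub>G\<^esub> z)"
    if "w \<in> carrier G" "x \<in> carrier G" "y \<in> carrier G" "z \<in> carrier G" for w x y z
    using that by (intro U.cocycle_identity X(2)) auto
  have "a \<in> carrier (cocycles3 G)"
    using a_nz a_cocycle by (auto simp: cocycles3_def a_def)
  moreover have "normalized3 G a"
  proof -
    have mid: "a (x, \<one>\<^bsub>G\<^esub>, y) = 1" if "x \<in> carrier G" "y \<in> carrier G" for x y
      using that middle[of x y] l_nz r_nz b_nz c_nz by (simp add: a_def b_left b_right field_simps)
    have "a (\<one>\<^bsub>G\<^esub>, x, y) = 1" if "x \<in> carrier G" "y \<in> carrier G" for x y
      using a_cocycle[of "\<one>\<^bsub>G\<^esub>" "\<one>\<^bsub>G\<^esub>" x y] mid that a_nz[of "\<one>\<^bsub>G\<^esub>" x y] by simp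
    moreover have "a (x, y, \<one>\<^bsub>G\<^esub>) = 1" if "x \<in> carrier G" "y \<in> carrier G" for x y
      using a_cocycle[of x y "\<one>\<^bsub>G\<^esub>" "\<one>\<^bsub>G\<^esub>"] mid that a_nz[of x y "\<one>\<^bsub>G\<^esub>"] by simp
    ultimately show ?thesis using mid by (simp add: normalized3_def)
  qed
  ultimately show ?thesis using fam by blast
qed

section \<open>Transport of multiplicative families along tensor functors\<close>

text \<open>
  The last two conditions say that \<open>\<theta>\<close> is a monoidal transformation from \<open>Y \<circ> p\<close> to \<open>F \<circ> X\<close>.
\<close>

locale compatible_families =
  tensor_functor_between C D F + S: unital_family C G X \<mu> a \<nu> + T: unital_family D H Y \<mu>' a' \<nu>'
  for C :: "('o1, 'm1, 'k :: field, 'y) tensor_category_data_scheme"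
    and D :: "('o2, 'm2, 'k, 'z) tensor_category_data_scheme" (structure)
    and F :: "('o1, 'm1, 'o2, 'm2, 'w) tensor_functor_data_scheme"
    and G :: "('g, 'x) monoid_scheme" and X \<mu> a \<nu>
    and H :: "('h, 'v) monoid_scheme" and Y \<mu>' a' \<nu>' +
  fixes p :: "'g \<Rightarrow> 'h" and \<theta> :: "'g \<Rightarrow> 'm2"
  assumes p_hom: "p \<in> hom G H"
    and \<theta>_iso [simp]: "g \<in> carrier G \<Longrightarrow> is_iso D (\<theta> g)"
    and \<theta>_Hom: "g \<in> carrier G \<Longrightarrow> \<theta> g \<in> Hom D (Y (p g)) (fobj F (X g))"
    and \<theta>_\<mu>: "g \<in> carrier G \<Longrightarrow> h \<in> carrier G \<Longrightarrow>
      farr F (\<mu> g h) \<diamondop> fmult F (X g) (X h) \<diamondop> tarr D (\<theta> g) (\<theta> h) =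
      \<theta> (g \<otimes>\<^bsub>G\<^esub> h) \<diamondop> \<mu>' (p g) (p h)"
    and \<theta>_\<nu>: "farr F \<nu> \<diamondop> funit F = \<theta> \<one>\<^bsub>G\<^esub> \<diamondop> \<nu>'"

text \<open>
  The compatibility conditions prescribe \<open>F(\<mu>\<^sub>g\<^sub>h)\<close> and \<open>F(\<nu>)\<close>, and \<open>bij\<close> lets one solve for \<open>\<mu>\<close>
  and \<open>\<nu>\<close>. An equation between composites in \<open>C\<close> is then proved by applying \<open>F\<close> and
  precomposing with an isomorphism built from \<open>\<theta>\<close> and the structure maps of \<open>F\<close>: this turns it
  into the corresponding equation of the family in \<open>D\<close>.
\<close>

lemma (in tensor_functor_between) transport_family:
  fixes G :: "('g, 'x) monoid_scheme" and H :: "('h, 'v) monoid_scheme"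
    and X :: "'g \<Rightarrow> 'o1" and Y :: "'h \<Rightarrow> 'o2"
  assumes T: "unital_family D H Y \<mu>' a' \<nu>'" and G: "group G" and p: "p \<in> hom G H"
    and X: "\<And>g. g \<in> carrier G \<Longrightarrow> X g \<in> Obj C"
    and unit: "isomorphic C (tunit C) (X \<one>\<^bsub>G\<^esub>)"
    and mult: "\<And>g h. g \<in> carrier G \<Longrightarrow> h \<in> carrier G \<Longrightarrow>
      isomorphic C (tobj C (X g) (X h)) (X (g \<otimes>\<^bsub>G\<^esub> h))"
    and bij: "\<And>g A. g \<in> carrier G \<Longrightarrow> isomorphic C A (X g) \<Longrightarrow>
      bij_betw (farr F) (Hom C A (X g)) (Hom D (fobj F A) (fobj F (X g)))"
    and \<theta>_iso [simp]: "\<And>g. g \<in> carrier G \<Longrightarrow> is_iso D (\<theta> g)"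
    and \<theta>_Hom: "\<And>g. g \<in> carrier G \<Longrightarrow> \<theta> g \<in> Hom D (Y (p g)) (fobj F (X g))"
  shows "\<exists>\<mu> \<nu>. compatible_families C D F G X \<mu> (pullback3 G p a') \<nu> H Y \<mu>' a' \<nu>' p \<theta>"
proof -
  interpret T: unital_family D H Y \<mu>' a' \<nu>' by fact
  interpret G: group G by fact
  note [simp] = X
  have p_simps [simp]: "g \<in> carrier G \<Longrightarrow> p g \<in> carrier H"
    "g \<in> carrier G \<Longrightarrow> h \<in> carrier G \<Longrightarrow> p (g \<otimes>\<^bsub>G\<^esub> h) = p g \<otimes>\<^bsub>H\<^esub> p h" for g h
    using p by (auto simp: hom_def)
  have p_one [simp]: "p \<one>\<^bsub>G\<^esub> = \<one>\<^bsub>H\<^esub>"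
    using hom_one[OF p G.is_group T.G.is_group] .
  have \<theta>_simps [simp]: "g \<in> carrier G \<Longrightarrow> \<theta> g \<in> Arr D" "g \<in> carrier G \<Longrightarrow> Dom D (\<theta> g) = Y (p g)"
    "g \<in> carrier G \<Longrightarrow> Cod D (\<theta> g) = fobj F (X g)" for g
    using \<theta>_Hom by (auto simp: Hom_iff)
  have full: "\<exists>m. m \<in> Hom C A (X g) \<and> farr F m = u"
    if "g \<in> carrier G" "isomorphic C A (X g)" "u \<in> Hom D (fobj F A) (fobj F (X g))" for A g u
    using bij[OF that(1,2)] that(3) unfolding bij_betw_def by (metis (no_types) imageE)
  have faithful: "f = h" if "g \<in> carrier G" "isomorphic C A (X g)" "f \<in> Hom C A (X g)" "h \<in> Hom C A (X g)"
      "farr F f = farr F h" for A g f h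
    using bij[OF that(1,2)] that(3-) unfolding bij_betw_def by (auto dest: inj_onD)
  have reflect: "is_iso C f" if "g \<in> carrier G" "isomorphic C A (X g)" "f \<in> Hom C A (X g)" "is_iso D (farr F f)"
      for A g f
    using reflects_iso[OF that(3,4,2) bij[OF that(1)] bij[OF that(1,2)]] that C.isomorphic_refl by simp

  \<comment> \<open>\<open>U\<close> and, further down, \<open>V\<close> are the prescribed values of \<open>F(\<mu>)\<close> and \<open>F(\<nu>)\<close>.\<close>
  define U where "U g h = \<theta> (g \<otimes>\<^bsub>G\<^esub> h) \<diamondop> \<mu>' (p g) (p h) \<diamondop>
    tarr D (arr_inv D (\<theta> g)) (arr_inv D (\<theta> h)) \<diamondop> arr_inv D (fmult F (X g) (X h))" for g h
  have U: "is_iso D (U g h)" "U g h \<in> Hom D (fobj F (tobj C (X g) (X h))) (fobj F (X (g \<otimes>\<^bsub>G\<^esub> h)))"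
    "U g h \<diamondop> fmult F (X g) (X h) \<diamondop> tarr D (\<theta> g) (\<theta> h) =
      \<theta> (g \<otimes>\<^bsub>G\<^esub> h) \<diamondop> \<mu>' (p g) (p h)"
    if "g \<in> carrier G" "h \<in> carrier G" for g h
    using that by (auto simp: U_def Hom_iff)
  define \<mu> where "\<mu> g h = (SOME m. m \<in> Hom C (tobj C (X g) (X h)) (X (g \<otimes>\<^bsub>G\<^esub> h)) \<and> farr F m = U g h)" for g h
  have \<mu>: "\<mu> g h \<in> Hom C (tobj C (X g) (X h)) (X (g \<otimes>\<^bsub>G\<^esub> h)) \<and> farr F (\<mu> g h) = U g h"
    if "g \<in> carrier G" "h \<in> carrier G" for g h
    unfolding \<mu>_def by (rule someI_ex) (use that full mult U(2) in auto)
  have \<mu>_simps [simp]: "\<mu> g h \<in> Arr C" "Dom C (\<mu> g h) = tobj C (X g) (X h)" "Cod C (\<mu> g h) = X (g \<otimes>\<^bsub>G\<^esub> h)"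
    if "g \<in> carrier G" "h \<in> carrier G" for g h
    using \<mu>[OF that] by (auto simp: Hom_iff)
  have \<mu>_iso [simp]: "is_iso C (\<mu> g h)" if "g \<in> carrier G" "h \<in> carrier G" for g h
    by (rule reflect[OF _ mult[OF that]]) (use \<mu>[OF that] U(1)[OF that] that in auto)
  have F\<mu>: "farr F (\<mu> g h) \<diamondop> fmult F (X g) (X h) \<diamondop> tarr D (\<theta> g) (\<theta> h) =
      \<theta> (g \<otimes>\<^bsub>G\<^esub> h) \<diamondop> \<mu>' (p g) (p h)"
    if "g \<in> carrier G" "h \<in> carrier G" for g h
    using U(3)[OF that] \<mu>[OF that] by simp
  have F\<mu>_reassoc: "farr F (\<mu> g h) \<diamondop> fmult F (X g) (X h) \<diamondop> tarr D (\<theta> g) (\<theta> h) \<diamondop> f =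
      \<theta> (g \<otimes>\<^bsub>G\<^esub> h) \<diamondop> \<mu>' (p g) (p h) \<diamondop> f"
    if "g \<in> carrier G" "h \<in> carrier G" "f \<in> Arr D" "Cod D f = tobj D (Y (p g)) (Y (p h))" for g h f
  proof -
    have "(farr F (\<mu> g h) \<diamondop> fmult F (X g) (X h) \<diamondop> tarr D (\<theta> g) (\<theta> h)) \<diamondop> f =
        (\<theta> (g \<otimes>\<^bsub>G\<^esub> h) \<diamondop> \<mu>' (p g) (p h)) \<diamondop> f"
      using that by (subst F\<mu>) auto
    then show ?thesis using that by simp
  qed
  define V where "V = \<theta> \<one>\<^bsub>G\<^esub> \<diamondop> \<nu>' \<diamondop> arr_inv D (funit F)"
  have V: "is_iso D V" "V \<in> Hom D (fobj F (tunit C)) (fobj F (X \<one>\<^bsub>G\<^esub>))" "V \<diamondop> funit F = \<theta> \<one>\<^bsub>G\<^esub> \<diamondop> \<nu>'"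
    by (auto simp: V_def Hom_iff)
  obtain \<nu> where \<nu>: "\<nu> \<in> Hom C (tunit C) (X \<one>\<^bsub>G\<^esub>)" "farr F \<nu> = V"
    using full[OF _ unit V(2)] by auto
  have \<nu>_simps [simp]: "\<nu> \<in> Arr C" "Dom C \<nu> = tunit C" "Cod C \<nu> = X \<one>\<^bsub>G\<^esub>"
    using \<nu>(1) by (auto simp: Hom_iff)
  have \<nu>_iso [simp]: "is_iso C \<nu>"
    by (rule reflect[OF _ unit]) (use \<nu> V(1) in auto)
  have F\<nu>: "farr F \<nu> \<diamondop> funit F = \<theta> \<one>\<^bsub>G\<^esub> \<diamondop> \<nu>'"
    using V(3) \<nu> by simp

  have fam: "unital_family C G X \<mu> (pullback3 G p a') \<nu>"
  proof
    fix g h k assume [simp]: "g \<in> carrier G" "h \<in> carrier G" "k \<in> carrier G"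
    let ?L = "\<mu> g (h \<otimes>\<^bsub>G\<^esub> k) \<diamondop>\<^bsub>C\<^esub> tarr C (ident C (X g)) (\<mu> h k) \<diamondop>\<^bsub>C\<^esub> assoc C (X g) (X h) (X k)"
    let ?R = "\<mu> (g \<otimes>\<^bsub>G\<^esub> h) k \<diamondop>\<^bsub>C\<^esub> tarr C (\<mu> g h) (ident C (X k))"
    let ?m = "fmult F (tobj C (X g) (X h)) (X k) \<diamondop>
        tarr D (fmult F (X g) (X h)) (ident D (fobj F (X k)))"
    let ?t = "tarr D (tarr D (\<theta> g) (\<theta> h)) (\<theta> k)"
    let ?ghk = "g \<otimes>\<^bsub>G\<^esub> (h \<otimes>\<^bsub>G\<^esub> k)"
    let ?Y = "assoc D (Y (p g)) (Y (p h)) (Y (p k))"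
    have iso: "isomorphic C (tobj C (tobj C (X g) (X h)) (X k)) (X ?ghk)"
      by (rule C.isomorphicI[of ?R]) (auto simp: Hom_iff G.m_assoc)

    have a1: "farr F (assoc C (X g) (X h) (X k)) \<diamondop> ?m \<diamondop> ?t =
        fmult F (X g) (tobj C (X h) (X k)) \<diamondop> tarr D (ident D (fobj F (X g))) (fmult F (X h) (X k)) \<diamondop>
        tarr D (\<theta> g) (tarr D (\<theta> h) (\<theta> k)) \<diamondop> ?Y"
    proof -
      have "farr F (assoc C (X g) (X h) (X k)) \<diamondop> ?m \<diamondop> ?t =
          (farr F (assoc C (X g) (X h) (X k)) \<diamondop> ?m) \<diamondop> ?t"
        by (simp del: D.tarr_cmp' D.tarr_cmp_reassoc)
      also have "\<dots> = (fmult F (X g) (tobj C (X h) (X k)) \<diamondop>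
          tarr D (ident D (fobj F (X g))) (fmult F (X h) (X k)) \<diamondop>
          assoc D (fobj F (X g)) (fobj F (X h)) (fobj F (X k))) \<diamondop> ?t"
        by (simp only: fmult_assoc[OF X X X] \<open>g \<in> carrier G\<close> \<open>h \<in> carrier G\<close> \<open>k \<in> carrier G\<close>)
      also have "\<dots> = fmult F (X g) (tobj C (X h) (X k)) \<diamondop>
          tarr D (ident D (fobj F (X g))) (fmult F (X h) (X k)) \<diamondop>
          tarr D (\<theta> g) (tarr D (\<theta> h) (\<theta> k)) \<diamondop> ?Y"
        using D.assoc_natural'[of "\<theta> g" "\<theta> h" "\<theta> k"]
        by (simp del: D.tarr_cmp' D.tarr_cmp_reassoc)
      finally show ?thesis .
    qed
    have n1: "farr F (tarr C (ident C (X g)) (\<mu> h k)) \<diamondop> fmult F (X g) (tobj C (X h) (X k)) =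
        fmult F (X g) (X (h \<otimes>\<^bsub>G\<^esub> k)) \<diamondop> tarr D (ident D (fobj F (X g))) (farr F (\<mu> h k))"
      using fmult_natural[of "ident C (X g)" "\<mu> h k"] by simp
    have "farr F ?L \<diamondop> ?m \<diamondop> ?t = farr F (\<mu> g (h \<otimes>\<^bsub>G\<^esub> k)) \<diamondop>
        farr F (tarr C (ident C (X g)) (\<mu> h k)) \<diamondop> fmult F (X g) (tobj C (X h) (X k)) \<diamondop>
        tarr D (ident D (fobj F (X g))) (fmult F (X h) (X k)) \<diamondop>
        tarr D (\<theta> g) (tarr D (\<theta> h) (\<theta> k)) \<diamondop> ?Y"
      using a1 by (simp del: D.tarr_cmp' D.tarr_cmp_reassoc)
    also have "\<dots> = farr F (\<mu> g (h \<otimes>\<^bsub>G\<^esub> k)) \<diamondop> fmult F (X g) (X (h \<otimes>\<^bsub>G\<^esub> k)) \<diamondop>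
        tarr D (ident D (fobj F (X g))) (farr F (\<mu> h k)) \<diamondop>
        tarr D (ident D (fobj F (X g))) (fmult F (X h) (X k)) \<diamondop>
        tarr D (\<theta> g) (tarr D (\<theta> h) (\<theta> k)) \<diamondop> ?Y"
      by (simp add: D.cmp_reassoc[OF n1] del: D.tarr_cmp' D.tarr_cmp_reassoc)
    also have "\<dots> = farr F (\<mu> g (h \<otimes>\<^bsub>G\<^esub> k)) \<diamondop> fmult F (X g) (X (h \<otimes>\<^bsub>G\<^esub> k)) \<diamondop>
        tarr D (\<theta> g) (\<theta> (h \<otimes>\<^bsub>G\<^esub> k)) \<diamondop> tarr D (ident D (Y (p g))) (\<mu>' (p h) (p k)) \<diamondop> ?Y"
      by (simp add: F\<mu>)
    also have "\<dots> = \<theta> ?ghk \<diamondop> \<mu>' (p g) (p h \<otimes>\<^bsub>H\<^esub> p k) \<diamondop>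
        tarr D (ident D (Y (p g))) (\<mu>' (p h) (p k)) \<diamondop> ?Y"
      by (subst F\<mu>_reassoc) auto
    also have "\<dots> = lsmult D (a' (p g, p h, p k)) (\<theta> ?ghk \<diamondop> \<mu>' (p g \<otimes>\<^bsub>H\<^esub> p h) (p k) \<diamondop>
        tarr D (\<mu>' (p g) (p h)) (ident D (Y (p k))))"
      by (simp add: T.\<mu>_assoc T.G.m_assoc)
    finally have L: "farr F ?L \<diamondop> ?m \<diamondop> ?t = lsmult D (a' (p g, p h, p k)) (\<theta> ?ghk \<diamondop>
        \<mu>' (p g \<otimes>\<^bsub>H\<^esub> p h) (p k) \<diamondop> tarr D (\<mu>' (p g) (p h)) (ident D (Y (p k))))" .

    have n2: "farr F (tarr C (\<mu> g h) (ident C (X k))) \<diamondop> fmult F (tobj C (X g) (X h)) (X k) =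
        fmult F (X (g \<otimes>\<^bsub>G\<^esub> h)) (X k) \<diamondop> tarr D (farr F (\<mu> g h)) (ident D (fobj F (X k)))"
      using fmult_natural[of "\<mu> g h" "ident C (X k)"] by simp
    have "farr F ?R \<diamondop> ?m \<diamondop> ?t = farr F (\<mu> (g \<otimes>\<^bsub>G\<^esub> h) k) \<diamondop>
        fmult F (X (g \<otimes>\<^bsub>G\<^esub> h)) (X k) \<diamondop> tarr D (farr F (\<mu> g h)) (ident D (fobj F (X k))) \<diamondop>
        tarr D (fmult F (X g) (X h)) (ident D (fobj F (X k))) \<diamondop> ?t"
      by (simp add: D.cmp_reassoc[OF n2] del: D.tarr_cmp' D.tarr_cmp_reassoc)
    also have "\<dots> = farr F (\<mu> (g \<otimes>\<^bsub>G\<^esub> h) k) \<diamondop> fmult F (X (g \<otimes>\<^bsub>G\<^esub> h)) (X k) \<diamondop>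
        tarr D (\<theta> (g \<otimes>\<^bsub>G\<^esub> h)) (\<theta> k) \<diamondop> tarr D (\<mu>' (p g) (p h)) (ident D (Y (p k)))"
      by (simp add: F\<mu>)
    also have "\<dots> = \<theta> ?ghk \<diamondop>
        \<mu>' (p g \<otimes>\<^bsub>H\<^esub> p h) (p k) \<diamondop> tarr D (\<mu>' (p g) (p h)) (ident D (Y (p k)))"
      by (subst F\<mu>_reassoc) (auto simp: G.m_assoc)
    finally have "farr F ?L \<diamondop> ?m \<diamondop> ?t =
        farr F (lsmult C (a' (p g, p h, p k)) ?R) \<diamondop> ?m \<diamondop> ?t"
      using L by (simp add: G.m_assoc del: D.tarr_cmp' D.tarr_cmp_reassoc)
    moreover have "is_iso D (?m \<diamondop> ?t)" by simp
    ultimately have "farr F ?L = farr F (lsmult C (a' (p g, p h, p k)) ?R)"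
      by (elim D.iso_cancel_right[rotated -1]) (auto simp: G.m_assoc)
    then show "?L = lsmult C (pullback3 G p a' (g, h, k)) ?R"
      by (intro faithful[OF _ iso]) (auto simp: pullback3_def Hom_iff G.m_assoc)
  next
    fix g assume [simp]: "g \<in> carrier G"
    let ?t = "fmult F (tunit C) (X g) \<diamondop> tarr D (funit F) (ident D (fobj F (X g))) \<diamondop>
      tarr D (ident D (tunit D)) (\<theta> g)"
    have n: "farr F (tarr C \<nu> (ident C (X g))) \<diamondop> fmult F (tunit C) (X g) =
        fmult F (X \<one>\<^bsub>G\<^esub>) (X g) \<diamondop> tarr D (farr F \<nu>) (ident D (fobj F (X g)))"
      using fmult_natural[of \<nu> "ident C (X g)"] by simp
    have "farr F (\<mu> \<one>\<^bsub>G\<^esub> g \<diamondop>\<^bsub>C\<^esub> tarr C \<nu> (ident C (X g))) \<diamondop> ?t =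
        farr F (\<mu> \<one>\<^bsub>G\<^esub> g) \<diamondop> fmult F (X \<one>\<^bsub>G\<^esub>) (X g) \<diamondop> tarr D (\<theta> \<one>\<^bsub>G\<^esub>) (\<theta> g) \<diamondop>
        tarr D \<nu>' (ident D (Y (p g)))"
      by (simp add: D.cmp_reassoc[OF n] F\<nu>)
    also have "\<dots> = \<theta> g \<diamondop> \<mu>' \<one>\<^bsub>H\<^esub> (p g) \<diamondop> tarr D \<nu>' (ident D (Y (p g)))"
      by (subst F\<mu>_reassoc) auto
    also have "\<dots> = \<theta> g \<diamondop> lunit D (Y (p g))" by (simp add: T.\<mu>_unit_left)
    also have "\<dots> = lunit D (fobj F (X g)) \<diamondop> tarr D (ident D (tunit D)) (\<theta> g)"
      using D.lunit_natural'[of "\<theta> g"] by simp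
    also have "\<dots> = farr F (lunit C (X g)) \<diamondop> ?t"
      by (subst fmult_lunit[symmetric]) (simp_all del: D.tarr_cmp' D.tarr_cmp_reassoc)
    finally have "farr F (\<mu> \<one>\<^bsub>G\<^esub> g \<diamondop>\<^bsub>C\<^esub> tarr C \<nu> (ident C (X g))) = farr F (lunit C (X g))"
      by (elim D.iso_cancel_right[rotated -1]) auto
    then show "\<mu> \<one>\<^bsub>G\<^esub> g \<diamondop>\<^bsub>C\<^esub> tarr C \<nu> (ident C (X g)) = lunit C (X g)"
      by (intro faithful[of g "tobj C (tunit C) (X g)"] C.isomorphic_units) (auto simp: Hom_iff)
  next
    fix g assume [simp]: "g \<in> carrier G"
    let ?t = "fmult F (X g) (tunit C) \<diamondop> tarr D (ident D (fobj F (X g))) (funit F) \<diamondop>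
      tarr D (\<theta> g) (ident D (tunit D))"
    have n: "farr F (tarr C (ident C (X g)) \<nu>) \<diamondop> fmult F (X g) (tunit C) =
        fmult F (X g) (X \<one>\<^bsub>G\<^esub>) \<diamondop> tarr D (ident D (fobj F (X g))) (farr F \<nu>)"
      using fmult_natural[of "ident C (X g)" \<nu>] by simp
    have "farr F (\<mu> g \<one>\<^bsub>G\<^esub> \<diamondop>\<^bsub>C\<^esub> tarr C (ident C (X g)) \<nu>) \<diamondop> ?t =
        farr F (\<mu> g \<one>\<^bsub>G\<^esub>) \<diamondop> fmult F (X g) (X \<one>\<^bsub>G\<^esub>) \<diamondop> tarr D (\<theta> g) (\<theta> \<one>\<^bsub>G\<^esub>) \<diamondop>
        tarr D (ident D (Y (p g))) \<nu>'"
      by (simp add: D.cmp_reassoc[OF n] F\<nu>)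
    also have "\<dots> = \<theta> g \<diamondop> \<mu>' (p g) \<one>\<^bsub>H\<^esub> \<diamondop> tarr D (ident D (Y (p g))) \<nu>'"
      by (subst F\<mu>_reassoc) auto
    also have "\<dots> = \<theta> g \<diamondop> runit D (Y (p g))" by (simp add: T.\<mu>_unit_right)
    also have "\<dots> = runit D (fobj F (X g)) \<diamondop> tarr D (\<theta> g) (ident D (tunit D))"
      using D.runit_natural'[of "\<theta> g"] by simp
    also have "\<dots> = farr F (runit C (X g)) \<diamondop> ?t"
      by (subst fmult_runit[symmetric]) (simp_all del: D.tarr_cmp' D.tarr_cmp_reassoc)
    finally have "farr F (\<mu> g \<one>\<^bsub>G\<^esub> \<diamondop>\<^bsub>C\<^esub> tarr C (ident C (X g)) \<nu>) = farr F (runit C (X g))"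
      by (elim D.iso_cancel_right[rotated -1]) auto
    then show "\<mu> g \<one>\<^bsub>G\<^esub> \<diamondop>\<^bsub>C\<^esub> tarr C (ident C (X g)) \<nu> = runit C (X g)"
      by (intro faithful[of g "tobj C (X g) (tunit C)"] C.isomorphic_units) (auto simp: Hom_iff)
  qed (use \<mu> \<nu> in auto)
  interpret S: unital_family C G X \<mu> "pullback3 G p a'" \<nu> by (rule fam)
  have "compatible_families C D F G X \<mu> (pullback3 G p a') \<nu> H Y \<mu>' a' \<nu>' p \<theta>"
    by unfold_locales (use p \<theta>_Hom F\<mu> F\<nu> in auto)
  then show ?thesis by blast
qed

section \<open>Arrows between direct sums and tensor products of direct sums\<close>

lemma (in linear_category) biproduct_matrix_ext:
  assumes B: "biproduct C Xs A \<iota> \<pi>" and B': "biproduct C Ys B \<iota>' \<pi>'"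
    and "u \<in> Hom C A B" "v \<in> Hom C A B"
    and eq: "\<And>i j. i < length Ys \<Longrightarrow> j < length Xs \<Longrightarrow> \<pi>' i \<diamondop> u \<diamondop> \<iota> j = \<pi>' i \<diamondop> v \<diamondop> \<iota> j"
  shows "u = v"
proof -
  note L = linear_category_axioms
  note [simp] = biproduct_simps[OF L B] biproduct_simps[OF L B']
  have [simp]: "u \<in> Arr C" "Dom C u = A" "Cod C u = B" "v \<in> Arr C" "Dom C v = A" "Cod C v = B"
    using assms by (auto simp: Hom_iff)
  show ?thesis
  proof (rule biproduct_joint_epi[OF L B])
    fix j assume j: "j < length Xs"
    show "u \<diamondop> \<iota> j = v \<diamondop> \<iota> j"
      by (rule biproduct_joint_mono[OF L B']) (use j eq in auto)
  qed auto
qed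

lemma (in linear_category) biproduct_matrix_exists:
  assumes B: "biproduct C Xs A \<iota> \<pi>" and B': "biproduct C Ys B \<iota>' \<pi>'"
    and e: "\<And>i j. i < length Ys \<Longrightarrow> j < length Xs \<Longrightarrow> e i j \<in> Hom C (Xs ! j) (Ys ! i)"
  shows "\<exists>u. u \<in> Hom C A B \<and> (\<forall>i < length Ys. \<forall>j < length Xs. \<pi>' i \<diamondop> u \<diamondop> \<iota> j = e i j)"
proof -
  note L = linear_category_axioms
  note [simp] = biproduct_simps[OF L B] biproduct_simps[OF L B']
  have ex: "\<forall>j. \<exists>t. j < length Xs \<longrightarrow> t \<in> Hom C (Xs ! j) B \<and> (\<forall>i < length Ys. \<pi>' i \<diamondop> t = e i j)"
  proof
    fix j
    show "\<exists>t. j < length Xs \<longrightarrow> t \<in> Hom C (Xs ! j) B \<and> (\<forall>i < length Ys. \<pi>' i \<diamondop> t = e i j)"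
    proof (cases "j < length Xs")
      case True
      obtain t where "t \<in> Hom C (Xs ! j) B" "\<And>i. i < length Ys \<Longrightarrow> \<pi>' i \<diamondop> t = e i j"
        by (rule biproduct_tuple[OF L B', of "Xs ! j" "\<lambda>i. e i j"]) (use True e in auto)
      then show ?thesis by blast
    qed simp
  qed
  obtain t where t: "\<forall>j. j < length Xs \<longrightarrow> t j \<in> Hom C (Xs ! j) B \<and> (\<forall>i < length Ys. \<pi>' i \<diamondop> t j = e i j)"
    using choice[OF ex] by (rule exE) (rule that)
  obtain u where u: "u \<in> Hom C A B" "\<And>j. j < length Xs \<Longrightarrow> u \<diamondop> \<iota> j = t j"
    by (rule biproduct_cotuple[OF L B, of B t]) (use t in auto)
  then show ?thesis using t by auto
qed

context tensor_category
begin

lemma splitting_tarr: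
  assumes s: "splitting C A n e r" and B: "B \<in> Obj C"
  shows "splitting C (tobj C A B) n (\<lambda>i. tarr C (e i) (ident C B)) (\<lambda>i. tarr C (r i) (ident C B))"
    and "splitting C (tobj C B A) n (\<lambda>i. tarr C (ident C B) (e i)) (\<lambda>i. tarr C (ident C B) (r i))"
proof -
  have S [simp]: "A \<in> Obj C" "i < n \<Longrightarrow> e i \<in> Arr C" "i < n \<Longrightarrow> r i \<in> Arr C" "i < n \<Longrightarrow> Cod C (e i) = A"
    "i < n \<Longrightarrow> Dom C (r i) = A" "i < n \<Longrightarrow> Cod C (r i) = Dom C (e i)" for i
    using s by (auto simp: splitting_def)
  have sum: "hsum C A A (\<lambda>i. e i \<diamondop> r i) {..<n} = ident C A"
    using s by (auto simp: splitting_def)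
  have "tarr C (hsum C A A (\<lambda>i. e i \<diamondop> r i) {..<n}) (ident C B) =
      hsum C (tobj C A B) (tobj C A B) (\<lambda>i. tarr C (e i \<diamondop> r i) (ident C B)) {..<n}"
    by (rule hsum_additive[where X = A and Y = A and T = "\<lambda>f. tarr C f (ident C B)"])
      (use B tarr_ladd_left[of _ A A _ "ident C B" B B] linear_category_axioms in \<open>auto simp: Hom_iff\<close>)
  also have "\<dots> = hsum C (tobj C A B) (tobj C A B)
      (\<lambda>i. tarr C (e i) (ident C B) \<diamondop> tarr C (r i) (ident C B)) {..<n}"
    by (rule hsum_cong) (use B in \<open>auto simp: Hom_iff\<close>)
  finally show "splitting C (tobj C A B) n (\<lambda>i. tarr C (e i) (ident C B)) (\<lambda>i. tarr C (r i) (ident C B))"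
    using B unfolding splitting_def by (simp add: sum)
  have "tarr C (ident C B) (hsum C A A (\<lambda>i. e i \<diamondop> r i) {..<n}) =
      hsum C (tobj C B A) (tobj C B A) (\<lambda>i. tarr C (ident C B) (e i \<diamondop> r i)) {..<n}"
    by (rule hsum_additive[where X = A and Y = A and T = "\<lambda>f. tarr C (ident C B) f"])
      (use B tarr_ladd_right[of "ident C B" B B _ A A] linear_category_axioms in \<open>auto simp: Hom_iff\<close>)
  also have "\<dots> = hsum C (tobj C B A) (tobj C B A)
      (\<lambda>i. tarr C (ident C B) (e i) \<diamondop> tarr C (ident C B) (r i)) {..<n}"
    by (rule hsum_cong) (use B in \<open>auto simp: Hom_iff\<close>)
  finally show "splitting C (tobj C B A) n (\<lambda>i. tarr C (ident C B) (e i)) (\<lambda>i. tarr C (ident C B) (r i))"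
    using B unfolding splitting_def by (simp add: sum)
qed

text \<open>
  Inclusions of summands stay jointly epic after tensoring. With this, equations between
  arrows out of tensor products of direct sums are checked on the summands, and no double
  sums have to be manipulated.
\<close>

lemma biproduct_tensor_joint_epi:
  assumes B1: "biproduct C Xs A \<iota> \<pi>" and B2: "biproduct C Ys B \<iota>' \<pi>'"
    and fg: "f \<in> Arr C" "g \<in> Arr C" "Dom C f = tobj C A B" "Dom C g = tobj C A B" "Cod C f = Cod C g"
    and eq: "\<And>i j. i < length Xs \<Longrightarrow> j < length Ys \<Longrightarrow> f \<diamondop> tarr C (\<iota> i) (\<iota>' j) = g \<diamondop> tarr C (\<iota> i) (\<iota>' j)"
  shows "f = g"
proof -
  note L = linear_category_axioms
  note [simp] = biproduct_simps[OF L B1] biproduct_simps[OF L B2]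
  note S1 = biproduct_splitting[OF L B1] and S2 = biproduct_splitting[OF L B2]
  show ?thesis
  proof (rule splitting_joint_epi[OF splitting_tarr(1)[OF S1, of B] fg])
    fix i assume i: "i < length Xs"
    show "f \<diamondop> tarr C (\<iota> i) (ident C B) = g \<diamondop> tarr C (\<iota> i) (ident C B)"
    proof (rule splitting_joint_epi[OF splitting_tarr(2)[OF S2, of "Xs ! i"]])
      fix j assume j: "j < length Ys"
      show "(f \<diamondop> tarr C (\<iota> i) (ident C B)) \<diamondop> tarr C (ident C (Xs ! i)) (\<iota>' j) =
          (g \<diamondop> tarr C (\<iota> i) (ident C B)) \<diamondop> tarr C (ident C (Xs ! i)) (\<iota>' j)"
        using i j fg eq[OF i j] by simp
    qed (use i fg in auto)
  qed auto
qed

lemma biproduct_tensor3_joint_epi: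
  assumes B1: "biproduct C Xs A \<iota> \<pi>" and B2: "biproduct C Ys B \<iota>' \<pi>'" and B3: "biproduct C Zs D \<iota>'' \<pi>''"
    and fg: "f \<in> Arr C" "g \<in> Arr C" "Dom C f = tobj C (tobj C A B) D" "Dom C g = tobj C (tobj C A B) D"
      "Cod C f = Cod C g"
    and eq: "\<And>i j k. i < length Xs \<Longrightarrow> j < length Ys \<Longrightarrow> k < length Zs \<Longrightarrow>
      f \<diamondop> tarr C (tarr C (\<iota> i) (\<iota>' j)) (\<iota>'' k) = g \<diamondop> tarr C (tarr C (\<iota> i) (\<iota>' j)) (\<iota>'' k)"
  shows "f = g"
proof -
  note L = linear_category_axioms
  note [simp] = biproduct_simps[OF L B1] biproduct_simps[OF L B2] biproduct_simps[OF L B3]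
  note S1 = biproduct_splitting[OF L B1] and S2 = biproduct_splitting[OF L B2] and S3 = biproduct_splitting[OF L B3]
  show ?thesis
  proof (rule splitting_joint_epi[OF splitting_tarr(1)[OF splitting_tarr(1)[OF S1, of B], of D] fg])
    fix i assume i: "i < length Xs"
    let ?i = "tarr C (tarr C (\<iota> i) (ident C B)) (ident C D)"
    show "f \<diamondop> ?i = g \<diamondop> ?i"
    proof (rule splitting_joint_epi[OF splitting_tarr(1)[OF splitting_tarr(2)[OF S2, of "Xs ! i"], of D]])
      fix j assume j: "j < length Ys"
      let ?j = "tarr C (tarr C (ident C (Xs ! i)) (\<iota>' j)) (ident C D)"
      show "(f \<diamondop> ?i) \<diamondop> ?j = (g \<diamondop> ?i) \<diamondop> ?j"
      proof (rule splitting_joint_epi[OF splitting_tarr(2)[OF S3, of "tobj C (Xs ! i) (Ys ! j)"]])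
        fix k assume k: "k < length Zs"
        show "((f \<diamondop> ?i) \<diamondop> ?j) \<diamondop> tarr C (ident C (tobj C (Xs ! i) (Ys ! j))) (\<iota>'' k) =
            ((g \<diamondop> ?i) \<diamondop> ?j) \<diamondop> tarr C (ident C (tobj C (Xs ! i) (Ys ! j))) (\<iota>'' k)"
          using i j k fg eq[OF i j k] by simp
      qed (use i j fg in auto)
    qed (use i fg in auto)
  qed auto
qed

end


section \<open>Graded vector spaces\<close>

lemma graded_tensor_Nil [simp]: "graded_tensor G [] ys = []"
  by (simp add: graded_tensor_def)

lemma graded_tensor_Cons [simp]:
  "graded_tensor G (x # xs) ys = map (\<lambda>y. x \<otimes>\<^bsub>G\<^esub> y) ys @ graded_tensor G xs ys"
  by (simp add: graded_tensor_def)

lemma graded_tensor_append [simp]: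
  "graded_tensor G (xs @ xs') ys = graded_tensor G xs ys @ graded_tensor G xs' ys"
  by (simp add: graded_tensor_def)

lemma length_graded_tensor [simp]: "length (graded_tensor G xs ys) = length xs * length ys"
  by (induction xs) auto

lemma mult_add_less: "i * m + j < n * m" if "i < n" "j < m" for i j m n :: nat
proof -
  have "i * m + j < Suc i * m" using that by simp
  also have "\<dots> \<le> n * m" using that by (intro mult_le_mono1) simp
  finally show ?thesis .
qed

lemma graded_tensor_nth:
  assumes "i < length xs" "j < length ys"
  shows "graded_tensor G xs ys ! (i * length ys + j) = xs ! i \<otimes>\<^bsub>G\<^esub> ys ! j"
  using assms
proof (induction xs arbitrary: i)
  case (Cons x xs)
  then show ?case by (cases i) (auto simp: nth_append)
qed simp

lemma graded_tensor_index:
  assumes "k < length xs * length ys"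
  shows "k div length ys < length xs" "k mod length ys < length ys"
proof -
  have "0 < length ys" using assms by (cases "length ys = 0") auto
  then show "k mod length ys < length ys" by simp
  show "k div length ys < length xs" using assms by (simp add: less_mult_imp_div_less)
qed

lemma graded_tensor_nth_div_mod:
  assumes "k < length xs * length ys"
  shows "graded_tensor G xs ys ! k = xs ! (k div length ys) \<otimes>\<^bsub>G\<^esub> ys ! (k mod length ys)"
  using graded_tensor_nth[OF graded_tensor_index[OF assms], of G] by simp

lemma (in monoid) graded_tensor_lists:
  "xs \<in> lists (carrier G) \<Longrightarrow> ys \<in> lists (carrier G) \<Longrightarrow> graded_tensor G xs ys \<in> lists (carrier G)"
  by (induction xs) auto

lemma (in monoid) graded_tensor_map:
  assumes "x \<in> carrier G" "ys \<in> lists (carrier G)" "zs \<in> lists (carrier G)"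
  shows "graded_tensor G (map (\<lambda>y. x \<otimes> y) ys) zs = map (\<lambda>y. x \<otimes> y) (graded_tensor G ys zs)"
  using assms(2)
proof (induction ys)
  case (Cons y ys)
  then show ?case using assms by (auto simp: m_assoc)
qed simp

lemma (in monoid) graded_tensor_assoc:
  assumes "xs \<in> lists (carrier G)" "ys \<in> lists (carrier G)" "zs \<in> lists (carrier G)"
  shows "graded_tensor G (graded_tensor G xs ys) zs = graded_tensor G xs (graded_tensor G ys zs)"
  using assms(1)
proof (induction xs)
  case (Cons x xs)
  then show ?case using assms graded_tensor_map by auto
qed simp

lemma (in monoid) graded_tensor_units:
  assumes "xs \<in> lists (carrier G)"
  shows "graded_tensor G [\<one>] xs = xs" "graded_tensor G xs [\<one>] = xs"
proof -
  show "graded_tensor G [\<one>] xs = xs"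
    using assms by (auto intro!: map_idI)
  show "graded_tensor G xs [\<one>] = xs"
    using assms by (induction xs) auto
qed

lemma map_graded_tensor:
  assumes p: "\<And>x y. x \<in> carrier G \<Longrightarrow> y \<in> carrier G \<Longrightarrow> p (x \<otimes>\<^bsub>G\<^esub> y) = p x \<otimes>\<^bsub>H\<^esub> p y"
    and "xs \<in> lists (carrier G)" "ys \<in> lists (carrier G)"
  shows "map p (graded_tensor G xs ys) = graded_tensor H (map p xs) (map p ys)"
  using assms(2)
proof (induction xs)
  case (Cons x xs)
  then show ?case using assms by auto
qed simp

text \<open>
  The condition on the third component of an arrow of \<open>Vect\<close>.
\<close>

definition graded_matrix :: "'g list \<Rightarrow> 'g list \<Rightarrow> 'k :: zero mat \<Rightarrow> bool" where
  "graded_matrix xs ys M \<longleftrightarrow> M \<in> carrier_mat (length ys) (length xs) \<and>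
    (\<forall>i < length ys. \<forall>j < length xs. M $$ (i, j) \<noteq> 0 \<longrightarrow> ys ! i = xs ! j)"

lemma Vect_simps [simp]:
  "Obj (Vect G a) = lists (carrier G)"
  "Dom (Vect G a) (xs, ys, M) = xs" "Cod (Vect G a) (xs, ys, M) = ys"
  "ident (Vect G a) xs = (xs, xs, 1\<^sub>m (length xs))"
  "(ys', zs, N) \<diamondop>\<^bsub>Vect G a\<^esub> (xs, ys, M) = (xs, zs, N * M)"
  "ladd (Vect G a) (xs, ys, M) (xs', ys'', M') = (xs, ys, M + M')"
  "lzero (Vect G a) xs ys = (xs, ys, 0\<^sub>m (length ys) (length xs))"
  "lsmult (Vect G a) c (xs, ys, M) = (xs, ys, c \<cdot>\<^sub>m M)"
  "tunit (Vect G a) = [\<one>\<^bsub>G\<^esub>]" "tobj (Vect G a) = graded_tensor G"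
  "tarr (Vect G a) (xs, xs', M) (vs, vs', M') =
    (graded_tensor G xs vs, graded_tensor G xs' vs', kronecker M M')"
  "assoc (Vect G a) = graded_assoc G a"
  "lunit (Vect G a) xs = (graded_tensor G [\<one>\<^bsub>G\<^esub>] xs, xs, 1\<^sub>m (length xs))"
  "runit (Vect G a) xs = (graded_tensor G xs [\<one>\<^bsub>G\<^esub>], xs, 1\<^sub>m (length xs))"
  by (simp_all add: Vect_def)

lemma Vect_Arr_iff [simp]:
  "(xs, ys, M) \<in> Arr (Vect G a) \<longleftrightarrow>
    xs \<in> lists (carrier G) \<and> ys \<in> lists (carrier G) \<and> graded_matrix xs ys M"
  by (auto simp: Vect_def graded_matrix_def)

lemma Vect_Hom_iff:
  "f \<in> Hom (Vect G a) xs ys \<longleftrightarrow> (\<exists>M. f = (xs, ys, M) \<and>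
    xs \<in> lists (carrier G) \<and> ys \<in> lists (carrier G) \<and> graded_matrix xs ys M)"
  by (cases f) (auto simp: Hom_iff)

lemma graded_matrix_mult:
  assumes "graded_matrix xs ys M" "graded_matrix ys zs N"
  shows "graded_matrix xs zs (N * M)"
  unfolding graded_matrix_def
proof (intro conjI allI impI)
  show "N * M \<in> carrier_mat (length zs) (length xs)"
    using assms by (auto simp: graded_matrix_def)
  fix i j assume ij: "i < length zs" "j < length xs" "(N * M) $$ (i, j) \<noteq> 0"
  then have "(\<Sum>k < length ys. N $$ (i, k) * M $$ (k, j)) \<noteq> 0"
    using assms by (auto simp: graded_matrix_def scalar_prod_def atLeast0LessThan)
  then obtain k where "k < length ys" "N $$ (i, k) * M $$ (k, j) \<noteq> 0"
    by (metis (no_types, lifting) lessThan_iff sum.neutral)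
  then show "zs ! i = xs ! j"
    using assms ij unfolding graded_matrix_def by (metis mult_not_zero)
qed

lemma category_Vect: "category (Vect G a)"
proof
  fix f assume "f \<in> Arr (Vect G a)"
  then show "Dom (Vect G a) f \<in> Obj (Vect G a)" "Cod (Vect G a) f \<in> Obj (Vect G a)"
    by (cases f; simp)+
next
  fix f g X Y Z assume "f \<in> Hom (Vect G a) X Y" "g \<in> Hom (Vect G a) Y Z"
  then show "g \<diamondop>\<^bsub>Vect G a\<^esub> f \<in> Hom (Vect G a) X Z"
    by (auto simp: Vect_Hom_iff graded_matrix_mult)
next
  fix f g h W X Y Z
  assume "f \<in> Hom (Vect G a) W X" "g \<in> Hom (Vect G a) X Y" "h \<in> Hom (Vect G a) Y Z"
  then show "(h \<diamondop>\<^bsub>Vect G a\<^esub> g) \<diamondop>\<^bsub>Vect G a\<^esub> f = h \<diamondop>\<^bsub>Vect G a\<^esub> g \<diamondop>\<^bsub>Vect G a\<^esub> f"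
    by (auto simp: Vect_Hom_iff graded_matrix_def intro!: assoc_mult_mat)
qed (auto simp: Vect_Hom_iff graded_matrix_def)

lemma kronecker_carrier:
  "M \<in> carrier_mat m n \<Longrightarrow> N \<in> carrier_mat m' n' \<Longrightarrow> kronecker M N \<in> carrier_mat (m * m') (n * n')"
  by (auto simp: kronecker_def)

lemma kronecker_index:
  assumes "M \<in> carrier_mat m n" "N \<in> carrier_mat m' n'" "i < m" "j < n" "i' < m'" "j' < n'"
  shows "kronecker M N $$ (i * m' + i', j * n' + j') = M $$ (i, j) * N $$ (i', j')"
proof -
  have "i * m' + i' < m * m'" "j * n' + j' < n * n'" using assms mult_add_less by auto
  then show ?thesis using assms by (simp add: kronecker_def)
qed

lemma mult_add_div [simp]: "j < m \<Longrightarrow> (i * m + j) div m = i" for i j m :: nat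
  by (metis div_mult_self3 div_less add.right_neutral less_nat_zero_code)

section \<open>Realizing graded vector spaces by direct sums\<close>

text \<open>
  Representing objects for all lists are chosen once and for all, as part of the data.
\<close>

locale realization = unital_family C G X \<mu> a \<nu>
  for C :: "('o, 'm, 'k :: field, 'z) tensor_category_data_scheme" (structure)
    and G :: "('g, 'y) monoid_scheme" and X \<mu> a \<nu> +
  fixes S :: "'g list \<Rightarrow> 'o" and \<iota> \<pi> :: "'g list \<Rightarrow> nat \<Rightarrow> 'm"
  assumes S_biproduct: "xs \<in> lists (carrier G) \<Longrightarrow> biproduct C (map X xs) (S xs) (\<iota> xs) (\<pi> xs)"
begin

lemmas S_simps = biproduct_simps[OF linear_category_axioms S_biproduct, unfolded length_map]
lemmas S_reassoc = biproduct_delta_reassoc[OF linear_category_axioms S_biproduct, unfolded length_map]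

lemma nth_carrier [simp]: "xs \<in> lists (carrier G) \<Longrightarrow> i < length xs \<Longrightarrow> xs ! i \<in> carrier G"
  by (auto simp: in_lists_conv_set)

lemma S_Obj [simp]: "xs \<in> lists (carrier G) \<Longrightarrow> S xs \<in> Obj C"
  by (rule S_simps(1))

lemma \<iota>_simps [simp]:
  assumes "xs \<in> lists (carrier G)" "i < length xs"
  shows "\<iota> xs i \<in> Arr C" "Dom C (\<iota> xs i) = X (xs ! i)" "Cod C (\<iota> xs i) = S xs"
    "\<pi> xs i \<in> Arr C" "Dom C (\<pi> xs i) = S xs" "Cod C (\<pi> xs i) = X (xs ! i)"
    "\<pi> xs i \<diamondop> \<iota> xs i = ident C (X (xs ! i))"
  using S_simps[OF assms(1)] assms(2) by simp_all

lemma \<iota>_zero [simp]: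
  assumes "xs \<in> lists (carrier G)" "i < length xs" "j < length xs" "i \<noteq> j"
  shows "\<pi> xs j \<diamondop> \<iota> xs i = lzero C (X (xs ! i)) (X (xs ! j))"
  using S_simps(10)[OF assms] assms by simp

lemma \<iota>_reassoc [simp]:
  assumes "xs \<in> lists (carrier G)" "i < length xs" "j < length xs" "f \<in> Arr C" "Cod C f = X (xs ! i)"
  shows "\<pi> xs i \<diamondop> \<iota> xs i \<diamondop> f = f"
    "i \<noteq> j \<Longrightarrow> \<pi> xs j \<diamondop> \<iota> xs i \<diamondop> f = lzero C (Dom C f) (X (xs ! j))"
  using S_reassoc[of xs i j f] assms by simp_all

text \<open>
  In a graded matrix, entries between different degrees vanish, so nothing is lost by sending
  them to the zero arrow.
\<close>

definition entry :: "'g \<Rightarrow> 'g \<Rightarrow> 'k \<Rightarrow> 'm" where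
  "entry x y c = (if x = y then lsmult C c (ident C (X x)) else lzero C (X x) (X y))"

lemma entry_simps [simp]:
  assumes "x \<in> carrier G" "y \<in> carrier G"
  shows "entry x y c \<in> Arr C" "Dom C (entry x y c) = X x" "Cod C (entry x y c) = X y"
  using assms by (auto simp: entry_def)

definition realize :: "'g list \<Rightarrow> 'g list \<Rightarrow> 'k mat \<Rightarrow> 'm" where
  "realize xs ys M = (SOME u. u \<in> Hom C (S xs) (S ys) \<and>
    (\<forall>i < length ys. \<forall>j < length xs. \<pi> ys i \<diamondop> u \<diamondop> \<iota> xs j = entry (xs ! j) (ys ! i) (M $$ (i, j))))"

lemma realize:
  assumes "xs \<in> lists (carrier G)" "ys \<in> lists (carrier G)"
  shows "realize xs ys M \<in> Hom C (S xs) (S ys) \<and>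
    (\<forall>i < length ys. \<forall>j < length xs.
      \<pi> ys i \<diamondop> realize xs ys M \<diamondop> \<iota> xs j = entry (xs ! j) (ys ! i) (M $$ (i, j)))"
  unfolding realize_def
proof (rule someI_ex)
  show "\<exists>u. u \<in> Hom C (S xs) (S ys) \<and>
    (\<forall>i < length ys. \<forall>j < length xs. \<pi> ys i \<diamondop> u \<diamondop> \<iota> xs j = entry (xs ! j) (ys ! i) (M $$ (i, j)))"
    using biproduct_matrix_exists[OF S_biproduct[OF assms(1)] S_biproduct[OF assms(2)],
        of "\<lambda>i j. entry (xs ! j) (ys ! i) (M $$ (i, j))"] assms by (simp add: Hom_iff)
qed

lemma realize_simps [simp]:
  assumes "xs \<in> lists (carrier G)" "ys \<in> lists (carrier G)"
  shows "realize xs ys M \<in> Arr C" "Dom C (realize xs ys M) = S xs" "Cod C (realize xs ys M) = S ys"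
  using realize[OF assms, of M] by (auto simp: Hom_iff)

lemma realize_entry:
  assumes "xs \<in> lists (carrier G)" "ys \<in> lists (carrier G)" "i < length ys" "j < length xs"
  shows "\<pi> ys i \<diamondop> realize xs ys M \<diamondop> \<iota> xs j = entry (xs ! j) (ys ! i) (M $$ (i, j))"
  using realize[OF assms(1,2), of M] assms(3,4) by simp

lemma S_matrix_ext:
  assumes "xs \<in> lists (carrier G)" "ys \<in> lists (carrier G)"
    "u \<in> Arr C" "Dom C u = S xs" "Cod C u = S ys" "v \<in> Arr C" "Dom C v = S xs" "Cod C v = S ys"
    and "\<And>i j. i < length ys \<Longrightarrow> j < length xs \<Longrightarrow> \<pi> ys i \<diamondop> u \<diamondop> \<iota> xs j = \<pi> ys i \<diamondop> v \<diamondop> \<iota> xs j"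
  shows "u = v"
  using assms biproduct_matrix_ext[OF S_biproduct[OF assms(1)] S_biproduct[OF assms(2)], of u v]
  by (simp add: Hom_iff)

lemma realize_eqI:
  assumes "xs \<in> lists (carrier G)" "ys \<in> lists (carrier G)"
    "u \<in> Arr C" "Dom C u = S xs" "Cod C u = S ys"
    and "\<And>i j. i < length ys \<Longrightarrow> j < length xs \<Longrightarrow>
      \<pi> ys i \<diamondop> u \<diamondop> \<iota> xs j = entry (xs ! j) (ys ! i) (M $$ (i, j))"
  shows "realize xs ys M = u"
  by (rule S_matrix_ext[OF assms(1,2)]) (use assms realize_entry in auto)

lemma realize_ident:
  assumes "xs \<in> lists (carrier G)"
  shows "realize xs xs (1\<^sub>m (length xs)) = ident C (S xs)"
proof (rule realize_eqI)
  fix i j assume "i < length xs" "j < length xs"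
  then show "\<pi> xs i \<diamondop> ident C (S xs) \<diamondop> \<iota> xs j = entry (xs ! j) (xs ! i) (1\<^sub>m (length xs) $$ (i, j))"
    using assms by (cases "i = j") (auto simp: entry_def)
qed (use assms in auto)

lemma entry_cmp:
  assumes "x \<in> carrier G" "y \<in> carrier G" "z \<in> carrier G" "c \<noteq> 0 \<Longrightarrow> y = x" "d \<noteq> 0 \<Longrightarrow> z = y"
  shows "entry y z d \<diamondop> entry x y c = lsmult C (d * c) (if x = z then ident C (X x) else lzero C (X x) (X z))"
  using assms by (cases "c = 0"; cases "d = 0") (auto simp: entry_def mult.commute)

text \<open>
  Inserting the decomposition of the identity of \<open>S ys\<close> between the two factors gives matrix
  multiplication. The grading is essential here: otherwise paths through a summand of another
  degree would contribute to the product matrix but not to the composite.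
\<close>

lemma realize_cmp:
  assumes xs: "xs \<in> lists (carrier G)" and ys: "ys \<in> lists (carrier G)" and zs: "zs \<in> lists (carrier G)"
    and M: "graded_matrix xs ys M" and N: "graded_matrix ys zs N"
  shows "realize xs zs (N * M) = realize ys zs N \<diamondop> realize xs ys M"
proof (rule realize_eqI)
  note [simp] = xs ys zs
  fix i j assume i [simp]: "i < length zs" and j [simp]: "j < length xs"
  let ?e = "if xs ! j = zs ! i then ident C (X (xs ! j)) else lzero C (X (xs ! j)) (X (zs ! i))"
  have e: "?e \<in> Arr C" "Dom C ?e = X (xs ! j)" "Cod C ?e = X (zs ! i)" by auto
  have "\<pi> zs i \<diamondop> (realize ys zs N \<diamondop> realize xs ys M) \<diamondop> \<iota> xs j =
      (\<pi> zs i \<diamondop> realize ys zs N) \<diamondop> realize xs ys M \<diamondop> \<iota> xs j" by simp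
  also have "realize xs ys M \<diamondop> \<iota> xs j = hsum C (X (xs ! j)) (S ys)
      (\<lambda>k. \<iota> ys k \<diamondop> \<pi> ys k \<diamondop> realize xs ys M \<diamondop> \<iota> xs j) {..<length ys}"
    using biproduct_expand_left[OF linear_category_axioms S_biproduct[OF ys], of "realize xs ys M \<diamondop> \<iota> xs j"]
    by simp
  also have "(\<pi> zs i \<diamondop> realize ys zs N) \<diamondop> \<dots> = hsum C (X (xs ! j)) (X (zs ! i))
      (\<lambda>k. (\<pi> zs i \<diamondop> realize ys zs N) \<diamondop> \<iota> ys k \<diamondop> \<pi> ys k \<diamondop> realize xs ys M \<diamondop> \<iota> xs j) {..<length ys}"
    by (subst cmp_hsum) (auto simp: Hom_iff)
  also have "\<dots> = hsum C (Dom C ?e) (Cod C ?e) (\<lambda>k. lsmult C (N $$ (i, k) * M $$ (k, j)) ?e) {..<length ys}"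
    unfolding e
  proof (rule hsum_cong)
    fix k assume "k \<in> {..<length ys}"
    then have k [simp]: "k < length ys" by simp
    have "(\<pi> zs i \<diamondop> realize ys zs N) \<diamondop> \<iota> ys k \<diamondop> \<pi> ys k \<diamondop> realize xs ys M \<diamondop> \<iota> xs j =
        (\<pi> zs i \<diamondop> realize ys zs N \<diamondop> \<iota> ys k) \<diamondop> (\<pi> ys k \<diamondop> realize xs ys M \<diamondop> \<iota> xs j)" by simp
    also have "\<dots> = entry (ys ! k) (zs ! i) (N $$ (i, k)) \<diamondop> entry (xs ! j) (ys ! k) (M $$ (k, j))"
      by (simp only: realize_entry xs ys zs i j k)
    also have "\<dots> = lsmult C (N $$ (i, k) * M $$ (k, j)) ?e"
      by (rule entry_cmp) (use M N in \<open>auto simp: graded_matrix_def\<close>)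
    finally show "(\<pi> zs i \<diamondop> realize ys zs N) \<diamondop> \<iota> ys k \<diamondop> \<pi> ys k \<diamondop> realize xs ys M \<diamondop> \<iota> xs j =
        lsmult C (N $$ (i, k) * M $$ (k, j)) ?e" .
  qed (auto simp: Hom_iff)
  also have "\<dots> = lsmult C (\<Sum>k < length ys. N $$ (i, k) * M $$ (k, j)) ?e"
    by (rule hsum_lsmult) auto
  also have "(\<Sum>k < length ys. N $$ (i, k) * M $$ (k, j)) = (N * M) $$ (i, j)"
    using M N by (auto simp: graded_matrix_def scalar_prod_def atLeast0LessThan)
  also have "lsmult C ((N * M) $$ (i, j)) ?e = entry (xs ! j) (zs ! i) ((N * M) $$ (i, j))"
    by (auto simp: entry_def)
  finally show "\<pi> zs i \<diamondop> (realize ys zs N \<diamondop> realize xs ys M) \<diamondop> \<iota> xs j =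
      entry (xs ! j) (zs ! i) ((N * M) $$ (i, j))" .
qed (use xs ys zs in auto)

lemma realize_add:
  assumes xs: "xs \<in> lists (carrier G)" and ys: "ys \<in> lists (carrier G)"
    and M: "M \<in> carrier_mat (length ys) (length xs)" and N: "N \<in> carrier_mat (length ys) (length xs)"
  shows "realize xs ys (M + N) = ladd C (realize xs ys M) (realize xs ys N)"
proof -
  note [simp] = xs ys
  let ?s = "ladd C (realize xs ys M) (realize xs ys N)"
  have H: "realize xs ys M \<in> Hom C (S xs) (S ys)" "realize xs ys N \<in> Hom C (S xs) (S ys)"
    by (auto simp: Hom_iff)
  have s [simp]: "?s \<in> Arr C" "Dom C ?s = S xs" "Cod C ?s = S ys"
    using ladd_Hom[OF H] by (auto simp: Hom_iff)
  show ?thesis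
  proof (rule realize_eqI)
    fix i j assume [simp]: "i < length ys" "j < length xs"
    have "?s \<diamondop> \<iota> xs j = ladd C (realize xs ys M \<diamondop> \<iota> xs j) (realize xs ys N \<diamondop> \<iota> xs j)"
      by (rule cmp_ladd_left[of _ "X (xs ! j)" "S xs" _ "S ys"]) (auto simp: Hom_iff)
    also have "\<pi> ys i \<diamondop> \<dots> = ladd C (\<pi> ys i \<diamondop> realize xs ys M \<diamondop> \<iota> xs j) (\<pi> ys i \<diamondop> realize xs ys N \<diamondop> \<iota> xs j)"
      by (rule cmp_ladd_right[of _ "X (xs ! j)" "S ys" _ _ "X (ys ! i)"]) (auto simp: Hom_iff)
    also have "\<dots> = ladd C (entry (xs ! j) (ys ! i) (M $$ (i, j))) (entry (xs ! j) (ys ! i) (N $$ (i, j)))"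
      by (simp add: realize_entry)
    also have "\<dots> = entry (xs ! j) (ys ! i) ((M + N) $$ (i, j))"
      using M N lsmult_add[of "lzero C (X (xs ! j)) (X (ys ! i))" 0 0] by (simp add: entry_def lsmult_add)
    finally show "\<pi> ys i \<diamondop> ?s \<diamondop> \<iota> xs j = entry (xs ! j) (ys ! i) ((M + N) $$ (i, j))" .
  qed auto
qed

lemma realize_smult:
  assumes "xs \<in> lists (carrier G)" "ys \<in> lists (carrier G)"
    and "M \<in> carrier_mat (length ys) (length xs)"
  shows "realize xs ys (c \<cdot>\<^sub>m M) = lsmult C c (realize xs ys M)"
  by (rule realize_eqI) (use assms in \<open>auto simp: realize_entry entry_def\<close>)

lemma realize_zero:
  assumes "xs \<in> lists (carrier G)" "ys \<in> lists (carrier G)"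
  shows "realize xs ys (0\<^sub>m (length ys) (length xs)) = lzero C (S xs) (S ys)"
  by (rule realize_eqI) (use assms in \<open>auto simp: entry_def\<close>)

lemma realize_diagonal:
  assumes xs: "xs \<in> lists (carrier G)" and n: "n = length xs" and j: "j < n"
  shows "realize xs xs (mat n n (\<lambda>(i, j). if i = j then d i else 0)) \<diamondop> \<iota> xs j = lsmult C (d j) (\<iota> xs j)"
    (is "?R \<diamondop> _ = _")
proof (rule biproduct_joint_mono[OF linear_category_axioms S_biproduct[OF xs]])
  fix i assume "i < length (map X xs)"
  then have i: "i < length xs" by simp
  have "\<pi> xs i \<diamondop> ?R \<diamondop> \<iota> xs j = entry (xs ! j) (xs ! i) (if i = j then d i else 0)"
    using realize_entry[OF xs xs i, of j] i j n by simp
  then show "\<pi> xs i \<diamondop> ?R \<diamondop> \<iota> xs j = \<pi> xs i \<diamondop> lsmult C (d j) (\<iota> xs j)"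
    using i j n xs by (cases "i = j") (auto simp: entry_def)
qed (use xs n j in auto)

text \<open>
  The structure isomorphism \<open>S xs \<otimes> S ys \<rightarrow> S (xs \<otimes> ys)\<close> is \<open>\<mu>\<close> on each pair of summands. It is
  defined by its components after projections; being diagonal, it has an equally simple
  description before inclusions (\<open>realize_mult_\<iota>\<close>).
\<close>

definition realize_mult :: "'g list \<Rightarrow> 'g list \<Rightarrow> 'm" where
  "realize_mult xs ys = (SOME u. u \<in> Hom C (tobj C (S xs) (S ys)) (S (graded_tensor G xs ys)) \<and>
    (\<forall>k < length xs * length ys. \<pi> (graded_tensor G xs ys) k \<diamondop> u =
      \<mu> (xs ! (k div length ys)) (ys ! (k mod length ys)) \<diamondop>
        tarr C (\<pi> xs (k div length ys)) (\<pi> ys (k mod length ys))))"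

context
  fixes xs ys
  assumes xs [simp]: "xs \<in> lists (carrier G)" and ys [simp]: "ys \<in> lists (carrier G)"
begin

private lemma zs [simp]: "graded_tensor G xs ys \<in> lists (carrier G)"
  by (rule G.graded_tensor_lists) auto

lemma realize_mult:
  "realize_mult xs ys \<in> Hom C (tobj C (S xs) (S ys)) (S (graded_tensor G xs ys)) \<and>
    (\<forall>k < length xs * length ys. \<pi> (graded_tensor G xs ys) k \<diamondop> realize_mult xs ys =
      \<mu> (xs ! (k div length ys)) (ys ! (k mod length ys)) \<diamondop>
        tarr C (\<pi> xs (k div length ys)) (\<pi> ys (k mod length ys)))"
  unfolding realize_mult_def
proof (rule someI_ex)
  let ?g = "\<lambda>k. \<mu> (xs ! (k div length ys)) (ys ! (k mod length ys)) \<diamondop>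
        tarr C (\<pi> xs (k div length ys)) (\<pi> ys (k mod length ys))"
  have g: "?g k \<in> Hom C (tobj C (S xs) (S ys)) (map X (graded_tensor G xs ys) ! k)"
    if "k < length (map X (graded_tensor G xs ys))" for k
    using that graded_tensor_index[of k xs ys] by (simp add: Hom_iff graded_tensor_nth_div_mod)
  obtain u where "u \<in> Hom C (tobj C (S xs) (S ys)) (S (graded_tensor G xs ys))"
    "\<And>k. k < length (map X (graded_tensor G xs ys)) \<Longrightarrow> \<pi> (graded_tensor G xs ys) k \<diamondop> u = ?g k"
    by (rule biproduct_tuple[OF linear_category_axioms S_biproduct[OF zs], of _ ?g]) (use g in auto)
  then show "\<exists>u. u \<in> Hom C (tobj C (S xs) (S ys)) (S (graded_tensor G xs ys)) \<and>
    (\<forall>k < length xs * length ys. \<pi> (graded_tensor G xs ys) k \<diamondop> u = ?g k)"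
    by auto
qed

lemma realize_mult_simps [simp]:
  "realize_mult xs ys \<in> Arr C" "Dom C (realize_mult xs ys) = tobj C (S xs) (S ys)"
  "Cod C (realize_mult xs ys) = S (graded_tensor G xs ys)"
  using realize_mult by (auto simp: Hom_iff)

lemma \<pi>_realize_mult:
  assumes "i < length xs" "j < length ys"
  shows "\<pi> (graded_tensor G xs ys) (i * length ys + j) \<diamondop> realize_mult xs ys =
    \<mu> (xs ! i) (ys ! j) \<diamondop> tarr C (\<pi> xs i) (\<pi> ys j)"
  using realize_mult mult_add_less[OF assms] assms by simp

lemma realize_mult_\<iota>:
  assumes i: "i < length xs" and j: "j < length ys"
  shows "realize_mult xs ys \<diamondop> tarr C (\<iota> xs i) (\<iota> ys j) =
    \<iota> (graded_tensor G xs ys) (i * length ys + j) \<diamondop> \<mu> (xs ! i) (ys ! j)"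
proof (rule biproduct_joint_mono[OF linear_category_axioms S_biproduct[OF zs]])
  let ?l = "i * length ys + j"
  have l: "?l < length xs * length ys" using i j mult_add_less by blast
  have nl: "graded_tensor G xs ys ! ?l = xs ! i \<otimes>\<^bsub>G\<^esub> ys ! j" using i j graded_tensor_nth by blast
  fix k assume "k < length (map X (graded_tensor G xs ys))"
  then have k: "k < length xs * length ys" by simp
  let ?i = "k div length ys" and ?j = "k mod length ys"
  have ij: "?i < length xs" "?j < length ys" using graded_tensor_index[OF k] by auto
  have nk: "graded_tensor G xs ys ! k = xs ! ?i \<otimes>\<^bsub>G\<^esub> ys ! ?j" using k graded_tensor_nth_div_mod by blast
  have "\<pi> (graded_tensor G xs ys) k \<diamondop> realize_mult xs ys \<diamondop> tarr C (\<iota> xs i) (\<iota> ys j) =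
      (\<pi> (graded_tensor G xs ys) k \<diamondop> realize_mult xs ys) \<diamondop> tarr C (\<iota> xs i) (\<iota> ys j)"
    using i j k by simp
  also have "\<dots> = \<mu> (xs ! ?i) (ys ! ?j) \<diamondop> tarr C (\<pi> xs ?i \<diamondop> \<iota> xs i) (\<pi> ys ?j \<diamondop> \<iota> ys j)"
    using \<pi>_realize_mult[OF ij] ij i j by simp
  also have "\<dots> = \<pi> (graded_tensor G xs ys) k \<diamondop> \<iota> (graded_tensor G xs ys) ?l \<diamondop> \<mu> (xs ! i) (ys ! j)"
  proof (cases "k = ?l")
    case True
    then have "?i = i" "?j = j" using j by auto
    then show ?thesis using True i j l nl by simp
  next
    case False
    then have "?i \<noteq> i \<or> ?j \<noteq> j" using div_mult_mod_eq[of k "length ys"] by auto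
    then show ?thesis using False i j k l ij nl nk by auto
  qed
  finally show "\<pi> (graded_tensor G xs ys) k \<diamondop> realize_mult xs ys \<diamondop> tarr C (\<iota> xs i) (\<iota> ys j) =
      \<pi> (graded_tensor G xs ys) k \<diamondop> \<iota> (graded_tensor G xs ys) ?l \<diamondop> \<mu> (xs ! i) (ys ! j)" .
qed (use i j mult_add_less[OF i j] graded_tensor_nth[OF i j, of G] in auto)

lemma is_iso_realize_mult [simp]: "is_iso C (realize_mult xs ys)"
proof -
  let ?zs = "graded_tensor G xs ys"
  let ?g = "\<lambda>k. tarr C (\<iota> xs (k div length ys)) (\<iota> ys (k mod length ys)) \<diamondop>
      arr_inv C (\<mu> (xs ! (k div length ys)) (ys ! (k mod length ys)))"
  have g: "?g k \<in> Hom C (map X ?zs ! k) (tobj C (S xs) (S ys))" if "k < length (map X ?zs)" for k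
    using that graded_tensor_index[of k xs ys] by (simp add: Hom_iff graded_tensor_nth_div_mod)
  obtain v where v: "v \<in> Hom C (S ?zs) (tobj C (S xs) (S ys))"
    "\<And>k. k < length (map X ?zs) \<Longrightarrow> v \<diamondop> \<iota> ?zs k = ?g k"
    by (rule biproduct_cotuple[OF linear_category_axioms S_biproduct[OF zs], of _ ?g]) (use g in auto)
  have [simp]: "v \<in> Arr C" "Dom C v = S ?zs" "Cod C v = tobj C (S xs) (S ys)"
    using v by (auto simp: Hom_iff)
  have "v \<diamondop> realize_mult xs ys = ident C (tobj C (S xs) (S ys))"
  proof (rule biproduct_tensor_joint_epi[OF S_biproduct[OF xs] S_biproduct[OF ys]])
    fix i j assume "i < length (map X xs)" "j < length (map X ys)"
    then have ij: "i < length xs" "j < length ys" by auto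
    note n = mult_add_less[OF ij] graded_tensor_nth[OF ij, of G]
    have v': "v \<diamondop> \<iota> ?zs (i * length ys + j) = tarr C (\<iota> xs i) (\<iota> ys j) \<diamondop> arr_inv C (\<mu> (xs ! i) (ys ! j))"
      using v(2)[of "i * length ys + j"] n ij by simp
    have "(v \<diamondop> realize_mult xs ys) \<diamondop> tarr C (\<iota> xs i) (\<iota> ys j) =
        v \<diamondop> \<iota> ?zs (i * length ys + j) \<diamondop> \<mu> (xs ! i) (ys ! j)"
      using ij by (simp add: realize_mult_\<iota>)
    also have "\<dots> = tarr C (\<iota> xs i) (\<iota> ys j)"
      using ij n by (simp add: cmp_reassoc[OF v'])
    finally show "(v \<diamondop> realize_mult xs ys) \<diamondop> tarr C (\<iota> xs i) (\<iota> ys j) =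
        ident C (tobj C (S xs) (S ys)) \<diamondop> tarr C (\<iota> xs i) (\<iota> ys j)" using ij by simp
  qed auto
  moreover have "realize_mult xs ys \<diamondop> v = ident C (S ?zs)"
  proof (rule biproduct_joint_epi[OF linear_category_axioms S_biproduct[OF zs]])
    fix k assume "k < length (map X ?zs)"
    then have k: "k < length xs * length ys" by simp
    note ij = graded_tensor_index[OF k]
    have "(realize_mult xs ys \<diamondop> v) \<diamondop> \<iota> ?zs k = realize_mult xs ys \<diamondop> ?g k"
      using k v(2)[of k] by simp
    also have "\<dots> = (realize_mult xs ys \<diamondop> tarr C (\<iota> xs (k div length ys)) (\<iota> ys (k mod length ys))) \<diamondop>
      arr_inv C (\<mu> (xs ! (k div length ys)) (ys ! (k mod length ys)))"
      using ij by simp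
    also have "\<dots> = \<iota> ?zs k"
      using ij k realize_mult_\<iota>[OF ij] graded_tensor_nth_div_mod[OF k, of G] by simp
    finally show "(realize_mult xs ys \<diamondop> v) \<diamondop> \<iota> ?zs k = ident C (S ?zs) \<diamondop> \<iota> ?zs k" using k by simp
  qed auto
  ultimately show ?thesis by (intro is_isoI(1)[of _ v]) auto
qed

end

lemma realize_mult_\<iota>_reassoc:
  assumes "xs \<in> lists (carrier G)" "ys \<in> lists (carrier G)" "i < length xs" "j < length ys"
    "f \<in> Arr C" "g \<in> Arr C" "Cod C f = X (xs ! i)" "Cod C g = X (ys ! j)"
  shows "realize_mult xs ys \<diamondop> tarr C (\<iota> xs i \<diamondop> f) (\<iota> ys j \<diamondop> g) =
    \<iota> (graded_tensor G xs ys) (i * length ys + j) \<diamondop> \<mu> (xs ! i) (ys ! j) \<diamondop> tarr C f g"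
proof -
  note n = mult_add_less[OF assms(3,4)] graded_tensor_nth[OF assms(3,4), of G]
    G.graded_tensor_lists[OF assms(1,2)]
  have "realize_mult xs ys \<diamondop> tarr C (\<iota> xs i \<diamondop> f) (\<iota> ys j \<diamondop> g) =
      realize_mult xs ys \<diamondop> tarr C (\<iota> xs i) (\<iota> ys j) \<diamondop> tarr C f g"
    using assms by simp
  also have "\<dots> = (\<iota> (graded_tensor G xs ys) (i * length ys + j) \<diamondop> \<mu> (xs ! i) (ys ! j)) \<diamondop> tarr C f g"
    using assms n by (intro cmp_reassoc realize_mult_\<iota>) auto
  finally show ?thesis using assms n by simp
qed

lemma realize_mult_natural:
  assumes xs: "xs \<in> lists (carrier G)" "xs' \<in> lists (carrier G)" and ys: "ys \<in> lists (carrier G)" "ys' \<in> lists (carrier G)"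
    and M: "graded_matrix xs xs' M" and N: "graded_matrix ys ys' N"
  shows "realize_mult xs' ys' \<diamondop> tarr C (realize xs xs' M) (realize ys ys' N) =
    realize (graded_tensor G xs ys) (graded_tensor G xs' ys') (kronecker M N) \<diamondop> realize_mult xs ys"
proof (rule biproduct_tensor_joint_epi[OF S_biproduct[OF xs(1)] S_biproduct[OF ys(1)]])
  note [simp] = xs ys G.graded_tensor_lists
  let ?zs = "graded_tensor G xs ys" and ?zs' = "graded_tensor G xs' ys'"
  fix j l assume "j < length (map X xs)" "l < length (map X ys)"
  then have jl [simp]: "j < length xs" "l < length ys" by auto
  note njl [simp] = mult_add_less[OF jl] graded_tensor_nth[OF jl, of G]
  show "(realize_mult xs' ys' \<diamondop> tarr C (realize xs xs' M) (realize ys ys' N)) \<diamondop> tarr C (\<iota> xs j) (\<iota> ys l) =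
    (realize ?zs ?zs' (kronecker M N) \<diamondop> realize_mult xs ys) \<diamondop> tarr C (\<iota> xs j) (\<iota> ys l)"
  proof (rule biproduct_joint_mono[OF linear_category_axioms S_biproduct[of ?zs']])
    fix k assume "k < length (map X ?zs')"
    then have k [simp]: "k < length xs' * length ys'" by simp
    let ?i = "k div length ys'" and ?i' = "k mod length ys'"
    note ii [simp] = graded_tensor_index[OF k]
    have nk [simp]: "?zs' ! k = xs' ! ?i \<otimes>\<^bsub>G\<^esub> ys' ! ?i'" using k graded_tensor_nth_div_mod by blast
    have K: "kronecker M N $$ (k, j * length ys + l) = M $$ (?i, j) * N $$ (?i', l)"
      using kronecker_index[of M "length xs'" "length xs" N "length ys'" "length ys" ?i j ?i' l] M N
      by (simp add: graded_matrix_def)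
    have p: "\<pi> ?zs' k \<diamondop> realize_mult xs' ys' = \<mu> (xs' ! ?i) (ys' ! ?i') \<diamondop> tarr C (\<pi> xs' ?i) (\<pi> ys' ?i')"
      using \<pi>_realize_mult[OF xs(2) ys(2) ii] by simp
    have "\<pi> ?zs' k \<diamondop> (realize_mult xs' ys' \<diamondop> tarr C (realize xs xs' M) (realize ys ys' N)) \<diamondop> tarr C (\<iota> xs j) (\<iota> ys l) =
        \<mu> (xs' ! ?i) (ys' ! ?i') \<diamondop>
          tarr C (\<pi> xs' ?i \<diamondop> realize xs xs' M \<diamondop> \<iota> xs j) (\<pi> ys' ?i' \<diamondop> realize ys ys' N \<diamondop> \<iota> ys l)"
      by (simp add: cmp_reassoc[OF p])
    also have "\<dots> = \<mu> (xs' ! ?i) (ys' ! ?i') \<diamondop>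
          tarr C (entry (xs ! j) (xs' ! ?i) (M $$ (?i, j))) (entry (ys ! l) (ys' ! ?i') (N $$ (?i', l)))"
      by (simp add: realize_entry)
    also have "\<dots> = entry (xs ! j \<otimes>\<^bsub>G\<^esub> ys ! l) (xs' ! ?i \<otimes>\<^bsub>G\<^esub> ys' ! ?i') (M $$ (?i, j) * N $$ (?i', l)) \<diamondop>
        \<mu> (xs ! j) (ys ! l)"
    proof (cases "xs ! j = xs' ! ?i \<and> ys ! l = ys' ! ?i'")
      case True
      then show ?thesis
        using nth_carrier[OF xs(1) jl(1)] nth_carrier[OF ys(1) jl(2)] by (auto simp: entry_def mult.commute)
    next
      case False
      then have "M $$ (?i, j) * N $$ (?i', l) = 0"
        using M N jl ii unfolding graded_matrix_def by (metis mult_eq_0_iff)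
      then show ?thesis using False by (auto simp: entry_def)
    qed
    also have "\<dots> = (\<pi> ?zs' k \<diamondop> realize ?zs ?zs' (kronecker M N) \<diamondop> \<iota> ?zs (j * length ys + l)) \<diamondop> \<mu> (xs ! j) (ys ! l)"
      by (subst realize_entry) (simp_all add: K)
    also have "\<dots> = \<pi> ?zs' k \<diamondop> (realize ?zs ?zs' (kronecker M N) \<diamondop> realize_mult xs ys) \<diamondop> tarr C (\<iota> xs j) (\<iota> ys l)"
      by (simp add: realize_mult_\<iota>)
    finally show "\<pi> ?zs' k \<diamondop> (realize_mult xs' ys' \<diamondop> tarr C (realize xs xs' M) (realize ys ys' N)) \<diamondop> tarr C (\<iota> xs j) (\<iota> ys l) =
      \<pi> ?zs' k \<diamondop> (realize ?zs ?zs' (kronecker M N) \<diamondop> realize_mult xs ys) \<diamondop> tarr C (\<iota> xs j) (\<iota> ys l)" .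
  qed auto
qed (use xs ys G.graded_tensor_lists in auto)

text \<open>
  On a triple of summands this is the associativity of \<open>\<mu>\<close>. The lists \<open>(xs \<otimes> ys) \<otimes> zs\<close> and
  \<open>xs \<otimes> (ys \<otimes> zs)\<close> are equal, and a triple of positions has the same position in both, so \<open>A\<close>
  acts on the summand by the scalar \<open>a\<close>.
\<close>

lemma realize_mult_assoc:
  assumes xs: "xs \<in> lists (carrier G)" and ys: "ys \<in> lists (carrier G)" and zs: "zs \<in> lists (carrier G)"
    and A: "graded_assoc G a xs ys zs = (vs, vs', A)"
  shows "realize vs vs' A \<diamondop> realize_mult (graded_tensor G xs ys) zs \<diamondop> tarr C (realize_mult xs ys) (ident C (S zs)) =
    realize_mult xs (graded_tensor G ys zs) \<diamondop> tarr C (ident C (S xs)) (realize_mult ys zs) \<diamondop>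
      assoc C (S xs) (S ys) (S zs)"
proof -
  note [simp] = xs ys zs G.graded_tensor_lists
  let ?n = "length xs * length ys * length zs"
  let ?d = "\<lambda>i. a (xs ! (i div (length ys * length zs)), ys ! (i div length zs mod length ys), zs ! (i mod length zs))"
  have vs: "vs = graded_tensor G (graded_tensor G xs ys) zs" "vs' = vs"
    and A': "A = mat ?n ?n (\<lambda>(i, j). if i = j then ?d i else 0)"
    using A G.graded_tensor_assoc[OF xs ys zs] by (auto simp: graded_assoc_def Let_def)
  have vsL [simp]: "vs \<in> lists (carrier G)" and vsn: "?n = length vs" by (auto simp: vs)
  have vs2: "graded_tensor G xs (graded_tensor G ys zs) = vs"
    using G.graded_tensor_assoc[OF xs ys zs] by (simp add: vs)
  show ?thesis
  proof (rule biproduct_tensor3_joint_epi[OF S_biproduct[OF xs] S_biproduct[OF ys] S_biproduct[OF zs]])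
    fix i j k assume "i < length (map X xs)" "j < length (map X ys)" "k < length (map X zs)"
    then have i [simp]: "i < length xs" and j [simp]: "j < length ys" and k [simp]: "k < length zs" by auto
    let ?l = "(i * length ys + j) * length zs + k"
    have ij [simp]: "i * length ys + j < length xs * length ys" and jk [simp]: "j * length zs + k < length ys * length zs"
      using mult_add_less i j k by blast+
    have l [simp]: "?l < length xs * length ys * length zs"
      using mult_add_less[OF ij k] .
    have l2: "i * (length ys * length zs) + (j * length zs + k) = ?l" by (simp add: algebra_simps)
    have "?l div (length ys * length zs) = i"
      using mult_add_div[OF jk, of i] unfolding l2 .
    moreover have "?l div length zs mod length ys = j" "?l mod length zs = k" by auto
    ultimately have d: "?d ?l = a (xs ! i, ys ! j, zs ! k)" by simp
    have nij: "graded_tensor G xs ys ! (i * length ys + j) = xs ! i \<otimes>\<^bsub>G\<^esub> ys ! j"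
      and njk: "graded_tensor G ys zs ! (j * length zs + k) = ys ! j \<otimes>\<^bsub>G\<^esub> zs ! k"
      using graded_tensor_nth i j k by blast+
    have nl: "vs ! ?l = xs ! i \<otimes>\<^bsub>G\<^esub> ys ! j \<otimes>\<^bsub>G\<^esub> zs ! k"
      using graded_tensor_nth[of "i * length ys + j" "graded_tensor G xs ys" k zs G] nij by (simp add: vs)
    note [simp] = nij njk nl vsn[symmetric]
    let ?t = "tarr C (tarr C (\<iota> xs i) (\<iota> ys j)) (\<iota> zs k)"
    have m1: "realize_mult (graded_tensor G xs ys) zs \<diamondop> tarr C (\<iota> (graded_tensor G xs ys) (i * length ys + j) \<diamondop> \<mu> (xs ! i) (ys ! j)) (\<iota> zs k) =
        \<iota> vs ?l \<diamondop> \<mu> (xs ! i \<otimes>\<^bsub>G\<^esub> ys ! j) (zs ! k) \<diamondop> tarr C (\<mu> (xs ! i) (ys ! j)) (ident C (X (zs ! k)))"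
      using realize_mult_\<iota>_reassoc[of "graded_tensor G xs ys" zs "i * length ys + j" k "\<mu> (xs ! i) (ys ! j)" "ident C (X (zs ! k))"]
      by (simp add: vs(1))
    have D: "realize vs vs' A \<diamondop> \<iota> vs ?l = lsmult C (a (xs ! i, ys ! j, zs ! k)) (\<iota> vs ?l)"
      using realize_diagonal[OF vsL vsn l, of ?d] unfolding A' vs(2) d .
    have [simp]: "realize vs vs' A \<in> Arr C" "Dom C (realize vs vs' A) = S vs" "Cod C (realize vs vs' A) = S vs"
      by (simp_all add: vs(2))
    have [simp]: "Cod C (realize_mult (graded_tensor G xs ys) zs) = S vs"
      "Cod C (realize_mult xs (graded_tensor G ys zs)) = S vs"
      using vs2 by (simp_all add: vs(1))
    have "(realize vs vs' A \<diamondop> realize_mult (graded_tensor G xs ys) zs \<diamondop> tarr C (realize_mult xs ys) (ident C (S zs))) \<diamondop> ?t =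
        realize vs vs' A \<diamondop> \<iota> vs ?l \<diamondop> \<mu> (xs ! i \<otimes>\<^bsub>G\<^esub> ys ! j) (zs ! k) \<diamondop> tarr C (\<mu> (xs ! i) (ys ! j)) (ident C (X (zs ! k)))"
      by (simp add: realize_mult_\<iota> m1)
    also have "\<dots> = lsmult C (a (xs ! i, ys ! j, zs ! k)) (\<iota> vs ?l \<diamondop> \<mu> (xs ! i \<otimes>\<^bsub>G\<^esub> ys ! j) (zs ! k) \<diamondop>
        tarr C (\<mu> (xs ! i) (ys ! j)) (ident C (X (zs ! k))))"
      by (subst cmp_reassoc[OF D]) auto
    also have "\<dots> = \<iota> vs ?l \<diamondop> \<mu> (xs ! i) (ys ! j \<otimes>\<^bsub>G\<^esub> zs ! k) \<diamondop> tarr C (ident C (X (xs ! i))) (\<mu> (ys ! j) (zs ! k)) \<diamondop>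
        assoc C (X (xs ! i)) (X (ys ! j)) (X (zs ! k))"
      by (simp add: \<mu>_assoc)
    also have "\<dots> = (\<iota> vs ?l \<diamondop> \<mu> (xs ! i) (ys ! j \<otimes>\<^bsub>G\<^esub> zs ! k) \<diamondop> tarr C (ident C (X (xs ! i))) (\<mu> (ys ! j) (zs ! k))) \<diamondop>
        assoc C (X (xs ! i)) (X (ys ! j)) (X (zs ! k))"
      by (simp add: G.m_assoc)
    also have "\<iota> vs ?l \<diamondop> \<mu> (xs ! i) (ys ! j \<otimes>\<^bsub>G\<^esub> zs ! k) \<diamondop> tarr C (ident C (X (xs ! i))) (\<mu> (ys ! j) (zs ! k)) =
        realize_mult xs (graded_tensor G ys zs) \<diamondop>
          tarr C (\<iota> xs i) (\<iota> (graded_tensor G ys zs) (j * length zs + k) \<diamondop> \<mu> (ys ! j) (zs ! k))"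
      using realize_mult_\<iota>_reassoc[of xs "graded_tensor G ys zs" i "j * length zs + k" "ident C (X (xs ! i))" "\<mu> (ys ! j) (zs ! k)"]
      by (simp add: vs2 l2)
    also have "\<dots> = realize_mult xs (graded_tensor G ys zs) \<diamondop> tarr C (ident C (S xs)) (realize_mult ys zs) \<diamondop>
          tarr C (\<iota> xs i) (tarr C (\<iota> ys j) (\<iota> zs k))"
      by (simp add: realize_mult_\<iota>)
    also have "(realize_mult xs (graded_tensor G ys zs) \<diamondop> tarr C (ident C (S xs)) (realize_mult ys zs) \<diamondop>
          tarr C (\<iota> xs i) (tarr C (\<iota> ys j) (\<iota> zs k))) \<diamondop> assoc C (X (xs ! i)) (X (ys ! j)) (X (zs ! k)) =
        (realize_mult xs (graded_tensor G ys zs) \<diamondop> tarr C (ident C (S xs)) (realize_mult ys zs) \<diamondop>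
          assoc C (S xs) (S ys) (S zs)) \<diamondop> ?t"
      using assoc_natural'[of "\<iota> xs i" "\<iota> ys j" "\<iota> zs k"] by (simp del: tarr_cmp' tarr_cmp_reassoc)
    finally show "(realize vs vs' A \<diamondop> realize_mult (graded_tensor G xs ys) zs \<diamondop> tarr C (realize_mult xs ys) (ident C (S zs))) \<diamondop> ?t =
        (realize_mult xs (graded_tensor G ys zs) \<diamondop> tarr C (ident C (S xs)) (realize_mult ys zs) \<diamondop>
          assoc C (S xs) (S ys) (S zs)) \<diamondop> ?t" .
  qed (use vs vs2 in auto)
qed

definition realize_unit :: 'm where
  "realize_unit = \<iota> [\<one>\<^bsub>G\<^esub>] 0 \<diamondop> \<nu>"

lemma realize_unit_simps [simp]:
  "realize_unit \<in> Arr C" "Dom C realize_unit = tunit C" "Cod C realize_unit = S [\<one>\<^bsub>G\<^esub>]"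
  "is_iso C realize_unit"
proof -
  have [simp]: "[\<one>\<^bsub>G\<^esub>] \<in> lists (carrier G)" by simp
  have i: "\<iota> [\<one>\<^bsub>G\<^esub>] 0 \<in> Arr C" "Dom C (\<iota> [\<one>\<^bsub>G\<^esub>] 0) = X \<one>\<^bsub>G\<^esub>" "Cod C (\<iota> [\<one>\<^bsub>G\<^esub>] 0) = S [\<one>\<^bsub>G\<^esub>]"
    "\<pi> [\<one>\<^bsub>G\<^esub>] 0 \<in> Arr C" "Dom C (\<pi> [\<one>\<^bsub>G\<^esub>] 0) = S [\<one>\<^bsub>G\<^esub>]" "Cod C (\<pi> [\<one>\<^bsub>G\<^esub>] 0) = X \<one>\<^bsub>G\<^esub>"
    "\<pi> [\<one>\<^bsub>G\<^esub>] 0 \<diamondop> \<iota> [\<one>\<^bsub>G\<^esub>] 0 = ident C (X \<one>\<^bsub>G\<^esub>)"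
    using \<iota>_simps[of "[\<one>\<^bsub>G\<^esub>]" 0] by simp_all
  have "\<iota> [\<one>\<^bsub>G\<^esub>] 0 \<diamondop> \<pi> [\<one>\<^bsub>G\<^esub>] 0 = ident C (S [\<one>\<^bsub>G\<^esub>])"
    by (rule biproduct_joint_epi[OF linear_category_axioms S_biproduct[of "[\<one>\<^bsub>G\<^esub>]"]]) (use i in auto)
  then have "is_iso C (\<iota> [\<one>\<^bsub>G\<^esub>] 0)"
    using i by (intro is_isoI(1)[of _ "\<pi> [\<one>\<^bsub>G\<^esub>] 0"]) auto
  then show "realize_unit \<in> Arr C" "Dom C realize_unit = tunit C" "Cod C realize_unit = S [\<one>\<^bsub>G\<^esub>]"
    "is_iso C realize_unit"
    using i by (simp_all add: realize_unit_def)
qed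

lemma realize_units:
  assumes xs: "xs \<in> lists (carrier G)"
  shows "realize_mult [\<one>\<^bsub>G\<^esub>] xs \<diamondop> tarr C realize_unit (ident C (S xs)) = lunit C (S xs)"
    "realize_mult xs [\<one>\<^bsub>G\<^esub>] \<diamondop> tarr C (ident C (S xs)) realize_unit = runit C (S xs)"
proof -
  note [simp] = xs
  have one [simp]: "[\<one>\<^bsub>G\<^esub>] \<in> lists (carrier G)" "0 < length [\<one>\<^bsub>G\<^esub>]" by simp_all
  have lr [simp]: "Cod C (realize_mult [\<one>\<^bsub>G\<^esub>] xs) = S xs" "Cod C (realize_mult xs [\<one>\<^bsub>G\<^esub>]) = S xs"
    using G.graded_tensor_units[OF xs] realize_mult_simps(3)[OF one(1) xs] realize_mult_simps(3)[OF xs one(1)]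
    by simp_all
  note epi = splitting_joint_epi[OF splitting_tarr(2)[OF biproduct_splitting[OF linear_category_axioms S_biproduct[OF xs]], of "tunit C"]]
    splitting_joint_epi[OF splitting_tarr(1)[OF biproduct_splitting[OF linear_category_axioms S_biproduct[OF xs]], of "tunit C"]]
  show "realize_mult [\<one>\<^bsub>G\<^esub>] xs \<diamondop> tarr C realize_unit (ident C (S xs)) = lunit C (S xs)"
  proof (rule epi(1))
    fix i assume "i < length (map X xs)"
    then have i [simp]: "i < length xs" by simp
    have "(realize_mult [\<one>\<^bsub>G\<^esub>] xs \<diamondop> tarr C realize_unit (ident C (S xs))) \<diamondop> tarr C (ident C (tunit C)) (\<iota> xs i) =
        realize_mult [\<one>\<^bsub>G\<^esub>] xs \<diamondop> tarr C (\<iota> [\<one>\<^bsub>G\<^esub>] 0 \<diamondop> \<nu>) (\<iota> xs i)"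
      by (simp add: realize_unit_def[symmetric])
    also have "\<dots> = \<iota> xs i \<diamondop> \<mu> \<one>\<^bsub>G\<^esub> (xs ! i) \<diamondop> tarr C \<nu> (ident C (X (xs ! i)))"
      using realize_mult_\<iota>_reassoc[OF one(1) xs one(2) i, of \<nu> "ident C (X (xs ! i))"]
        G.graded_tensor_units[OF xs] by simp
    also have "\<dots> = lunit C (S xs) \<diamondop> tarr C (ident C (tunit C)) (\<iota> xs i)"
      using lunit_natural'[of "\<iota> xs i"] by (simp add: \<mu>_unit_left)
    finally show "(realize_mult [\<one>\<^bsub>G\<^esub>] xs \<diamondop> tarr C realize_unit (ident C (S xs))) \<diamondop> tarr C (ident C (tunit C)) (\<iota> xs i) =
        lunit C (S xs) \<diamondop> tarr C (ident C (tunit C)) (\<iota> xs i)" .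
  qed auto
  show "realize_mult xs [\<one>\<^bsub>G\<^esub>] \<diamondop> tarr C (ident C (S xs)) realize_unit = runit C (S xs)"
  proof (rule epi(2))
    fix i assume "i < length (map X xs)"
    then have i [simp]: "i < length xs" by simp
    have "(realize_mult xs [\<one>\<^bsub>G\<^esub>] \<diamondop> tarr C (ident C (S xs)) realize_unit) \<diamondop> tarr C (\<iota> xs i) (ident C (tunit C)) =
        realize_mult xs [\<one>\<^bsub>G\<^esub>] \<diamondop> tarr C (\<iota> xs i) (\<iota> [\<one>\<^bsub>G\<^esub>] 0 \<diamondop> \<nu>)"
      by (simp add: realize_unit_def[symmetric])
    also have "\<dots> = \<iota> xs i \<diamondop> \<mu> (xs ! i) \<one>\<^bsub>G\<^esub> \<diamondop> tarr C (ident C (X (xs ! i))) \<nu>"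
      using realize_mult_\<iota>_reassoc[OF xs one(1) i one(2), of "ident C (X (xs ! i))" \<nu>]
        G.graded_tensor_units[OF xs] by simp
    also have "\<dots> = runit C (S xs) \<diamondop> tarr C (\<iota> xs i) (ident C (tunit C))"
      using runit_natural'[of "\<iota> xs i"] by (simp add: \<mu>_unit_right)
    finally show "(realize_mult xs [\<one>\<^bsub>G\<^esub>] \<diamondop> tarr C (ident C (S xs)) realize_unit) \<diamondop> tarr C (\<iota> xs i) (ident C (tunit C)) =
        runit C (S xs) \<diamondop> tarr C (\<iota> xs i) (ident C (tunit C))" .
  qed auto
qed

definition realization_functor :: "('g list, ('g, 'k) graded_arrow, 'o, 'm) tensor_functor_data" where
  "realization_functor = \<lparr>fobj = S, farr = (\<lambda>(xs, ys, M). realize xs ys M),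
    fmult = realize_mult, funit = realize_unit\<rparr>"

lemma realization_functor_simps [simp]:
  "fobj realization_functor = S" "farr realization_functor (xs, ys, M) = realize xs ys M"
  "fmult realization_functor = realize_mult" "funit realization_functor = realize_unit"
  by (simp_all add: realization_functor_def)

lemma is_functor_realization: "is_functor (Vect G a) C realization_functor"
  unfolding is_functor_def
  by (auto simp: Vect_Hom_iff realize realize_ident realize_cmp)

lemma linear_realization: "linear_functor (Vect G a) C realization_functor"
  unfolding linear_functor_def
  using is_functor_realization
  by (auto simp: Vect_Hom_iff realize_add realize_smult graded_matrix_def)

lemma strong_monoidal_realization: "strong_monoidal (Vect G a) C realization_functor"
proof -
  have nat: "realize_mult X' Y' \<diamondop> tarr C (farr realization_functor f) (farr realization_functor g) =
      farr realization_functor (tarr (Vect G a) f g) \<diamondop> realize_mult X Y"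
    if "f \<in> Hom (Vect G a) X X'" "g \<in> Hom (Vect G a) Y Y'" for X X' Y Y' f g
  proof -
    obtain M N where "f = (X, X', M)" "g = (Y, Y', N)" "graded_matrix X X' M" "graded_matrix Y Y' N"
      "X \<in> lists (carrier G)" "X' \<in> lists (carrier G)" "Y \<in> lists (carrier G)" "Y' \<in> lists (carrier G)"
      using \<open>f \<in> _\<close> \<open>g \<in> _\<close> unfolding Vect_Hom_iff by blast
    then show ?thesis
      using realize_mult_natural[of X X' Y Y' M N] by simp
  qed
  have assoc: "farr realization_functor (graded_assoc G a xs ys zs) \<diamondop> realize_mult (graded_tensor G xs ys) zs \<diamondop>
      tarr C (realize_mult xs ys) (ident C (S zs)) =
    realize_mult xs (graded_tensor G ys zs) \<diamondop> tarr C (ident C (S xs)) (realize_mult ys zs) \<diamondop>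
      assoc C (S xs) (S ys) (S zs)"
    if "xs \<in> lists (carrier G)" "ys \<in> lists (carrier G)" "zs \<in> lists (carrier G)" for xs ys zs
    using that realize_mult_assoc by (cases "graded_assoc G a xs ys zs") auto
  have one: "[\<one>\<^bsub>G\<^esub>] \<in> lists (carrier G)" by simp
  have units: "realize (graded_tensor G [\<one>\<^bsub>G\<^esub>] xs) xs (1\<^sub>m (length xs)) \<diamondop> realize_mult [\<one>\<^bsub>G\<^esub>] xs \<diamondop>
      tarr C realize_unit (ident C (S xs)) = lunit C (S xs)"
    "realize (graded_tensor G xs [\<one>\<^bsub>G\<^esub>]) xs (1\<^sub>m (length xs)) \<diamondop> realize_mult xs [\<one>\<^bsub>G\<^esub>] \<diamondop>
      tarr C (ident C (S xs)) realize_unit = runit C (S xs)"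
    if xs: "xs \<in> lists (carrier G)" for xs
    using xs realize_units[OF xs] G.graded_tensor_units[OF xs] by (simp_all add: realize_ident)
  show ?thesis
    unfolding strong_monoidal_def
  proof (intro conjI ballI allI)
    show "is_functor (Vect G a) C realization_functor" by (rule is_functor_realization)
  next
    fix X Y assume "X \<in> Obj (Vect G a)" "Y \<in> Obj (Vect G a)"
    then show "fmult realization_functor X Y \<in> Hom C (tobj C (fobj realization_functor X) (fobj realization_functor Y))
        (fobj realization_functor (tobj (Vect G a) X Y))" "is_iso C (fmult realization_functor X Y)"
      by (simp_all add: Hom_iff)
  next
    fix X X' Y Y' f g assume "f \<in> Hom (Vect G a) X X'" "g \<in> Hom (Vect G a) Y Y'"
    then show "fmult realization_functor X' Y' \<diamondop> tarr C (farr realization_functor f) (farr realization_functor g) =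
        farr realization_functor (tarr (Vect G a) f g) \<diamondop> fmult realization_functor X Y"
      unfolding realization_functor_simps by (rule nat)
  next
    fix X Y Z assume "X \<in> Obj (Vect G a)" "Y \<in> Obj (Vect G a)" "Z \<in> Obj (Vect G a)"
    then show "farr realization_functor (assoc (Vect G a) X Y Z) \<diamondop>
        fmult realization_functor (tobj (Vect G a) X Y) Z \<diamondop>
        tarr C (fmult realization_functor X Y) (ident C (fobj realization_functor Z)) =
        fmult realization_functor X (tobj (Vect G a) Y Z) \<diamondop>
        tarr C (ident C (fobj realization_functor X)) (fmult realization_functor Y Z) \<diamondop>
        assoc C (fobj realization_functor X) (fobj realization_functor Y) (fobj realization_functor Z)"
      unfolding realization_functor_simps Vect_simps by (rule assoc)
  next
    fix X assume "X \<in> Obj (Vect G a)"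
    then have X: "X \<in> lists (carrier G)" by (simp only: Vect_simps)
    show "farr realization_functor (lunit (Vect G a) X) \<diamondop> fmult realization_functor (tunit (Vect G a)) X \<diamondop>
        tarr C (funit realization_functor) (ident C (fobj realization_functor X)) = lunit C (fobj realization_functor X)"
      "farr realization_functor (runit (Vect G a) X) \<diamondop> fmult realization_functor X (tunit (Vect G a)) \<diamondop>
        tarr C (ident C (fobj realization_functor X)) (funit realization_functor) = runit C (fobj realization_functor X)"
      unfolding realization_functor_simps Vect_simps by (rule units[OF X])+
  qed (simp_all add: Hom_iff)
qed

end


section \<open>The realization is an equivalence\<close>

locale skeletal_realization = realization C G X \<mu> a \<nu> S \<iota> \<pi> + fusion_category C
  for C :: "('o, 'm, 'k :: field, 'z) tensor_category_data_scheme" (structure)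
    and G :: "('g, 'y) monoid_scheme" and X \<mu> a \<nu> S \<iota> \<pi> +
  assumes X_simple: "g \<in> carrier G \<Longrightarrow> simple_object C (X g)"
    and X_distinct: "g \<in> carrier G \<Longrightarrow> h \<in> carrier G \<Longrightarrow> isomorphic C (X g) (X h) \<Longrightarrow> g = h"
    and X_exhaustive: "simple_object C Z \<Longrightarrow> \<exists>g \<in> carrier G. isomorphic C Z (X g)"
begin

lemma entry_surj:
  assumes "x \<in> carrier G" "y \<in> carrier G" "u \<in> Hom C (X x) (X y)"
  shows "\<exists>c. u = entry x y c \<and> (c \<noteq> 0 \<longrightarrow> y = x)"
proof (cases "x = y")
  case True
  then show ?thesis
    using assms split[OF X_simple[of x]] scalar_endos_iff[of "X x"] by (auto simp: entry_def)
next
  case False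
  then have "u = lzero C (X x) (X y)"
    using schur_isomorphic[of "X x" "X y" u] X_simple X_distinct assms by blast
  then show ?thesis using False by (auto simp: entry_def intro: exI[of _ 0])
qed

lemma entry_inj:
  assumes "x \<in> carrier G" "y \<in> carrier G" "entry x y c = entry x y d" "c \<noteq> 0 \<Longrightarrow> y = x" "d \<noteq> 0 \<Longrightarrow> y = x"
  shows "c = d"
proof (cases "x = y")
  case True
  have "ident C (X x) \<noteq> lzero C (X x) (X x)"
    using split[OF X_simple[of x]] scalar_endos_iff[of "X x"] assms by simp
  then show ?thesis
    using assms True lsmult_cancel[of c "ident C (X x)" d] by (simp add: entry_def)
qed (use assms in auto)

text \<open>
  By Schur's lemma the components of an arrow between direct sums are scalars, and vanish
  between different degrees: arrows are the same as graded matrices.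
\<close>

lemma full_embedding_realization: "full_embedding (Vect G a) C realization_functor"
  unfolding full_embedding_def bij_betw_def
proof (intro ballI conjI)
  fix xs ys assume "xs \<in> Obj (Vect G a)" "ys \<in> Obj (Vect G a)"
  then have xs: "xs \<in> lists (carrier G)" and ys: "ys \<in> lists (carrier G)" by (simp_all only: Vect_simps)
  show "inj_on (farr realization_functor) (Hom (Vect G a) xs ys)"
  proof (rule inj_onI)
    fix f g assume f: "f \<in> Hom (Vect G a) xs ys" and g: "g \<in> Hom (Vect G a) xs ys"
      and eq: "farr realization_functor f = farr realization_functor g"
    obtain M N where fM: "f = (xs, ys, M)" and gN: "g = (xs, ys, N)"
      and M: "graded_matrix xs ys M" and N: "graded_matrix xs ys N"
      using f g unfolding Vect_Hom_iff by blast
    have "M = N"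
    proof (rule eq_matI)
      fix i j assume "i < dim_row N" "j < dim_col N"
      then have ij: "i < length ys" "j < length xs" using N by (auto simp: graded_matrix_def)
      have e: "entry (xs ! j) (ys ! i) (M $$ (i, j)) = entry (xs ! j) (ys ! i) (N $$ (i, j))"
        using realize_entry[OF xs ys ij, of M] realize_entry[OF xs ys ij, of N] eq fM gN by simp
      show "M $$ (i, j) = N $$ (i, j)"
        by (rule entry_inj[OF nth_carrier[OF xs ij(2)] nth_carrier[OF ys ij(1)] e])
          (use M N ij in \<open>unfold graded_matrix_def, blast\<close>)+
    qed (use M N in \<open>auto simp: graded_matrix_def\<close>)
    then show "f = g" using fM gN by simp
  qed
  show "farr realization_functor ` Hom (Vect G a) xs ys =
      Hom C (fobj realization_functor xs) (fobj realization_functor ys)"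
  proof
    show "farr realization_functor ` Hom (Vect G a) xs ys \<subseteq>
        Hom C (fobj realization_functor xs) (fobj realization_functor ys)"
      using is_functor_realization unfolding is_functor_def by blast
    show "Hom C (fobj realization_functor xs) (fobj realization_functor ys) \<subseteq>
        farr realization_functor ` Hom (Vect G a) xs ys"
    proof
      fix u assume u: "u \<in> Hom C (fobj realization_functor xs) (fobj realization_functor ys)"
      then have uA [simp]: "u \<in> Arr C" "Dom C u = S xs" "Cod C u = S ys" by (auto simp: Hom_iff)
      have ex: "\<exists>c. \<pi> ys i \<diamondop> u \<diamondop> \<iota> xs j = entry (xs ! j) (ys ! i) c \<and> (c \<noteq> 0 \<longrightarrow> ys ! i = xs ! j)"
        if "i < length ys" "j < length xs" for i j
        by (rule entry_surj) (use that xs ys in \<open>auto simp: Hom_iff\<close>)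
      define m where "m i j = (SOME c. \<pi> ys i \<diamondop> u \<diamondop> \<iota> xs j = entry (xs ! j) (ys ! i) c \<and>
          (c \<noteq> 0 \<longrightarrow> ys ! i = xs ! j))" for i j
      have m: "\<pi> ys i \<diamondop> u \<diamondop> \<iota> xs j = entry (xs ! j) (ys ! i) (m i j) \<and> (m i j \<noteq> 0 \<longrightarrow> ys ! i = xs ! j)"
        if "i < length ys" "j < length xs" for i j
        unfolding m_def by (rule someI_ex[OF ex[OF that]])
      let ?M = "mat (length ys) (length xs) (\<lambda>(i, j). m i j)"
      have "realize xs ys ?M = u"
        by (rule realize_eqI[OF xs ys]) (use m in auto)
      moreover have "graded_matrix xs ys ?M"
        using m by (auto simp: graded_matrix_def)
      ultimately show "u \<in> farr realization_functor ` Hom (Vect G a) xs ys"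
        using xs ys by (intro image_eqI[of _ _ "(xs, ys, ?M)"]) (auto simp: Vect_Hom_iff)
    qed
  qed
qed

lemma realization_essentially_surjective:
  assumes "Y \<in> Obj C"
  shows "\<exists>xs \<in> lists (carrier G). isomorphic C (S xs) Y"
proof -
  obtain Ss j q where Ss: "\<forall>Z \<in> set Ss. simple_object C Z" and B: "biproduct C Ss Y j q"
    using semisimple[OF assms] by (auto simp: semisimple_object_def is_direct_sum_iff)
  have ex_d: "\<forall>Z \<in> set Ss. \<exists>g. g \<in> carrier G \<and> isomorphic C Z (X g)"
    using Ss X_exhaustive by blast
  obtain d where d: "\<forall>Z \<in> set Ss. d Z \<in> carrier G \<and> isomorphic C Z (X (d Z))"
    using bchoice[OF ex_d] by (rule exE) (rule that)
  let ?xs = "map d Ss"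
  have xs: "?xs \<in> lists (carrier G)" using d by auto
  have ex_u: "\<forall>i \<in> {..<length Ss}. \<exists>u. is_iso C u \<and> u \<in> Hom C (X (d (Ss ! i))) (Ss ! i)"
  proof
    fix i assume "i \<in> {..<length Ss}"
    then have "isomorphic C (X (d (Ss ! i))) (Ss ! i)" using d isomorphic_sym by simp
    then show "\<exists>u. is_iso C u \<and> u \<in> Hom C (X (d (Ss ! i))) (Ss ! i)"
      unfolding isomorphic_def by blast
  qed
  obtain u where u: "\<forall>i \<in> {..<length Ss}. is_iso C (u i) \<and> u i \<in> Hom C (X (d (Ss ! i))) (Ss ! i)"
    using bchoice[OF ex_u] by (rule exE) (rule that)
  have "biproduct C (map X ?xs) Y (\<lambda>i. j i \<diamondop> u i) (\<lambda>i. arr_inv C (u i) \<diamondop> q i)"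
    by (rule biproduct_change_summands[OF B]) (use u in auto)
  then have "isomorphic C (S ?xs) Y"
    by (rule biproducts_isomorphic[OF S_biproduct[OF xs]])
  then show ?thesis using xs by blast
qed

theorem tensor_equivalence_realization: "tensor_equivalence (Vect G a) C realization_functor"
proof -
  interpret V: category "Vect G a" by (rule category_Vect)
  interpret E: zero_preserving_equivalence "Vect G a" C realization_functor
  proof unfold_locales
    show "is_functor (Vect G a) C realization_functor" by (rule is_functor_realization)
    show "full_embedding (Vect G a) C realization_functor" by (rule full_embedding_realization)
  next
    fix Y assume "Y \<in> Obj C"
    then show "\<exists>xs \<in> Obj (Vect G a). isomorphic C (fobj realization_functor xs) Y"
      using realization_essentially_surjective unfolding Vect_simps realization_functor_simps by blast
  next
    fix xs ys assume "xs \<in> Obj (Vect G a)" "ys \<in> Obj (Vect G a)"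
    then have xs: "xs \<in> lists (carrier G)" "ys \<in> lists (carrier G)" by (simp_all only: Vect_simps)
    then show "lzero (Vect G a) xs ys \<in> Hom (Vect G a) xs ys"
      unfolding Vect_Hom_iff by (auto simp: graded_matrix_def)
    show "farr realization_functor (lzero (Vect G a) xs ys) =
        lzero C (fobj realization_functor xs) (fobj realization_functor ys)"
      using xs by (simp add: realize_zero)
  qed
  show ?thesis
    unfolding tensor_equivalence_def tensor_functor_def exact_functor_def
    using linear_realization strong_monoidal_realization E.is_equivalence E.preserves_short_exact by blast
qed

end


section \<open>Compatible families realize to isomorphic tensor functors\<close>

lemma regrade_simps [simp]:
  "fobj (regrade H p) = map p" "farr (regrade H p) (xs, ys, M) = (map p xs, map p ys, M)"
  "fmult (regrade H p) xs ys = (graded_tensor H (map p xs) (map p ys), graded_tensor H (map p xs) (map p ys),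
    1\<^sub>m (length (graded_tensor H (map p xs) (map p ys))))"
  "funit (regrade H p) = ([\<one>\<^bsub>H\<^esub>], [\<one>\<^bsub>H\<^esub>], 1\<^sub>m 1)"
  by (simp_all add: regrade_def Let_def)

lemma comp_tensor_functor_simps [simp]:
  "fobj (comp_tensor_functor E T R) X = fobj T (fobj R X)"
  "farr (comp_tensor_functor E T R) f = farr T (farr R f)"
  "fmult (comp_tensor_functor E T R) X Y = farr T (fmult R X Y) \<diamondop>\<^bsub>E\<^esub> fmult T (fobj R X) (fobj R Y)"
  "funit (comp_tensor_functor E T R) = farr T (funit R) \<diamondop>\<^bsub>E\<^esub> funit T"
  by (simp_all add: comp_tensor_functor_def)

text \<open>
  The direct sums in \<open>C\<close> and in \<open>D\<close> have been chosen independently, so that \<open>F\<close> applied to the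
  former is only isomorphic to the latter; the comparison is \<open>\<theta>\<close> on each summand.
\<close>

locale compatible_realizations =
  compatible_families C D F G X \<mu> a \<nu> H Y \<mu>' a' \<nu>' p \<theta> +
  S: realization C G X \<mu> a \<nu> S \<iota> \<pi> + T: realization D H Y \<mu>' a' \<nu>' T \<iota>' \<pi>'
  for C :: "('o1, 'm1, 'k :: field, 'y) tensor_category_data_scheme"
    and D :: "('o2, 'm2, 'k, 'z) tensor_category_data_scheme" (structure)
    and F :: "('o1, 'm1, 'o2, 'm2, 'w) tensor_functor_data_scheme"
    and G :: "('g, 'x) monoid_scheme" and X \<mu> a \<nu>
    and H :: "('h, 'v) monoid_scheme" and Y \<mu>' a' \<nu>' p \<theta> S \<iota> \<pi> T \<iota>' \<pi>'
begin

lemma p_simps [simp]: "g \<in> carrier G \<Longrightarrow> p g \<in> carrier H"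
    "g \<in> carrier G \<Longrightarrow> h \<in> carrier G \<Longrightarrow> p (g \<otimes>\<^bsub>G\<^esub> h) = p g \<otimes>\<^bsub>H\<^esub> p h"
    "p \<one>\<^bsub>G\<^esub> = \<one>\<^bsub>H\<^esub>"
  using p_hom hom_one[OF p_hom S.G.is_group T.G.is_group] by (auto simp: hom_def)

lemma map_p [simp]: "xs \<in> lists (carrier G) \<Longrightarrow> map p xs \<in> lists (carrier H)"
  by (auto simp: in_lists_conv_set)

lemma map_p_tensor:
  "xs \<in> lists (carrier G) \<Longrightarrow> ys \<in> lists (carrier G) \<Longrightarrow>
    map p (graded_tensor G xs ys) = graded_tensor H (map p xs) (map p ys)"
  by (rule map_graded_tensor) auto

lemma \<theta>_simps [simp]:
  assumes "g \<in> carrier G"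
  shows "\<theta> g \<in> Arr D" "Dom D (\<theta> g) = Y (p g)" "Cod D (\<theta> g) = fobj F (X g)"
  using \<theta>_Hom[OF assms] by (auto simp: Hom_iff)

text \<open>
  The condition on \<open>c\<close> excludes the case that \<open>p\<close> identifies different degrees \<open>x\<close> and \<open>y\<close>: there
  \<open>T.entry\<close> is \<open>c\<close> times an identity, while \<open>S.entry\<close> is zero.
\<close>

lemma F_entry:
  assumes "x \<in> carrier G" "y \<in> carrier G" "c \<noteq> 0 \<Longrightarrow> y = x"
  shows "farr F (S.entry x y c) \<diamondop> \<theta> x = \<theta> y \<diamondop> T.entry (p x) (p y) c"
  using assms by (cases "c = 0") (auto simp: S.entry_def T.entry_def)

definition comparison :: "'g list \<Rightarrow> 'm2" where
  "comparison xs = (SOME u. u \<in> Hom D (T (map p xs)) (fobj F (S xs)) \<and>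
    (\<forall>i < length xs. u \<diamondop> \<iota>' (map p xs) i = farr F (\<iota> xs i) \<diamondop> \<theta> (xs ! i)))"

context
  fixes xs assumes xs [simp]: "xs \<in> lists (carrier G)"
begin

private lemma T_simps [simp]:
  assumes "i < length xs"
  shows "\<iota>' (map p xs) i \<in> Arr D" "Dom D (\<iota>' (map p xs) i) = Y (p (xs ! i))"
    "Cod D (\<iota>' (map p xs) i) = T (map p xs)" "\<pi>' (map p xs) i \<in> Arr D"
    "Dom D (\<pi>' (map p xs) i) = T (map p xs)" "Cod D (\<pi>' (map p xs) i) = Y (p (xs ! i))"
    "\<pi>' (map p xs) i \<diamondop> \<iota>' (map p xs) i = ident D (Y (p (xs ! i)))"
  using T.\<iota>_simps[OF map_p[OF xs], of i] assms by auto

private lemma T_zero [simp]: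
  assumes "i < length xs" "j < length xs" "i \<noteq> j"
  shows "\<pi>' (map p xs) j \<diamondop> \<iota>' (map p xs) i = lzero D (Y (p (xs ! i))) (Y (p (xs ! j)))"
  using T.\<iota>_zero[OF map_p[OF xs], of i j] assms by auto

private lemmas BT = T.S_biproduct[OF map_p[OF xs]]
private lemmas BF = F_biproduct[OF S.S_biproduct[OF xs]]

private lemma F_delta [simp]:
  assumes "i < length xs" "j < length xs"
  shows "farr F (\<pi> xs j) \<diamondop> farr F (\<iota> xs i) =
    (if i = j then ident D (fobj F (X (xs ! i))) else lzero D (fobj F (X (xs ! i))) (fobj F (X (xs ! j))))"
  using F_simps(6)[of "\<iota> xs i" "\<pi> xs j"] assms by (cases "i = j") auto

lemma comparison:
  "comparison xs \<in> Hom D (T (map p xs)) (fobj F (S xs)) \<and>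
    (\<forall>i < length xs. comparison xs \<diamondop> \<iota>' (map p xs) i = farr F (\<iota> xs i) \<diamondop> \<theta> (xs ! i))"
  unfolding comparison_def
proof (rule someI_ex)
  obtain u where "u \<in> Hom D (T (map p xs)) (fobj F (S xs))"
    "\<And>i. i < length (map Y (map p xs)) \<Longrightarrow> u \<diamondop> \<iota>' (map p xs) i = farr F (\<iota> xs i) \<diamondop> \<theta> (xs ! i)"
    by (rule biproduct_cotuple[OF D.linear_category_axioms BT, of _ "\<lambda>i. farr F (\<iota> xs i) \<diamondop> \<theta> (xs ! i)"])
      (auto simp: Hom_iff)
  then show "\<exists>u. u \<in> Hom D (T (map p xs)) (fobj F (S xs)) \<and>
    (\<forall>i < length xs. u \<diamondop> \<iota>' (map p xs) i = farr F (\<iota> xs i) \<diamondop> \<theta> (xs ! i))" by auto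
qed

lemma comparison_simps [simp]:
  "comparison xs \<in> Arr D" "Dom D (comparison xs) = T (map p xs)" "Cod D (comparison xs) = fobj F (S xs)"
  using comparison by (auto simp: Hom_iff)

lemma comparison_\<iota>: "i < length xs \<Longrightarrow>
    comparison xs \<diamondop> \<iota>' (map p xs) i = farr F (\<iota> xs i) \<diamondop> \<theta> (xs ! i)"
  using comparison by blast

lemma comparison_\<iota>_reassoc: "i < length xs \<Longrightarrow> h \<in> Arr D \<Longrightarrow> Cod D h = Y (p (xs ! i)) \<Longrightarrow>
    comparison xs \<diamondop> \<iota>' (map p xs) i \<diamondop> h = farr F (\<iota> xs i) \<diamondop> \<theta> (xs ! i) \<diamondop> h"
  using D.cmp_reassoc[OF comparison_\<iota>, of i h] by simp

lemma \<pi>_comparison: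
  assumes i: "i < length xs"
  shows "farr F (\<pi> xs i) \<diamondop> comparison xs = \<theta> (xs ! i) \<diamondop> \<pi>' (map p xs) i"
proof (rule biproduct_joint_epi[OF D.linear_category_axioms BT])
  fix j assume "j < length (map Y (map p xs))"
  then have j: "j < length xs" by simp
  have "(farr F (\<pi> xs i) \<diamondop> comparison xs) \<diamondop> \<iota>' (map p xs) j =
      farr F (\<pi> xs i) \<diamondop> farr F (\<iota> xs j) \<diamondop> \<theta> (xs ! j)"
    using i j by (simp add: comparison_\<iota>)
  also have "\<dots> = (farr F (\<pi> xs i) \<diamondop> farr F (\<iota> xs j)) \<diamondop> \<theta> (xs ! j)"
    by (rule D.cmp_assoc'[symmetric]) (use i j in auto)
  also have "\<dots> = (\<theta> (xs ! i) \<diamondop> \<pi>' (map p xs) i) \<diamondop> \<iota>' (map p xs) j"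
    using i j by (cases "i = j") auto
  finally show "(farr F (\<pi> xs i) \<diamondop> comparison xs) \<diamondop> \<iota>' (map p xs) j =
      (\<theta> (xs ! i) \<diamondop> \<pi>' (map p xs) i) \<diamondop> \<iota>' (map p xs) j" .
qed (use i in auto)

lemma is_iso_comparison: "is_iso D (comparison xs)"
proof -
  obtain v where v: "v \<in> Hom D (fobj F (S xs)) (T (map p xs))"
    and v\<pi>: "\<And>i. i < length (map Y (map p xs)) \<Longrightarrow>
      \<pi>' (map p xs) i \<diamondop> v = arr_inv D (\<theta> (xs ! i)) \<diamondop> farr F (\<pi> xs i)"
    by (rule biproduct_tuple[OF D.linear_category_axioms BT, of _ "\<lambda>i. arr_inv D (\<theta> (xs ! i)) \<diamondop> farr F (\<pi> xs i)"])
      (auto simp: Hom_iff)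
  have [simp]: "v \<in> Arr D" "Dom D v = fobj F (S xs)" "Cod D v = T (map p xs)" using v by (auto simp: Hom_iff)
  have "v \<diamondop> comparison xs = ident D (T (map p xs))"
  proof (rule biproduct_joint_mono[OF D.linear_category_axioms BT])
    fix i assume i': "i < length (map Y (map p xs))"
    then have i: "i < length xs" by simp
    show "\<pi>' (map p xs) i \<diamondop> v \<diamondop> comparison xs = \<pi>' (map p xs) i \<diamondop> ident D (T (map p xs))"
      using i by (simp add: D.cmp_reassoc[OF v\<pi>[OF i']] \<pi>_comparison)
  qed auto
  moreover have "comparison xs \<diamondop> v = ident D (fobj F (S xs))"
  proof (rule biproduct_joint_mono[OF D.linear_category_axioms BF])
    fix i assume "i < length (map (fobj F) (map X xs))"
    then have i: "i < length xs" by simp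
    have "farr F (\<pi> xs i) \<diamondop> comparison xs \<diamondop> v = farr F (\<pi> xs i)"
      using i v\<pi>[of i] by (simp add: D.cmp_reassoc[OF \<pi>_comparison[OF i]])
    then show "farr F (\<pi> xs i) \<diamondop> comparison xs \<diamondop> v = farr F (\<pi> xs i) \<diamondop> ident D (fobj F (S xs))"
      using i by simp
  qed auto
  ultimately show ?thesis by (intro D.is_isoI(1)[of _ v]) auto
qed

end

lemma comparison_natural:
  assumes xs: "xs \<in> lists (carrier G)" and ys: "ys \<in> lists (carrier G)" and M: "graded_matrix xs ys M"
  shows "comparison ys \<diamondop> T.realize (map p xs) (map p ys) M = farr F (S.realize xs ys M) \<diamondop> comparison xs"
proof (rule biproduct_joint_epi[OF D.linear_category_axioms T.S_biproduct[OF map_p[OF xs]]])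
  note [simp] = xs ys map_p[OF xs] map_p[OF ys]
  fix j assume "j < length (map Y (map p xs))"
  then have j [simp]: "j < length xs" by simp
  have Tj [simp]: "\<iota>' (map p xs) j \<in> Arr D" "Dom D (\<iota>' (map p xs) j) = Y (p (xs ! j))"
    "Cod D (\<iota>' (map p xs) j) = T (map p xs)"
    using T.\<iota>_simps[of "map p xs" j] by auto
  show "(comparison ys \<diamondop> T.realize (map p xs) (map p ys) M) \<diamondop> \<iota>' (map p xs) j =
      (farr F (S.realize xs ys M) \<diamondop> comparison xs) \<diamondop> \<iota>' (map p xs) j"
  proof (rule biproduct_joint_mono[OF D.linear_category_axioms F_biproduct[OF S.S_biproduct[OF ys]]])
    fix i assume "i < length (map (fobj F) (map X ys))"
    then have i [simp]: "i < length ys" by simp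
    have Ti [simp]: "\<pi>' (map p ys) i \<in> Arr D" "Dom D (\<pi>' (map p ys) i) = T (map p ys)"
      "Cod D (\<pi>' (map p ys) i) = Y (p (ys ! i))"
      using T.\<iota>_simps[of "map p ys" i] by auto
    have "farr F (\<pi> ys i) \<diamondop> (comparison ys \<diamondop> T.realize (map p xs) (map p ys) M) \<diamondop> \<iota>' (map p xs) j =
        \<theta> (ys ! i) \<diamondop> \<pi>' (map p ys) i \<diamondop> T.realize (map p xs) (map p ys) M \<diamondop> \<iota>' (map p xs) j"
      by (simp add: D.cmp_reassoc[OF \<pi>_comparison[OF ys i]])
    also have "\<dots> = \<theta> (ys ! i) \<diamondop> T.entry (p (xs ! j)) (p (ys ! i)) (M $$ (i, j))"
      using T.realize_entry[of "map p xs" "map p ys" i j M] by simp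
    also have "\<dots> = farr F (S.entry (xs ! j) (ys ! i) (M $$ (i, j))) \<diamondop> \<theta> (xs ! j)"
      by (rule F_entry[symmetric]) (use M in \<open>auto simp: graded_matrix_def\<close>)
    also have "\<dots> = farr F (\<pi> ys i \<diamondop>\<^bsub>C\<^esub> S.realize xs ys M \<diamondop>\<^bsub>C\<^esub> \<iota> xs j) \<diamondop> \<theta> (xs ! j)"
      by (simp only: S.realize_entry xs ys i j)
    also have "\<dots> = farr F (\<pi> ys i) \<diamondop> (farr F (S.realize xs ys M) \<diamondop> comparison xs) \<diamondop> \<iota>' (map p xs) j"
      by (simp add: comparison_\<iota>)
    finally show "farr F (\<pi> ys i) \<diamondop> (comparison ys \<diamondop> T.realize (map p xs) (map p ys) M) \<diamondop> \<iota>' (map p xs) j =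
        farr F (\<pi> ys i) \<diamondop> (farr F (S.realize xs ys M) \<diamondop> comparison xs) \<diamondop> \<iota>' (map p xs) j" .
  qed auto
qed (use xs ys map_p in auto)

lemma comparison_mult:
  assumes xs: "xs \<in> lists (carrier G)" and ys: "ys \<in> lists (carrier G)"
  shows "comparison (graded_tensor G xs ys) \<diamondop> T.realize_mult (map p xs) (map p ys) =
    (farr F (S.realize_mult xs ys) \<diamondop> fmult F (S xs) (S ys)) \<diamondop> tarr D (comparison xs) (comparison ys)"
proof (rule D.biproduct_tensor_joint_epi[OF T.S_biproduct[OF map_p[OF xs]] T.S_biproduct[OF map_p[OF ys]]])
  note [simp] = xs ys map_p[OF xs] map_p[OF ys] map_p_tensor[OF xs ys] S.G.graded_tensor_lists[OF xs ys]
    T.G.graded_tensor_lists[OF map_p[OF xs] map_p[OF ys]]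
  let ?zs = "graded_tensor G xs ys" and ?zs' = "graded_tensor H (map p xs) (map p ys)"
  fix i j assume "i < length (map Y (map p xs))" "j < length (map Y (map p ys))"
  then have i [simp]: "i < length xs" and j [simp]: "j < length ys" by auto
  let ?k = "i * length ys + j"
  have k [simp]: "?k < length xs * length ys" using mult_add_less i j by blast
  have nk [simp]: "?zs ! ?k = xs ! i \<otimes>\<^bsub>G\<^esub> ys ! j" using graded_tensor_nth i j by blast
  have Ti [simp]: "\<iota>' (map p xs) i \<in> Arr D" "Dom D (\<iota>' (map p xs) i) = Y (p (xs ! i))"
    "Cod D (\<iota>' (map p xs) i) = T (map p xs)"
    using T.\<iota>_simps[of "map p xs" i] by auto
  have Tj [simp]: "\<iota>' (map p ys) j \<in> Arr D" "Dom D (\<iota>' (map p ys) j) = Y (p (ys ! j))"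
    "Cod D (\<iota>' (map p ys) j) = T (map p ys)"
    using T.\<iota>_simps[of "map p ys" j] by auto
  have m: "T.realize_mult (map p xs) (map p ys) \<diamondop> tarr D (\<iota>' (map p xs) i) (\<iota>' (map p ys) j) =
      \<iota>' (map p ?zs) ?k \<diamondop> \<mu>' (p (xs ! i)) (p (ys ! j))"
    using T.realize_mult_\<iota>[of "map p xs" "map p ys" i j] by simp
  have n: "farr F (tarr C (\<iota> xs i) (\<iota> ys j)) \<diamondop> fmult F (X (xs ! i)) (X (ys ! j)) =
      fmult F (S xs) (S ys) \<diamondop> tarr D (farr F (\<iota> xs i)) (farr F (\<iota> ys j))"
    using fmult_natural[of "\<iota> xs i" "\<iota> ys j"] by simp
  have c: "farr F (S.realize_mult xs ys) \<diamondop> farr F (tarr C (\<iota> xs i) (\<iota> ys j)) =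
      farr F (\<iota> ?zs ?k) \<diamondop> farr F (\<mu> (xs ! i) (ys ! j))"
    using arg_cong[OF S.realize_mult_\<iota>[OF xs ys i j], of "farr F"] by simp
  have "(comparison ?zs \<diamondop> T.realize_mult (map p xs) (map p ys)) \<diamondop>
      tarr D (\<iota>' (map p xs) i) (\<iota>' (map p ys) j) =
      comparison ?zs \<diamondop> T.realize_mult (map p xs) (map p ys) \<diamondop> tarr D (\<iota>' (map p xs) i) (\<iota>' (map p ys) j)"
    by simp
  also have "\<dots> = farr F (\<iota> ?zs ?k) \<diamondop> \<theta> (xs ! i \<otimes>\<^bsub>G\<^esub> ys ! j) \<diamondop> \<mu>' (p (xs ! i)) (p (ys ! j))"
    unfolding m by (subst comparison_\<iota>_reassoc) auto
  also have "\<dots> = farr F (\<iota> ?zs ?k) \<diamondop> farr F (\<mu> (xs ! i) (ys ! j)) \<diamondop>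
      fmult F (X (xs ! i)) (X (ys ! j)) \<diamondop> tarr D (\<theta> (xs ! i)) (\<theta> (ys ! j))"
    by (simp add: \<theta>_\<mu>)
  also have "\<dots> = farr F (S.realize_mult xs ys) \<diamondop> farr F (tarr C (\<iota> xs i) (\<iota> ys j)) \<diamondop>
      fmult F (X (xs ! i)) (X (ys ! j)) \<diamondop> tarr D (\<theta> (xs ! i)) (\<theta> (ys ! j))"
    by (simp add: D.cmp_reassoc[OF c])
  also have "\<dots> = farr F (S.realize_mult xs ys) \<diamondop> fmult F (S xs) (S ys) \<diamondop>
      tarr D (farr F (\<iota> xs i) \<diamondop> \<theta> (xs ! i)) (farr F (\<iota> ys j) \<diamondop> \<theta> (ys ! j))"
    by (simp add: D.cmp_reassoc[OF n])
  also have "\<dots> = ((farr F (S.realize_mult xs ys) \<diamondop> fmult F (S xs) (S ys)) \<diamondop>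
      tarr D (comparison xs) (comparison ys)) \<diamondop> tarr D (\<iota>' (map p xs) i) (\<iota>' (map p ys) j)"
    by (simp add: comparison_\<iota>)
  finally show "(comparison ?zs \<diamondop> T.realize_mult (map p xs) (map p ys)) \<diamondop>
      tarr D (\<iota>' (map p xs) i) (\<iota>' (map p ys) j) =
      ((farr F (S.realize_mult xs ys) \<diamondop> fmult F (S xs) (S ys)) \<diamondop>
      tarr D (comparison xs) (comparison ys)) \<diamondop> tarr D (\<iota>' (map p xs) i) (\<iota>' (map p ys) j)" .
qed (use xs ys map_p map_p_tensor S.G.graded_tensor_lists T.G.graded_tensor_lists in auto)

lemma comparison_unit:
  "comparison [\<one>\<^bsub>G\<^esub>] \<diamondop> T.realize_unit = farr F S.realize_unit \<diamondop> funit F"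
proof -
  have one: "[\<one>\<^bsub>G\<^esub>] \<in> lists (carrier G)" "0 < length [\<one>\<^bsub>G\<^esub>]" by simp_all
  have "comparison [\<one>\<^bsub>G\<^esub>] \<diamondop> \<iota>' (map p [\<one>\<^bsub>G\<^esub>]) 0 \<diamondop> \<nu>' =
      farr F (\<iota> [\<one>\<^bsub>G\<^esub>] 0) \<diamondop> \<theta> \<one>\<^bsub>G\<^esub> \<diamondop> \<nu>'"
    using comparison_\<iota>_reassoc[OF one, of \<nu>'] by simp
  also have "\<dots> = farr F (\<iota> [\<one>\<^bsub>G\<^esub>] 0) \<diamondop> farr F \<nu> \<diamondop> funit F"
    by (simp add: \<theta>_\<nu>)
  also have "\<dots> = farr F S.realize_unit \<diamondop> funit F"
    using S.\<iota>_simps[OF one] by (simp add: S.realize_unit_def)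
  finally show ?thesis by (simp add: T.realize_unit_def)
qed

theorem realizations_isomorphic:
  "tensor_functor_isomorphic (Vect G a) D
    (comp_tensor_functor D T.realization_functor (regrade H p))
    (comp_tensor_functor D F S.realization_functor)"
  unfolding tensor_functor_isomorphic_def
proof (intro exI[of _ comparison] conjI ballI)
  show "natural_iso (Vect G a) D (comp_tensor_functor D T.realization_functor (regrade H p))
      (comp_tensor_functor D F S.realization_functor) comparison"
    unfolding natural_iso_def
  proof (intro conjI ballI allI)
    fix xs assume "xs \<in> Obj (Vect G a)"
    then have xs: "xs \<in> lists (carrier G)" by (simp only: Vect_simps)
    show "comparison xs \<in> Hom D (fobj (comp_tensor_functor D T.realization_functor (regrade H p)) xs)
        (fobj (comp_tensor_functor D F S.realization_functor) xs)" "is_iso D (comparison xs)"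
      using comparison[OF xs] is_iso_comparison[OF xs] by simp_all
  next
    fix xs ys f assume "f \<in> Hom (Vect G a) xs ys"
    then obtain M where "f = (xs, ys, M)" "xs \<in> lists (carrier G)" "ys \<in> lists (carrier G)" "graded_matrix xs ys M"
      unfolding Vect_Hom_iff by blast
    then show "comparison ys \<diamondop> farr (comp_tensor_functor D T.realization_functor (regrade H p)) f =
        farr (comp_tensor_functor D F S.realization_functor) f \<diamondop> comparison xs"
      using comparison_natural by simp
  qed
next
  fix xs ys assume "xs \<in> Obj (Vect G a)" "ys \<in> Obj (Vect G a)"
  then have xs: "xs \<in> lists (carrier G)" and ys: "ys \<in> lists (carrier G)" by (simp_all only: Vect_simps)
  have "graded_tensor H (map p xs) (map p ys) \<in> lists (carrier H)"
    using T.G.graded_tensor_lists[OF map_p[OF xs] map_p[OF ys]] .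
  then show "comparison (tobj (Vect G a) xs ys) \<diamondop>
      fmult (comp_tensor_functor D T.realization_functor (regrade H p)) xs ys =
      fmult (comp_tensor_functor D F S.realization_functor) xs ys \<diamondop> tarr D (comparison xs) (comparison ys)"
    using comparison_mult[OF xs ys] T.realize_mult_simps[OF map_p[OF xs] map_p[OF ys]]
      T.realize_ident[of "graded_tensor H (map p xs) (map p ys)"]
    unfolding comp_tensor_functor_simps Vect_simps T.realization_functor_simps S.realization_functor_simps
      regrade_simps by simp
next
  have "T.realize [\<one>\<^bsub>H\<^esub>] [\<one>\<^bsub>H\<^esub>] (1\<^sub>m 1) = ident D (T [\<one>\<^bsub>H\<^esub>])"
    using T.realize_ident[of "[\<one>\<^bsub>H\<^esub>]"] by simp
  then show "comparison (tunit (Vect G a)) \<diamondop>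
      funit (comp_tensor_functor D T.realization_functor (regrade H p)) =
      funit (comp_tensor_functor D F S.realization_functor)"
    using comparison_unit by simp
qed

end

section \<open>Tensor functors and Picard groups\<close>

lemma (in functor_between) full_embedding_reflects_isomorphic:
  assumes full: "full_embedding C D F" and XY: "X \<in> Obj C" "Y \<in> Obj C"
    and iso: "isomorphic D (fobj F X) (fobj F Y)"
  shows "isomorphic C X Y"
proof -
  obtain u where u: "is_iso D u" "u \<in> Arr D" "Dom D u = fobj F X" "Cod D u = fobj F Y"
    using iso by (rule D.isomorphicE)
  have bij: "bij_betw (farr F) (Hom C A B) (Hom D (fobj F A) (fobj F B))"
    if "A \<in> Obj C" "B \<in> Obj C" for A B
    using full that by (simp add: full_embedding_def)
  have "u \<in> farr F ` Hom C X Y"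
    using bij[OF XY] u by (simp add: bij_betw_def Hom_iff)
  then obtain v where v: "v \<in> Hom C X Y" "farr F v = u" by blast
  have "arr_inv D u \<in> farr F ` Hom C Y X"
    using bij[OF XY(2,1)] u by (simp add: bij_betw_def Hom_iff)
  then obtain w where w: "w \<in> Hom C Y X" "farr F w = arr_inv D u" by (rule imageE) (rule that, simp_all)
  have vw: "v \<in> Arr C" "Dom C v = X" "Cod C v = Y" "w \<in> Arr C" "Dom C w = Y" "Cod C w = X"
    using v w by (auto simp: Hom_iff)
  have "w \<diamondop>\<^bsub>C\<^esub> v = ident C X"
    using bij[OF XY(1,1)] by (rule inj_onD[OF bij_betw_imp_inj_on]) (use vw v w u XY in \<open>auto simp: Hom_iff\<close>)
  moreover have "v \<diamondop>\<^bsub>C\<^esub> w = ident C Y"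
    using bij[OF XY(2,2)] by (rule inj_onD[OF bij_betw_imp_inj_on]) (use vw v w u XY in \<open>auto simp: Hom_iff\<close>)
  ultimately have "is_iso C v" using vw by (intro C.is_isoI(1)[of v w]) auto
  then show ?thesis using v by (intro C.isomorphicI)
qed

lemma (in linear_functor_between) full_embedding_scalar_endos_iff:
  assumes full: "full_embedding C D F" and X: "X \<in> Obj C"
  shows "scalar_endos D (fobj F X) \<longleftrightarrow> scalar_endos C X"
proof -
  have "bij_betw (farr F) (Hom C X X) (Hom D (fobj F X) (fobj F X))"
    using full X by (simp add: full_embedding_def)
  moreover have "range (\<lambda>c. lsmult C c (ident C X)) \<subseteq> Hom C X X"
    using X by (auto simp: Hom_iff)
  ultimately have "bij_betw (\<lambda>c. lsmult C c (ident C X)) UNIV (Hom C X X) \<longleftrightarrow>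
      bij_betw (farr F \<circ> (\<lambda>c. lsmult C c (ident C X))) UNIV (Hom D (fobj F X) (fobj F X))"
    by (rule bij_betw_comp_iff2)
  moreover have "farr F \<circ> (\<lambda>c. lsmult C c (ident C X)) = (\<lambda>c. lsmult D c (ident D (fobj F X)))"
    using X by auto
  ultimately show ?thesis by (simp add: scalar_endos_def)
qed

text \<open>
  The defining union consists of copies of one and the same class.
\<close>

lemma (in functor_between) iso_class_map_iso_class:
  assumes "X \<in> Obj C"
  shows "iso_class_map D F (iso_class C X) = iso_class D (fobj F X)"
proof -
  have "iso_class D (fobj F Y) = iso_class D (fobj F X)" if "isomorphic C X Y" for Y
    using F_isomorphic[OF that] D.iso_class_eq_iff[of "fobj F X" "fobj F Y"] assms by simp
  moreover have "isomorphic C X X" using assms C.isomorphic_refl by simp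
  ultimately show ?thesis unfolding iso_class_map_def iso_class_def by blast
qed

lemma (in tensor_functor_between) iso_class_map_hom:
  assumes "pointed_category C" "pointed_category D"
  shows "iso_class_map D F \<in> hom (Picard C) (Picard D)"
proof (rule homI)
  interpret PC: pointed_category C by fact
  interpret PD: pointed_category D by fact
  have simple: "simple_object D (fobj F X)" if "simple_object C X" for X
    using that PC.simple_iff_invertible PD.simple_iff_invertible F_invertible by blast
  fix A B assume "A \<in> carrier (Picard C)" "B \<in> carrier (Picard C)"
  then obtain X Y where XY: "simple_object C X" "A = iso_class C X" "simple_object C Y" "B = iso_class C Y"
    by (auto simp: PC.carrier_Picard)
  then have Obj: "X \<in> Obj C" "Y \<in> Obj C" using PC.simple_Obj by auto
  show "iso_class_map D F A \<in> carrier (Picard D)"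
    using XY Obj simple by (auto simp: PD.carrier_Picard iso_class_map_iso_class)
  have "iso_class_map D F (A \<otimes>\<^bsub>Picard C\<^esub> B) = iso_class D (fobj F (tobj C X Y))"
    using XY Obj by (simp add: PC.mult_Picard iso_class_map_iso_class)
  also have "\<dots> = iso_class D (tobj D (fobj F X) (fobj F Y))"
    using D.isomorphic_sym[OF F_tobj_isomorphic[OF Obj]] D.iso_class_eq_iff Obj by simp
  also have "\<dots> = iso_class_map D F A \<otimes>\<^bsub>Picard D\<^esub> iso_class_map D F B"
    using XY Obj simple by (simp add: PD.mult_Picard iso_class_map_iso_class)
  finally show "iso_class_map D F (A \<otimes>\<^bsub>Picard C\<^esub> B) =
      iso_class_map D F A \<otimes>\<^bsub>Picard D\<^esub> iso_class_map D F B" .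
qed

locale picard_representatives = pointed_category C
  for C :: "('o, 'm, 'k :: field, 'z) tensor_category_data_scheme" (structure) +
  fixes X :: "'o set \<Rightarrow> 'o"
  assumes X_simple: "g \<in> carrier (Picard C) \<Longrightarrow> simple_object C (X g)"
    and X_class: "g \<in> carrier (Picard C) \<Longrightarrow> iso_class C (X g) = g"
begin

lemma X_Obj: "g \<in> carrier (Picard C) \<Longrightarrow> X g \<in> Obj C"
  using X_simple simple_Obj by blast

lemma X_unit: "isomorphic C (tunit C) (X \<one>\<^bsub>Picard C\<^esub>)"
proof -
  interpret group "Picard C" by (rule group_Picard)
  have "iso_class C (tunit C) = iso_class C (X \<one>\<^bsub>Picard C\<^esub>)"
    by (simp only: X_class[OF one_closed] one_Picard[symmetric])
  then show ?thesis using iso_class_eq_iff[of "tunit C"] by simp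
qed

lemma X_mult:
  assumes "g \<in> carrier (Picard C)" "h \<in> carrier (Picard C)"
  shows "isomorphic C (tobj C (X g) (X h)) (X (g \<otimes>\<^bsub>Picard C\<^esub> h))"
proof -
  interpret group "Picard C" by (rule group_Picard)
  have "iso_class C (tobj C (X g) (X h)) = iso_class C (X (g \<otimes>\<^bsub>Picard C\<^esub> h))"
    using mult_Picard[OF X_simple[OF assms(1)] X_simple[OF assms(2)]]
      X_class[OF assms(1)] X_class[OF assms(2)] X_class[OF m_closed[OF assms]] by metis
  then show ?thesis using iso_class_eq_iff X_Obj assms by simp
qed

lemma X_exhaustive: "simple_object C Z \<Longrightarrow> \<exists>g \<in> carrier (Picard C). isomorphic C Z (X g)"
  using X_class[of "iso_class C Z"] iso_class_eq_iff[of Z] simple_Obj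
  by (intro bexI[of _ "iso_class C Z"]) (auto simp: carrier_Picard)

lemma X_distinct:
  assumes "g \<in> carrier (Picard C)" "h \<in> carrier (Picard C)" "isomorphic C (X g) (X h)"
  shows "g = h"
  using iso_class_eq_iff[OF X_Obj[OF assms(1)], of "X h"] X_class assms by simp

lemma skeletal_realization_exists:
  assumes "unital_family C (Picard C) X \<mu> a \<nu>"
  shows "\<exists>S \<iota> \<pi>. skeletal_realization C (Picard C) X \<mu> a \<nu> S \<iota> \<pi>"
proof -
  interpret unital_family C "Picard C" X \<mu> a \<nu> by fact
  have "\<exists>B. biproduct C (map X xs) (fst B) (fst (snd B)) (snd (snd B))"
    if xs: "xs \<in> lists (carrier (Picard C))" for xs
  proof -
    have "set (map X xs) \<subseteq> Obj C" using xs X_Obj by auto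
    then obtain A \<iota> \<pi> where "biproduct C (map X xs) A \<iota> \<pi>" using biproduct_exists by blast
    then show ?thesis by (intro exI[of _ "(A, \<iota>, \<pi>)"]) simp
  qed
  then have ex: "\<forall>xs \<in> lists (carrier (Picard C)).
      \<exists>B. biproduct C (map X xs) (fst B) (fst (snd B)) (snd (snd B))" by blast
  obtain B where B: "\<forall>xs \<in> lists (carrier (Picard C)).
      biproduct C (map X xs) (fst (B xs)) (fst (snd (B xs))) (snd (snd (B xs)))"
    using bchoice[OF ex] by (rule exE) (rule that)
  have "skeletal_realization C (Picard C) X \<mu> a \<nu>
      (\<lambda>xs. fst (B xs)) (\<lambda>xs. fst (snd (B xs))) (\<lambda>xs. snd (snd (B xs)))"
    by unfold_locales (use B X_simple X_distinct X_exhaustive in auto)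
  then show ?thesis by blast
qed

end

lemma (in pointed_category) picard_representatives_exist: "\<exists>X. picard_representatives C X"
proof -
  have ex: "\<forall>g \<in> carrier (Picard C). \<exists>Z. simple_object C Z \<and> iso_class C Z = g"
    by (auto simp: carrier_Picard)
  obtain X where X: "\<forall>g \<in> carrier (Picard C). simple_object C (X g) \<and> iso_class C (X g) = g"
    using bchoice[OF ex] by (rule exE) (rule that)
  have "picard_representatives C X"
    by unfold_locales (use X in auto)
  then show ?thesis by blast
qed

text \<open>
  For \<open>f\<close> and for \<open>F\<close> alike: simple objects are invertible and stay so under the functor, hence
  have scalar endomorphisms on both sides, which is all that \<open>transport_family\<close> needs.
\<close>

lemma (in tensor_functor_between) picard_transport:
  assumes PC: "picard_representatives C X" and PD: "picard_representatives D Y"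
    and T: "unital_family D (Picard D) Y \<mu>' a' \<nu>'"
  shows "\<exists>\<mu> \<nu> \<theta>. compatible_families C D F (Picard C) X \<mu> (pullback3 (Picard C) (iso_class_map D F) a') \<nu>
    (Picard D) Y \<mu>' a' \<nu>' (iso_class_map D F) \<theta>"
proof -
  interpret PC: picard_representatives C X by fact
  interpret PD: picard_representatives D Y by fact
  let ?p = "iso_class_map D F"
  have p: "?p \<in> hom (Picard C) (Picard D)"
    by (rule iso_class_map_hom[OF PC.pointed_category_axioms PD.pointed_category_axioms])
  have "isomorphic D (Y (?p g)) (fobj F (X g))" if g: "g \<in> carrier (Picard C)" for g
  proof -
    have pg: "?p g \<in> carrier (Picard D)" using p g by (auto simp: hom_def)
    have "iso_class D (Y (?p g)) = iso_class D (fobj F (X g))"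
      using PD.X_class[OF pg] iso_class_map_iso_class[OF PC.X_Obj[OF g]] PC.X_class[OF g] by simp
    then show ?thesis using D.iso_class_eq_iff[OF PD.X_Obj[OF pg]] by simp
  qed
  then have ex: "\<forall>g \<in> carrier (Picard C). \<exists>t. t \<in> Hom D (Y (?p g)) (fobj F (X g)) \<and> is_iso D t"
    unfolding isomorphic_def by blast
  obtain \<theta> where \<theta>: "\<forall>g \<in> carrier (Picard C). \<theta> g \<in> Hom D (Y (?p g)) (fobj F (X g)) \<and> is_iso D (\<theta> g)"
    using bchoice[OF ex] by (rule exE) (rule that)
  have bij: "bij_betw (farr F) (Hom C A (X g)) (Hom D (fobj F A) (fobj F (X g)))"
    if g: "g \<in> carrier (Picard C)" and A: "isomorphic C A (X g)" for g A
  proof (rule bij_on_scalar_homs[OF A])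
    have "invertible_object C (X g)" using PC.X_simple[OF g] PC.simple_invertible by simp
    then show "scalar_endos C (X g)" "scalar_endos D (fobj F (X g))"
      using C.invertible_scalar_endos D.invertible_scalar_endos F_invertible by blast+
  qed
  have "\<exists>\<mu> \<nu>. compatible_families C D F (Picard C) X \<mu> (pullback3 (Picard C) ?p a') \<nu>
    (Picard D) Y \<mu>' a' \<nu>' ?p \<theta>"
    by (rule transport_family[OF T PC.group_Picard p PC.X_Obj PC.X_unit PC.X_mult bij]) (use \<theta> in auto)
  then show ?thesis by blast
qed


section \<open>Third cohomology\<close>

lemma cocycles3_simps [simp]:
  "mult (cocycles3 G) a b = (\<lambda>t \<in> triples G. a t * b t)"
  "one (cocycles3 G) = (\<lambda>t \<in> triples G. 1)"
  by (simp_all add: cocycles3_def)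

lemma (in group) one_coboundary3: "(\<lambda>t \<in> triples G. 1) \<in> coboundaries3 G"
  unfolding coboundaries3_def
proof (rule image_eqI)
  show "(\<lambda>t \<in> triples G. 1) = coboundary3 G (\<lambda>t \<in> carrier G \<times> carrier G. 1)"
    by (auto simp: coboundary3_def restrict_def fun_eq_iff)
qed auto

text \<open>
  Pullbacks are extensional by construction, so this places them in their classes.
\<close>

lemma (in group) mem_own_class:
  assumes "b \<in> extensional (triples G)"
  shows "b \<in> coboundaries3 G #>\<^bsub>cocycles3 G\<^esub> b"
proof -
  have "b = (\<lambda>t \<in> triples G. 1) \<otimes>\<^bsub>cocycles3 G\<^esub> b"
    using assms by (auto simp: extensional_def restrict_def fun_eq_iff)
  then show ?thesis unfolding r_coset_def using one_coboundary3 by blast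
qed

lemma (in group) cohomology_class_exists:
  assumes "a \<in> carrier (cocycles3 G)"
  shows "\<exists>\<alpha> \<in> carrier (H3 G). a \<in> \<alpha>"
proof
  show "coboundaries3 G #>\<^bsub>cocycles3 G\<^esub> a \<in> carrier (H3 G)"
    using assms by (auto simp: H3_def FactGroup_def RCOSETS_def)
  show "a \<in> coboundaries3 G #>\<^bsub>cocycles3 G\<^esub> a"
    using assms by (intro mem_own_class) (auto simp: cocycles3_def PiE_def)
qed

lemma (in group) pullback3_in_infl: "a \<in> \<alpha> \<Longrightarrow> pullback3 G p a \<in> infl G p \<alpha>"
  unfolding infl_def using mem_own_class[of "pullback3 G p a"] by (auto simp: pullback3_def)


section \<open>Exact sequences with pointed middle term\<close>

locale pointed_exact_sequence =
  C': fusion_category C' + C: pointed_category C + C'': fusion_category C'' +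
  f: tensor_functor_between C' C f + F: tensor_functor_between C C'' F
  for C' :: "('o1, 'm1, 'k :: field) tensor_category_data"
    and C :: "('o2, 'm2, 'k) tensor_category_data"
    and C'' :: "('o3, 'm3, 'k) tensor_category_data"
    and f :: "('o1, 'm1, 'o2, 'm2) tensor_functor_data"
    and F :: "('o2, 'm2, 'o3, 'm3) tensor_functor_data" +
  assumes exact: "exact_sequence C' C C'' f F"
begin

lemma full: "full_embedding C' C f"
  using exact by (simp add: exact_sequence_def)

lemma F_simple: "simple_object C X \<Longrightarrow> simple_object C'' (fobj F X)"
  using C.simple_invertible F.F_invertible C''.invertible_simple by blast

lemma f_simple_iff:
  assumes "X \<in> Obj C'"
  shows "simple_object C (fobj f X) \<longleftrightarrow> simple_object C' X"
  using f.full_embedding_scalar_endos_iff[OF full assms] assms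
    C.simple_iff_scalar_endos C'.simple_iff_scalar_endos by simp

text \<open>
  The image of a simple object is simple, and the only trivial simple object is the unit, so
  for simple objects the kernel of \<open>F\<close> can be read off from isomorphism classes.
\<close>

lemma simple_kernel_iff:
  assumes X: "simple_object C X"
  shows "isomorphic C'' (fobj F X) (tunit C'') \<longleftrightarrow> (\<exists>Z \<in> Obj C'. isomorphic C (fobj f Z) X)"
proof -
  have "isomorphic C'' (fobj F X) (tunit C'') \<longleftrightarrow> trivial_object C'' (fobj F X)"
    using C''.trivial_simple_object[OF F_simple[OF X]] C''.trivial_object_unit by blast
  also have "\<dots> \<longleftrightarrow> X \<in> kernel_objects C C'' F"
    using C.simple_Obj[OF X] by (simp add: kernel_objects_def)
  also have "\<dots> \<longleftrightarrow> X \<in> essential_image C' C f"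
    using exact by (simp add: exact_sequence_def)
  finally show ?thesis by (simp add: essential_image_def)
qed

text \<open>
  The inverse \<open>Z\<close> of \<open>f(X)\<close> in \<open>C\<close> is sent to the unit by \<open>F\<close>, because \<open>f(X)\<close> is. So \<open>Z\<close> comes
  from an object of \<open>C'\<close>, which is inverse to \<open>X\<close> since \<open>f\<close> reflects isomorphisms.
\<close>

lemma pointed_first: "pointed_category C'"
proof unfold_locales
  fix X assume X: "simple_object C' X"
  then have XO: "X \<in> Obj C'" by (simp add: simple_object_def)
  have fX: "simple_object C (fobj f X)" using f_simple_iff[OF XO] X by simp
  obtain Z where Z: "Z \<in> Obj C" "isomorphic C (tobj C (fobj f X) Z) (tunit C)"
      "isomorphic C (tobj C Z (fobj f X)) (tunit C)"
    using C.simple_invertible[OF fX] by (rule C.invertible_objectE)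
  have "invertible_object C Z"
    using Z XO by (auto simp: invertible_object_def)
  then have Zs: "simple_object C Z" by (rule C.invertible_simple)
  have FfX: "isomorphic C'' (fobj F (fobj f X)) (tunit C'')"
    using simple_kernel_iff[OF fX] XO C.isomorphic_refl[of "fobj f X"] f.F_simps(1)[OF XO] by blast
  have "isomorphic C'' (fobj F Z) (tobj C'' (tunit C'') (fobj F Z))"
    using Z by (intro C''.isomorphic_sym[OF C''.isomorphic_units(1)]) simp
  also have "isomorphic C'' \<dots> (tobj C'' (fobj F (fobj f X)) (fobj F Z))"
    using Z by (intro C''.isomorphic_tobj C''.isomorphic_sym[OF FfX] C''.isomorphic_refl) simp
  also have "isomorphic C'' \<dots> (tunit C'')"
    using Z XO by (intro F.F_inverse) auto
  finally obtain W where W: "W \<in> Obj C'" "isomorphic C (fobj f W) Z"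
    using simple_kernel_iff[OF Zs] by blast
  have inverse: "isomorphic C' (tobj C' A B) (tunit C')"
    if AB: "A \<in> Obj C'" "B \<in> Obj C'" and i: "isomorphic C (tobj C (fobj f A) (fobj f B)) (tunit C)" for A B
  proof (rule f.full_embedding_reflects_isomorphic[OF full])
    have "isomorphic C (fobj f (tobj C' A B)) (tobj C (fobj f A) (fobj f B))"
      using AB by (intro C.isomorphic_sym[OF f.F_tobj_isomorphic])
    also have "isomorphic C \<dots> (tunit C)" by (rule i)
    also have "isomorphic C \<dots> (fobj f (tunit C'))" by (rule f.F_tunit_isomorphic)
    finally show "isomorphic C (fobj f (tobj C' A B)) (fobj f (tunit C'))" .
  qed (use AB in auto)
  have "isomorphic C (tobj C (fobj f X) (fobj f W)) (tunit C)"
    "isomorphic C (tobj C (fobj f W) (fobj f X)) (tunit C)"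
    using C.isomorphic_trans[OF C.isomorphic_tobj[OF C.isomorphic_refl W(2)] Z(2)]
      C.isomorphic_trans[OF C.isomorphic_tobj[OF W(2) C.isomorphic_refl] Z(3)] XO by auto
  then show "invertible_object C' X"
    using XO W(1) inverse unfolding invertible_object_def by blast
qed

text \<open>
  By dominance a simple object of the third category embeds in the image of a direct sum of
  invertible objects, hence is isomorphic to the image of one of them.
\<close>

lemma F_surjective_on_simples:
  assumes Y: "simple_object C'' Y"
  shows "\<exists>X. simple_object C X \<and> isomorphic C'' Y (fobj F X)"
proof -
  have YO: "Y \<in> Obj C''" "\<not> is_zero_object C'' Y" using Y by (auto simp: simple_object_def)
  obtain X m where X: "X \<in> Obj C" and m: "m \<in> Hom C'' Y (fobj F X)" "is_mono C'' m"
    using exact YO unfolding exact_sequence_def dominant_functor_def by blast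
  have mA: "m \<in> Arr C''" "Dom C'' m = Y" "Cod C'' m = fobj F X" using m by (auto simp: Hom_iff)
  obtain Ss j q where Ss: "\<forall>Z \<in> set Ss. simple_object C Z" and B: "biproduct C Ss X j q"
    using C.semisimple[OF X] by (auto simp: semisimple_object_def is_direct_sum_iff)
  have "m \<noteq> lzero C'' Y (fobj F X)"
  proof
    assume "m = lzero C'' Y (fobj F X)"
    then have "m \<diamondop>\<^bsub>C''\<^esub> ident C'' Y = m \<diamondop>\<^bsub>C''\<^esub> lzero C'' Y Y" using X YO by simp
    moreover have "ident C'' Y \<in> Hom C'' Y (Dom C'' m)" "lzero C'' Y Y \<in> Hom C'' Y (Dom C'' m)"
      using YO mA by (auto simp: Hom_iff)
    ultimately have "ident C'' Y = lzero C'' Y Y"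
      using m(2) unfolding is_mono_def by blast
    then show False using YO C''.is_zero_object_iff by blast
  qed
  moreover have "\<forall>Z \<in> set (map (fobj F) Ss). simple_object C'' Z" using Ss F_simple by auto
  ultimately obtain Z where "Z \<in> set (map (fobj F) Ss)" "isomorphic C'' Y Z"
    using C''.simple_into_biproduct[OF F.F_biproduct[OF B] _ Y m(1)] by blast
  then show ?thesis using Ss by auto
qed

lemma pointed_last: "pointed_category C''"
proof unfold_locales
  fix Y assume "simple_object C'' Y"
  then obtain X where "simple_object C X" "isomorphic C'' Y (fobj F X)"
    using F_surjective_on_simples by blast
  then show "invertible_object C'' Y"
    using C''.invertible_isomorphic[OF C''.isomorphic_sym] F.F_invertible C.simple_invertible by blast
qed

sublocale P': pointed_category C' by (rule pointed_first)
sublocale P'': pointed_category C'' by (rule pointed_last)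

lemma Picard_exact:
  "group_exact_sequence (Picard C') (Picard C) (Picard C'') (iso_class_map C f) (iso_class_map C'' F)"
  unfolding group_exact_sequence_def
proof (intro conjI)
  let ?i = "iso_class_map C f" and ?p = "iso_class_map C'' F"
  show "group (Picard C')" "group (Picard C)" "group (Picard C'')"
    by (rule P'.group_Picard C.group_Picard P''.group_Picard)+
  show "?i \<in> hom (Picard C') (Picard C)" "?p \<in> hom (Picard C) (Picard C'')"
    using f.iso_class_map_hom F.iso_class_map_hom pointed_first pointed_last C.pointed_category_axioms by blast+
  show "inj_on ?i (carrier (Picard C'))"
  proof (rule inj_onI)
    fix A B assume "A \<in> carrier (Picard C')" "B \<in> carrier (Picard C')" and eq: "?i A = ?i B"
    then obtain X Y where XY: "simple_object C' X" "A = iso_class C' X" "simple_object C' Y" "B = iso_class C' Y"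
      by (auto simp: P'.carrier_Picard)
    have Obj: "X \<in> Obj C'" "Y \<in> Obj C'" using XY P'.simple_Obj by auto
    have "isomorphic C (fobj f X) (fobj f Y)"
      using eq XY Obj C.iso_class_eq_iff[of "fobj f X" "fobj f Y"] by (simp add: f.iso_class_map_iso_class)
    then have "isomorphic C' X Y" using f.full_embedding_reflects_isomorphic[OF full Obj] by simp
    then show "A = B" using XY Obj C'.iso_class_eq_iff by simp
  qed
  show "?i ` carrier (Picard C') = Coset.kernel (Picard C) (Picard C'') ?p"
  proof (rule subset_antisym; rule subsetI)
    fix A assume "A \<in> ?i ` carrier (Picard C')"
    then obtain Z where Z: "simple_object C' Z" "A = ?i (iso_class C' Z)"
      by (auto simp: P'.carrier_Picard)
    have ZO: "Z \<in> Obj C'" using Z P'.simple_Obj by simp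
    have fZ: "simple_object C (fobj f Z)" using f_simple_iff[OF ZO] Z by simp
    have A: "A = iso_class C (fobj f Z)" using Z ZO f.iso_class_map_iso_class by simp
    have "isomorphic C'' (fobj F (fobj f Z)) (tunit C'')"
      using simple_kernel_iff[OF fZ] ZO C.isomorphic_refl[of "fobj f Z"] f.F_simps(1)[OF ZO] by blast
    then have "?p A = \<one>\<^bsub>Picard C''\<^esub>"
      using A ZO C''.iso_class_eq_iff by (simp add: F.iso_class_map_iso_class P''.one_Picard)
    then show "A \<in> Coset.kernel (Picard C) (Picard C'') ?p"
      using A fZ by (auto simp: Coset.kernel_def C.carrier_Picard)
  next
    fix A assume "A \<in> Coset.kernel (Picard C) (Picard C'') ?p"
    then obtain X where X: "simple_object C X" "A = iso_class C X" "?p A = \<one>\<^bsub>Picard C''\<^esub>"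
      by (auto simp: Coset.kernel_def C.carrier_Picard)
    have XO: "X \<in> Obj C" using X C.simple_Obj by simp
    have "isomorphic C'' (fobj F X) (tunit C'')"
      using X XO C''.iso_class_eq_iff by (simp add: F.iso_class_map_iso_class P''.one_Picard)
    then obtain Z where Z: "Z \<in> Obj C'" "isomorphic C (fobj f Z) X" using simple_kernel_iff[OF X(1)] by blast
    have "simple_object C' Z"
      using f_simple_iff[OF Z(1)] C.simple_isomorphic[OF C.isomorphic_sym[OF Z(2)] X(1)] by simp
    moreover have "A = ?i (iso_class C' Z)"
      using X Z C.iso_class_eq_iff[of "fobj f Z" X] by (simp add: f.iso_class_map_iso_class)
    ultimately show "A \<in> ?i ` carrier (Picard C')" by (auto simp: P'.carrier_Picard)
  qed
  show "?p ` carrier (Picard C) = carrier (Picard C'')"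
  proof
    show "?p ` carrier (Picard C) \<subseteq> carrier (Picard C'')"
      using C.simple_Obj F_simple by (auto simp: C.carrier_Picard P''.carrier_Picard F.iso_class_map_iso_class)
    show "carrier (Picard C'') \<subseteq> ?p ` carrier (Picard C)"
    proof
      fix A assume "A \<in> carrier (Picard C'')"
      then obtain Y where Y: "simple_object C'' Y" "A = iso_class C'' Y" by (auto simp: P''.carrier_Picard)
      obtain X where X: "simple_object C X" "isomorphic C'' Y (fobj F X)"
        using F_surjective_on_simples[OF Y(1)] by blast
      have "A = ?p (iso_class C X)"
        using X Y C.simple_Obj[OF X(1)] P''.simple_Obj C''.iso_class_eq_iff
        by (simp add: F.iso_class_map_iso_class)
      then show "A \<in> ?p ` carrier (Picard C)" using X by (auto simp: C.carrier_Picard)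
    qed
  qed
qed

text \<open>
  The families on \<open>C\<close> and on \<open>C'\<close> are both transported from one on \<open>C''\<close>. The cocycle on \<open>C'\<close> is
  constant with value \<open>a(1, 1, 1) = 1\<close>, because the composite of the two maps of Picard groups
  is trivial.
\<close>

lemma sequence_is_graded:
  "\<exists>a. a \<in> carrier (cocycles3 (Picard C'')) \<and> normalized3 (Picard C'') a \<and>
    sequences_equivalent
      (Vect (Picard C') \<one>\<^bsub>cocycles3 (Picard C')\<^esub>)
      (Vect (Picard C) (pullback3 (Picard C) (iso_class_map C'' F) a)) (Vect (Picard C'') a)
      (regrade (Picard C) (iso_class_map C f)) (regrade (Picard C'') (iso_class_map C'' F))
      C' C C'' f F"
proof -
  let ?G' = "Picard C'" and ?G = "Picard C" and ?G'' = "Picard C''"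
  let ?i = "iso_class_map C f" and ?p = "iso_class_map C'' F"
  obtain X' where X': "picard_representatives C' X'" using P'.picard_representatives_exist by blast
  obtain X where X: "picard_representatives C X" using C.picard_representatives_exist by blast
  obtain X'' where X'': "picard_representatives C'' X''" using P''.picard_representatives_exist by blast
  interpret X': picard_representatives C' X' by fact
  interpret X: picard_representatives C X by fact
  interpret X'': picard_representatives C'' X'' by fact
  obtain \<mu>'' a \<nu>'' where U'': "unital_family C'' ?G'' X'' \<mu>'' a \<nu>''"
    and a: "a \<in> carrier (cocycles3 ?G'')" "normalized3 ?G'' a"
    using C''.unital_family_exists[OF P''.group_Picard X''.X_Obj _ X''.X_unit X''.X_mult]
      C''.split[OF X''.X_simple] by blast
  let ?b = "pullback3 ?G ?p a"
  obtain \<mu> \<nu> \<theta> where cF: "compatible_families C C'' F ?G X \<mu> ?b \<nu> ?G'' X'' \<mu>'' a \<nu>'' ?p \<theta>"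
    using F.picard_transport[OF X X'' U''] by blast
  then have U: "unital_family C ?G X \<mu> ?b \<nu>"
    by (simp add: compatible_families_def)
  obtain \<mu>' \<nu>' \<theta>' where cf: "compatible_families C' C f ?G' X' \<mu>' (pullback3 ?G' ?i ?b) \<nu>' ?G X \<mu> ?b \<nu> ?i \<theta>'"
    using f.picard_transport[OF X' X U] by blast
  have trivial: "pullback3 ?G' ?i ?b = \<one>\<^bsub>cocycles3 ?G'\<^esub>"
  proof -
    have i: "?i x \<in> carrier ?G" "?p (?i x) = \<one>\<^bsub>?G''\<^esub>" if "x \<in> carrier ?G'" for x
    proof -
      have "?i x \<in> Coset.kernel ?G ?G'' ?p"
        using Picard_exact that unfolding group_exact_sequence_def by blast
      then show "?i x \<in> carrier ?G" "?p (?i x) = \<one>\<^bsub>?G''\<^esub>" by (auto simp: Coset.kernel_def)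
    qed
    have "a (\<one>\<^bsub>?G''\<^esub>, \<one>\<^bsub>?G''\<^esub>, \<one>\<^bsub>?G''\<^esub>) = 1"
      using a(2) group.is_monoid[OF P''.group_Picard] monoid.one_closed unfolding normalized3_def by blast
    then show ?thesis
      by (auto simp: pullback3_def restrict_def fun_eq_iff i)
  qed
  have U': "unital_family C' ?G' X' \<mu>' \<one>\<^bsub>cocycles3 ?G'\<^esub> \<nu>'"
    using cf unfolding trivial by (simp add: compatible_families_def)
  note cf = cf[unfolded trivial]
  obtain S' \<iota>' \<pi>' where R': "skeletal_realization C' ?G' X' \<mu>' \<one>\<^bsub>cocycles3 ?G'\<^esub> \<nu>' S' \<iota>' \<pi>'"
    using X'.skeletal_realization_exists[OF U'] by blast
  obtain S \<iota> \<pi> where R: "skeletal_realization C ?G X \<mu> ?b \<nu> S \<iota> \<pi>"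
    using X.skeletal_realization_exists[OF U] by blast
  obtain S'' \<iota>'' \<pi>'' where R'': "skeletal_realization C'' ?G'' X'' \<mu>'' a \<nu>'' S'' \<iota>'' \<pi>''"
    using X''.skeletal_realization_exists[OF U''] by blast
  interpret R': skeletal_realization C' ?G' X' \<mu>' "\<one>\<^bsub>cocycles3 ?G'\<^esub>" \<nu>' S' \<iota>' \<pi>' by (rule R')
  interpret R: skeletal_realization C ?G X \<mu> ?b \<nu> S \<iota> \<pi> by (rule R)
  interpret R'': skeletal_realization C'' ?G'' X'' \<mu>'' a \<nu>'' S'' \<iota>'' \<pi>'' by (rule R'')
  have iso1: "tensor_functor_isomorphic (Vect ?G' \<one>\<^bsub>cocycles3 ?G'\<^esub>) C
      (comp_tensor_functor C R.realization_functor (regrade ?G ?i))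
      (comp_tensor_functor C f R'.realization_functor)"
    by (rule compatible_realizations.realizations_isomorphic, rule compatible_realizations.intro)
      (rule cf R'.realization_axioms R.realization_axioms)+
  have iso2: "tensor_functor_isomorphic (Vect ?G ?b) C''
      (comp_tensor_functor C'' R''.realization_functor (regrade ?G'' ?p))
      (comp_tensor_functor C'' F R.realization_functor)"
    by (rule compatible_realizations.realizations_isomorphic, rule compatible_realizations.intro)
      (rule cF R.realization_axioms R''.realization_axioms)+
  have "sequences_equivalent (Vect ?G' \<one>\<^bsub>cocycles3 ?G'\<^esub>) (Vect ?G ?b) (Vect ?G'' a)
      (regrade ?G ?i) (regrade ?G'' ?p) C' C C'' f F"
    unfolding sequences_equivalent_def
    using R'.tensor_equivalence_realization R.tensor_equivalence_realization
      R''.tensor_equivalence_realization iso1 iso2 by blast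
  then show ?thesis using a by blast
qed

end

theorem proposition3p6:
  fixes C' :: "('o1, 'm1, 'k :: field) tensor_category_data"
    and C :: "('o2, 'm2, 'k) tensor_category_data"
    and C'' :: "('o3, 'm3, 'k) tensor_category_data"
    and f :: "('o1, 'm1, 'o2, 'm2) tensor_functor_data"
    and F :: "('o2, 'm2, 'o3, 'm3) tensor_functor_data"
  assumes "fusion_category C'" and "fusion_category C" and "fusion_category C''"
    and "exact_sequence C' C C'' f F"
    and "pointed_category C"
  shows "pointed_category C' \<and> pointed_category C'' \<and>
    (let G' = Picard C'; G = Picard C; G'' = Picard C'';
         i = iso_class_map C f; p = iso_class_map C'' F
     in finite (carrier G') \<and> finite (carrier G) \<and> finite (carrier G'') \<and>
        group_exact_sequence G' G G'' i p \<and>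
        (\<exists>\<alpha> \<in> carrier (H3 G'' :: ('o3 set \<times> 'o3 set \<times> 'o3 set \<Rightarrow> 'k) set monoid).
          \<exists>a \<in> \<alpha>. normalized3 G'' a \<and> pullback3 G p a \<in> infl G p \<alpha> \<and>
            sequences_equivalent
              (Vect G' \<one>\<^bsub>cocycles3 G'\<^esub>) (Vect G (pullback3 G p a)) (Vect G'' a)
              (regrade G i) (regrade G'' p)
              C' C C'' f F))"
proof -
  interpret pointed_exact_sequence C' C C'' f F
  proof (intro pointed_exact_sequence.intro pointed_exact_sequence_axioms.intro
      tensor_functor_between.intro tensor_functor_between_axioms.intro)
    show "tensor_functor C' C f" "tensor_functor C C'' F"
      using assms(4) by (simp_all add: exact_sequence_def)
  qed (use assms in \<open>simp_all add: fusion_category_def\<close>)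
  obtain a where a: "a \<in> carrier (cocycles3 (Picard C''))" "normalized3 (Picard C'') a"
    and equiv: "sequences_equivalent
      (Vect (Picard C') \<one>\<^bsub>cocycles3 (Picard C')\<^esub>)
      (Vect (Picard C) (pullback3 (Picard C) (iso_class_map C'' F) a)) (Vect (Picard C'') a)
      (regrade (Picard C) (iso_class_map C f)) (regrade (Picard C'') (iso_class_map C'' F))
      C' C C'' f F"
    using sequence_is_graded by blast
  obtain \<alpha> where \<alpha>: "\<alpha> \<in> carrier (H3 (Picard C''))" "a \<in> \<alpha>"
    using group.cohomology_class_exists[OF P''.group_Picard a(1)] by blast
  have infl: "pullback3 (Picard C) (iso_class_map C'' F) a \<in> infl (Picard C) (iso_class_map C'' F) \<alpha>"
    by (rule group.pullback3_in_infl[OF C.group_Picard \<alpha>(2)])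
  show ?thesis
    unfolding Let_def
    by (intro conjI bexI[OF _ \<alpha>(1)] bexI[OF _ \<alpha>(2)] pointed_first pointed_last
        P'.finite_Picard C.finite_Picard P''.finite_Picard Picard_exact a(2) infl equiv)
qed

end
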